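(* Let $\pi$ be a permutation of size $k$ and let $\mathcal{C}$ be a permutation class. The following are equivalent. (1) There exists a $\mathsf{TOTO}$ formula $\phi(x_1,\dots,x_k)$ such that for every $\sigma\in\mathcal{C}$ and every sequence $\mathbf{s}=(s_1,\dots,s_k)$ of elements of $\sigma$, $(\sigma,\mathbf{s})\models\phi$ if and only if $\mathbf{s}$ is a stable occurrence of $\pi$ in $\sigma$. (2) For each non-trivial cycle $\mathbf{i}$ of distinct elements of $[k+1]$ and each sequence $\overline{\mathcal{X}}$ of the same length as $\mathbf{i}$ whose terms are $\mathcal{I}$ or $\mathcal{D}$, $\mathcal{C}$ does not contain $E(\pi,\mathbf{i},\overline{\mathcal{X}})$, i.e. it avoids at least one permutation in each such class. (3) There is a positive integer $M$ such that whenever $\sigma\in\mathcal{C}$ and $\mathbf{s}$ is a stable occurrence of $\pi$ in $\sigma$, the sum of the non-diagonal entries of $A(\sigma,\mathbf{s})$ is at most $M$.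
   Context: Permutations are viewed as finite structures with domain $A^\sigma=\{(i,\sigma(i))\}$, position order $<_P$ (first coordinates) and value order $<_V$ (second coordinates); $\mathsf{TOTO}$ is first-order logic with equality over $\{<_P,<_V\}$. A permutation class is a set of permutations closed under taking patterns; $\mathcal{I}$ and $\mathcal{D}$ are the classes of increasing and of decreasing permutations. An occurrence of $\pi\in S_k$ in $\sigma$ is a sequence $\mathbf{s}=(s_1,\dots,s_k)$ of elements of $\sigma$ with $s_1<_P\dots<_P s_k$ whose pattern is $\pi$; it is stable if the set of positions of $s_1,\dots,s_k$ is mapped to itself by $\sigma$. An occurrence $\mathbf{s}$ partitions the remaining elements of $\sigma$ into $(k+1)^2$ cells: two elements are in the same cell iff they compare identically with each $s_j$ in both orders; cells form a $(k+1)\times(k+1)$ grid (columns by position relative to $\mathbf{s}$, rows by value, rows indexed bottom to top). $A(\sigma,\mathbf{s})$ is the $(k+1)\times(k+1)$ matrix whose $(i,j)$ entry is the number of elements in the cell in row $i$, column $j$. For a sequence $\mathbf{i}=(i_1,\dots,i_r)$ of distinct elements of $[k+1]$, $A_{\mathbf{i}}$ is the $(k+1)\times(k+1)$ 0/1 matrix with $1$'s exactly at $(i_t,i_{t+1})$, $1\le t<r$, and $(i_r,i_1)$; $\mathbf{i}$ is non-trivial if $r\ge2$. The expansion $E(\pi,\mathbf{i})$ is the permutation of length $k+r$ containing a stable occurrence $\mathbf{s}$ of $\pi$ with $A(E(\pi,\mathbf{i}),\mathbf{s})=A_{\mathbf{i}}$. For permutations $\Theta=(\theta_1,\dots,\theta_r)$,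 $E(\pi,\mathbf{i},\Theta)$ is obtained by inflating the $r$ points of $E(\pi,\mathbf{i})$ not in $\mathbf{s}$, in left-to-right order, by $\theta_1,\dots,\theta_r$ (replacing each point by the diagram of $\theta_t$). For classes $\overline{\mathcal{X}}=(\mathcal{X}_1,\dots,\mathcal{X}_r)$, $E(\pi,\mathbf{i},\overline{\mathcal{X}})$ is the class of all patterns of permutations $E(\pi,\mathbf{i},\Theta)$ with $\theta_t\in\mathcal{X}_t$. *)

theory Defs
  imports "HOL-Combinatorics.Multiset_Permutations"
begin

text \<open>Conventions: all indices start at 0. A permutation of size \<open>n\<close> is given in one-line notation,
  as a list of length \<open>n\<close> containing each of \<open>0, \<dots>, n - 1\<close> once; positions and values both range over
  \<open>{..<n}\<close>, and \<open>\<sigma> ! i\<close> is the value at position \<open>i\<close>.\<close>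

type_synonym point = "nat \<times> nat"

definition is_perm :: "nat list \<Rightarrow> bool" where
  "is_perm \<sigma> \<longleftrightarrow> \<sigma> \<in> permutations_of_set {..<length \<sigma>}"

definition diagram :: "nat list \<Rightarrow> point set" where
  "diagram \<sigma> = {(i, \<sigma> ! i) | i. i < length \<sigma>}"

definition less_P :: "point \<Rightarrow> point \<Rightarrow> bool"  (infix \<open><\<^sub>P\<close> 50) where
  "a <\<^sub>P b \<longleftrightarrow> fst a < fst b"

definition less_V :: "point \<Rightarrow> point \<Rightarrow> bool"  (infix \<open><\<^sub>V\<close> 50) where
  "a <\<^sub>V b \<longleftrightarrow> snd a < snd b"


subsection \<open>The logic TOTO\<close>

text \<open>The remaining connectives and the universal quantifier are definable from these.\<close>

datatype toto =
    Equal nat nat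
  | Less_P nat nat
  | Less_V nat nat
  | Neg toto
  | Conj toto toto
  | Exists nat toto

primrec free_vars :: "toto \<Rightarrow> nat set" where
  "free_vars (Equal x y) = {x, y}"
| "free_vars (Less_P x y) = {x, y}"
| "free_vars (Less_V x y) = {x, y}"
| "free_vars (Neg \<phi>) = free_vars \<phi>"
| "free_vars (Conj \<phi> \<psi>) = free_vars \<phi> \<union> free_vars \<psi>"
| "free_vars (Exists x \<phi>) = free_vars \<phi> - {x}"

text \<open>\<open>satisfies A e \<phi>\<close>: truth of \<open>\<phi>\<close> in the structure with domain \<open>A\<close> under the assignment \<open>e\<close>.\<close>

primrec satisfies :: "point set \<Rightarrow> (nat \<Rightarrow> point) \<Rightarrow> toto \<Rightarrow> bool" where
  "satisfies A e (Equal x y) \<longleftrightarrow> e x = e y"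
| "satisfies A e (Less_P x y) \<longleftrightarrow> e x <\<^sub>P e y"
| "satisfies A e (Less_V x y) \<longleftrightarrow> e x <\<^sub>V e y"
| "satisfies A e (Neg \<phi>) \<longleftrightarrow> \<not> satisfies A e \<phi>"
| "satisfies A e (Conj \<phi> \<psi>) \<longleftrightarrow> satisfies A e \<phi> \<and> satisfies A e \<psi>"
| "satisfies A e (Exists x \<phi>) \<longleftrightarrow> (\<exists>a\<in>A. satisfies A (e(x := a)) \<phi>)"

text \<open>\<open>(\<sigma>, s) \<Turnstile> \<phi>\<close>, where variable \<open>i\<close> is interpreted as \<open>s ! i\<close>. This is meaningful when all free
  variables of \<open>\<phi>\<close> are below \<open>length s\<close>.\<close>

definition models :: "nat list \<Rightarrow> point list \<Rightarrow> toto \<Rightarrow> bool" where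
  "models \<sigma> s \<phi> \<longleftrightarrow> satisfies (diagram \<sigma>) (\<lambda>i. s ! i) \<phi>"


subsection \<open>Patterns and permutation classes\<close>

definition occurrence :: "nat list \<Rightarrow> nat list \<Rightarrow> point list \<Rightarrow> bool" where
  "occurrence \<pi> \<sigma> s \<longleftrightarrow>
     length s = length \<pi> \<and> set s \<subseteq> diagram \<sigma> \<and> sorted_wrt (<\<^sub>P) s \<and>
     (\<forall>a<length \<pi>. \<forall>b<length \<pi>. s ! a <\<^sub>V s ! b \<longleftrightarrow> \<pi> ! a < \<pi> ! b)"

definition stable_occurrence :: "nat list \<Rightarrow> nat list \<Rightarrow> point list \<Rightarrow> bool" where
  "stable_occurrence \<pi> \<sigma> s \<longleftrightarrow>
     occurrence \<pi> \<sigma> s \<and> (\<lambda>i. \<sigma> ! i) ` (fst ` set s) = fst ` set s"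

definition is_pattern :: "nat list \<Rightarrow> nat list \<Rightarrow> bool" where
  "is_pattern \<pi> \<sigma> \<longleftrightarrow> (\<exists>s. occurrence \<pi> \<sigma> s)"

definition perm_class :: "nat list set \<Rightarrow> bool" where
  "perm_class C \<longleftrightarrow>
     (\<forall>\<sigma>\<in>C. is_perm \<sigma>) \<and> (\<forall>\<sigma>\<in>C. \<forall>\<tau>. is_perm \<tau> \<and> is_pattern \<tau> \<sigma> \<longrightarrow> \<tau> \<in> C)"

definition increasing_perms :: "nat list set" where
  "increasing_perms = {\<sigma>. is_perm \<sigma> \<and> sorted_wrt (<) \<sigma>}"

definition decreasing_perms :: "nat list set" where
  "decreasing_perms = {\<sigma>. is_perm \<sigma> \<and> sorted_wrt (>) \<sigma>}"


subsection \<open>Cells and expansions\<close>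

text \<open>Row \<open>i\<close> consists of the elements with exactly \<open>i\<close> elements of \<open>s\<close> below them, and column \<open>j\<close> of
  those with exactly \<open>j\<close> elements of \<open>s\<close> to their left; so \<open>i\<close> and \<open>j\<close> range over \<open>{..length s}\<close>.\<close>

definition cell :: "nat list \<Rightarrow> point list \<Rightarrow> nat \<Rightarrow> nat \<Rightarrow> point set" where
  "cell \<sigma> s i j =
     {x \<in> diagram \<sigma> - set s. card {y \<in> set s. y <\<^sub>V x} = i \<and> card {y \<in> set s. y <\<^sub>P x} = j}"

definition cell_matrix :: "nat list \<Rightarrow> point list \<Rightarrow> nat \<Rightarrow> nat \<Rightarrow> nat" where
  "cell_matrix \<sigma> s i j = card (cell \<sigma> s i j)"

definition cycle_matrix :: "nat list \<Rightarrow> nat \<Rightarrow> nat \<Rightarrow> nat" where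
  "cycle_matrix c i j =
     (if \<exists>t<length c. i = c ! t \<and> j = c ! (Suc t mod length c) then 1 else 0)"

text \<open>\<open>is_expansion \<pi> c \<epsilon> s\<close>: \<open>\<epsilon>\<close> is the expansion of \<open>\<pi>\<close> by the cycle \<open>c\<close>, and \<open>s\<close> is the stable
  occurrence of \<open>\<pi>\<close> in it. For distinct \<open>c\<close> with entries at most \<open>length \<pi>\<close>, each row and each column
  contains at most one point outside \<open>s\<close>, so \<open>\<epsilon>\<close> and \<open>s\<close> exist and are uniquely determined.\<close>

definition is_expansion :: "nat list \<Rightarrow> nat list \<Rightarrow> nat list \<Rightarrow> point list \<Rightarrow> bool" where
  "is_expansion \<pi> c \<epsilon> s \<longleftrightarrow>
     is_perm \<epsilon> \<and> length \<epsilon> = length \<pi> + length c \<and> stable_occurrence \<pi> \<epsilon> s \<and>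
     (\<forall>i\<le>length \<pi>. \<forall>j\<le>length \<pi>. cell_matrix \<epsilon> s i j = cycle_matrix c i j)"

text \<open>Inflation of the point at position \<open>p\<close> by \<open>\<alpha>s ! p\<close>, for all \<open>p\<close> at once: the values of a block are
  shifted up by the total size of the blocks replacing lower points.\<close>

definition inflate :: "nat list \<Rightarrow> nat list list \<Rightarrow> nat list" where
  "inflate \<sigma> \<alpha>s =
     concat (map (\<lambda>p. map (\<lambda>v. (\<Sum>q | q < length \<sigma> \<and> \<sigma> ! q < \<sigma> ! p. length (\<alpha>s ! q)) + v) (\<alpha>s ! p))
       [0..<length \<sigma>])"

text \<open>Inflation of the points not in \<open>s\<close>, from left to right, by the terms of \<open>\<Theta>\<close>; the points of \<open>s\<close> are
  kept, i.e. inflated by the permutation \<open>[0]\<close> of size 1.\<close>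

definition inflate_outside :: "nat list \<Rightarrow> point list \<Rightarrow> nat list list \<Rightarrow> nat list" where
  "inflate_outside \<sigma> s \<Theta> =
     inflate \<sigma> (map (\<lambda>p. if p \<in> fst ` set s then [0] else \<Theta> ! card ({..<p} - fst ` set s))
       [0..<length \<sigma>])"

definition expansion_class :: "nat list \<Rightarrow> nat list \<Rightarrow> nat list set list \<Rightarrow> nat list set" where
  "expansion_class \<pi> c Xs =
     {\<tau>. is_perm \<tau> \<and>
       (\<exists>\<epsilon> s \<Theta>. is_expansion \<pi> c \<epsilon> s \<and> length \<Theta> = length c \<and> (\<forall>t<length c. \<Theta> ! t \<in> Xs ! t) \<and>
          is_pattern \<tau> (inflate_outside \<epsilon> s \<Theta>))}"


subsection \<open>The three conditions\<close>

definition stable_occurrences_definable :: "nat list \<Rightarrow> nat list set \<Rightarrow> bool" where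
  "stable_occurrences_definable \<pi> C \<longleftrightarrow>
     (\<exists>\<phi>. free_vars \<phi> \<subseteq> {..<length \<pi>} \<and>
       (\<forall>\<sigma>\<in>C. \<forall>s. length s = length \<pi> \<and> set s \<subseteq> diagram \<sigma> \<longrightarrow>
          (models \<sigma> s \<phi> \<longleftrightarrow> stable_occurrence \<pi> \<sigma> s)))"

definition contains_no_expansion_class :: "nat list \<Rightarrow> nat list set \<Rightarrow> bool" where
  "contains_no_expansion_class \<pi> C \<longleftrightarrow>
     (\<forall>c Xs. distinct c \<and> set c \<subseteq> {..length \<pi>} \<and> 2 \<le> length c \<and>
        length Xs = length c \<and> set Xs \<subseteq> {increasing_perms, decreasing_perms} \<longrightarrow>
        \<not> expansion_class \<pi> c Xs \<subseteq> C)"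

definition off_diagonal_bounded :: "nat list \<Rightarrow> nat list set \<Rightarrow> bool" where
  "off_diagonal_bounded \<pi> C \<longleftrightarrow>
     (\<exists>M::nat. 0 < M \<and>
       (\<forall>\<sigma>\<in>C. \<forall>s. stable_occurrence \<pi> \<sigma> s \<longrightarrow>
          (\<Sum>i\<le>length \<pi>. \<Sum>j\<in>{..length \<pi>} - {i}. cell_matrix \<sigma> s i j) \<le> M))"

end

theory Submission
  imports Defs "HOL-Library.Ramsey" "HOL-Library.Transitive_Closure_Table"
begin

text \<open>
  (3) implies (1): an occurrence is stable iff each of its elements, listed by value, has the position
  of the element of the same rank listed by position. The two numbers to be compared differ from a
  common part only by off-diagonal elements, so with a bound on these the comparison is first-order.

  (1) implies (2): in an inflated expansion all of whose blocks are long compared with the quantifier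
  rank of the formula, deleting one point of a block cannot be noticed by the formula. The
  remaining permutation is still in the class, but the deletion unbalances row and column sums
  and destroys stability.

  (2) implies (3): stability makes the cell matrix a balanced weighted digraph. If a large
  off-diagonal entry \<open>(i, j)\<close> could not be closed to a cycle of large entries, then the vertices reachable
  from \<open>j\<close> along large entries would receive more than they lose. Ramsey's theorem gives long
  monotone sets in the cells of such a cycle, and by the pigeonhole principle one cycle with one
  choice of directions occurs for arbitrarily long sets.
\<close>

section \<open>Permutation diagrams\<close>

text \<open>First-order logic cannot count, so positions and values are not accessible one by one;
  only differences between them are, and only while these stay bounded. For (1) to (2) a single
  member of the expansion class is enough, with all blocks of length \<open>2 ^ q\<close>, where
  \<open>q\<close> is the quantifier rank. The common length keeps the copy of \<open>s\<close>
  stable: \<epsilon> sends positions outside \<open>s\<close> to values outside \<open>s\<close>, so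
  inflating shifts the positions and the values of \<open>s\<close> in the same way. Non-triviality
  of the cycle supplies a block off the diagonal; removing a point of a diagonal cell would shift as
  many positions of \<open>s\<close> as values. For (2) to (3) the difficulty is uniformity: a cycle
  and its directions are found for each size separately. The directions are recorded as the set of
  columns with an increasing cell, because the blocks of an expansion are listed from left to right,
  in the order of the columns and not in that of the cycle.\<close>

lemma is_perm_alt: "is_perm \<sigma> \<longleftrightarrow> distinct \<sigma> \<and> set \<sigma> = {..<length \<sigma>}"
  by (auto simp: is_perm_def permutations_of_set_def)

lemma is_permI:
  assumes "distinct \<sigma>" "set \<sigma> \<subseteq> {..<length \<sigma>}"
  shows "is_perm \<sigma>"
  using assms card_subset_eq[of "{..<length \<sigma>}" "set \<sigma>"]
  by (auto simp: is_perm_alt distinct_card)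

lemma is_perm_nth_less: "is_perm \<sigma> \<Longrightarrow> i < length \<sigma> \<Longrightarrow> \<sigma> ! i < length \<sigma>"
  using nth_mem[of i \<sigma>] by (auto simp: is_perm_alt)

lemma is_perm_nth_eq_iff:
  "is_perm \<sigma> \<Longrightarrow> i < length \<sigma> \<Longrightarrow> j < length \<sigma> \<Longrightarrow> \<sigma> ! i = \<sigma> ! j \<longleftrightarrow> i = j"
  by (auto simp: is_perm_alt nth_eq_iff_index_eq)

lemma is_perm_bij: "is_perm \<sigma> \<Longrightarrow> bij_betw ((!) \<sigma>) {..<length \<sigma>} {..<length \<sigma>}"
  by (simp add: bij_betw_nth is_perm_alt)

lemma mem_diagram_iff: "x \<in> diagram \<sigma> \<longleftrightarrow> fst x < length \<sigma> \<and> snd x = \<sigma> ! fst x"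
  by (cases x) (auto simp: diagram_def)

lemma diagram_image: "diagram \<sigma> = (\<lambda>i. (i, \<sigma> ! i)) ` {..<length \<sigma>}"
  by (auto simp: diagram_def)

lemma finite_diagram [simp]: "finite (diagram \<sigma>)"
  by (simp add: diagram_image)

lemma inj_on_fst_diagram: "inj_on fst (diagram \<sigma>)"
  by (auto simp: diagram_def inj_on_def)

lemma inj_on_snd_diagram: "is_perm \<sigma> \<Longrightarrow> inj_on snd (diagram \<sigma>)"
  by (auto simp: diagram_def inj_on_def is_perm_nth_eq_iff)

lemma fst_diagram: "fst ` diagram \<sigma> = {..<length \<sigma>}"
  by (auto simp: diagram_image image_image)

lemma snd_diagram: "is_perm \<sigma> \<Longrightarrow> snd ` diagram \<sigma> = {..<length \<sigma>}"
  using bij_betw_imp_surj_on[OF is_perm_bij[of \<sigma>]] by (simp add: diagram_image image_image)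

lemma less_P_neq: "a <\<^sub>P b \<Longrightarrow> a \<noteq> b"
  by (auto simp: less_P_def)

lemma diagram_eq_iff_fst: "a \<in> diagram \<sigma> \<Longrightarrow> b \<in> diagram \<sigma> \<Longrightarrow> fst a = fst b \<longleftrightarrow> a = b"
  using inj_on_fst_diagram by (auto dest: inj_onD)

lemma diagram_eq_iff_snd:
  "is_perm \<sigma> \<Longrightarrow> a \<in> diagram \<sigma> \<Longrightarrow> b \<in> diagram \<sigma> \<Longrightarrow> snd a = snd b \<longleftrightarrow> a = b"
  using inj_on_snd_diagram by (auto dest: inj_onD)

section \<open>Occurrences and their transport\<close>

lemma occurrence_nth_P:
  assumes "occurrence \<pi> \<sigma> s" "a < length \<pi>" "b < length \<pi>"
  shows "s ! a <\<^sub>P s ! b \<longleftrightarrow> a < b"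
proof -
  have *: "s ! i <\<^sub>P s ! j" if "i < j" "j < length \<pi>" for i j
    using assms(1) that by (auto simp: occurrence_def sorted_wrt_iff_nth_less)
  show ?thesis
    using *[of a b] *[of b a] assms(2,3) by (cases a b rule: linorder_cases) (auto simp: less_P_def)
qed

lemma occurrence_nth_V:
  "occurrence \<pi> \<sigma> s \<Longrightarrow> a < length \<pi> \<Longrightarrow> b < length \<pi> \<Longrightarrow> s ! a <\<^sub>V s ! b \<longleftrightarrow> \<pi> ! a < \<pi> ! b"
  by (auto simp: occurrence_def)

lemma occurrence_distinct: "occurrence \<pi> \<sigma> s \<Longrightarrow> distinct s"
proof -
  assume o: "occurrence \<pi> \<sigma> s"
  have "i = j" if "i < length s" "j < length s" "s ! i = s ! j" for i j
    using occurrence_nth_P[OF o, of i j] occurrence_nth_P[OF o, of j i] o that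
    by (auto simp: less_P_def occurrence_def)
  then show ?thesis
    by (auto simp: distinct_conv_nth)
qed

lemma occurrence_nth_mem: "occurrence \<pi> \<sigma> s \<Longrightarrow> a < length \<pi> \<Longrightarrow> s ! a \<in> diagram \<sigma>"
  by (metis nth_mem occurrence_def subsetD)

text \<open>Only the relative order of the chosen points matters. This serves for undoing a
  standardization, for passing from an expansion to its inflation, and for embedding an inflation
  into a member of the class.\<close>

lemma occurrence_map:
  assumes "occurrence \<tau> \<sigma> u" "\<And>x. x \<in> set u \<Longrightarrow> G x \<in> diagram \<sigma>'"
    and "\<And>x y. x \<in> set u \<Longrightarrow> y \<in> set u \<Longrightarrow> x <\<^sub>P y \<longleftrightarrow> G x <\<^sub>P G y"
    and "\<And>x y. x \<in> set u \<Longrightarrow> y \<in> set u \<Longrightarrow> x <\<^sub>V y \<longleftrightarrow> G x <\<^sub>V G y"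
  shows "occurrence \<tau> \<sigma>' (map G u)"
proof -
  have len: "length u = length \<tau>"
    using assms(1) by (auto simp: occurrence_def)
  have *: "G (u ! i) <\<^sub>P G (u ! j) \<longleftrightarrow> u ! i <\<^sub>P u ! j" "G (u ! i) <\<^sub>V G (u ! j) \<longleftrightarrow> u ! i <\<^sub>V u ! j"
    if "i < length \<tau>" "j < length \<tau>" for i j
    using assms(3,4)[of "u ! i" "u ! j"] that len by auto
  show ?thesis
    unfolding occurrence_def using assms(1,2) occurrence_nth_P[OF assms(1)] occurrence_nth_V[OF assms(1)]
    by (auto simp: * len sorted_wrt_iff_nth_less)
qed

text \<open>The elements of \<open>s\<close> are pairs \<open>(p, \<sigma> ! p)\<close>, so applying
  \<sigma> to their positions yields their values. In this form stability depends on the points of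
  \<open>s\<close> alone.\<close>

lemma stable_occurrence_alt:
  "stable_occurrence \<pi> \<sigma> s \<longleftrightarrow> occurrence \<pi> \<sigma> s \<and> snd ` set s = fst ` set s"
proof -
  have "(\<lambda>i. \<sigma> ! i) ` (fst ` set s) = snd ` set s" if "occurrence \<pi> \<sigma> s"
    using that by (force simp: occurrence_def mem_diagram_iff image_image intro!: image_cong)
  then show ?thesis
    by (simp add: stable_occurrence_def cong: conj_cong)
qed

section \<open>Cell coordinates relative to an occurrence\<close>

definition row :: "point list \<Rightarrow> point \<Rightarrow> nat" where
  "row s x = card {y \<in> set s. y <\<^sub>V x}"

definition col :: "point list \<Rightarrow> point \<Rightarrow> nat" where
  "col s x = card {y \<in> set s. y <\<^sub>P x}"

lemma cell_alt: "cell \<sigma> s i j = {x \<in> diagram \<sigma> - set s. row s x = i \<and> col s x = j}"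
  by (auto simp: cell_def row_def col_def)

lemma row_le: "row s x \<le> length s" and col_le: "col s x \<le> length s"
  by (auto simp: row_def col_def intro!: order.trans[OF card_mono[OF finite_set] card_length])

lemma finite_cell [simp]: "finite (cell \<sigma> s i j)"
  by (simp add: cell_def)

text \<open>Read through the bijection \<open>p\<close>, the set \<open>D\<close> is an initial
  segment of \<open>{..<k}\<close>, hence determined by its size. The keys used later are the index
  in \<open>s\<close> for positions and \<pi> for values.\<close>

lemma down_closed_subset:
  fixes p :: "'a \<Rightarrow> nat"
  assumes "inj_on p K" "p ` K = {..<k}" "D \<subseteq> K" "\<And>a b. a \<in> D \<Longrightarrow> b \<in> K \<Longrightarrow> p b < p a \<Longrightarrow> b \<in> D"
    and "a \<in> K"
  shows "a \<in> D \<longleftrightarrow> p a < card D"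
proof -
  have fin: "finite K"
    using assms(1,2) finite_imageD[of p K] by simp
  have 1: "p ` D \<subseteq> {..<k}"
    using assms(2,3) by auto
  have cD: "card (p ` D) = card D"
    using assms(1,3) by (meson card_image inj_on_subset)
  have down: "i \<in> p ` D" if less: "i < j" and j: "j \<in> p ` D" for i j
  proof -
    obtain d where d: "d \<in> D" "j = p d"
      using j by auto
    have "j < k"
      using 1 j by auto
    then have "i \<in> p ` K"
      using less assms(2) by auto
    then obtain b where b: "b \<in> K" "i = p b"
      by auto
    then have "b \<in> D"
      using assms(4)[OF d(1) b(1)] d b less by auto
    then show ?thesis
      using b by auto
  qed
  have fD: "finite (p ` D)"
    using 1 finite_subset by blast
  have eq: "p ` D = {..<card D}"
  proof -
    have sub: "p ` D \<subseteq> {..<card D}"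
    proof
      fix j assume j: "j \<in> p ` D"
      have "{..j} \<subseteq> p ` D"
        using down j by (metis atMost_iff le_eq_less_or_eq subsetI)
      then have "card {..j} \<le> card (p ` D)"
        by (rule card_mono[OF fD])
      then show "j \<in> {..<card D}"
        using cD by auto
    qed
    show ?thesis
      using card_subset_eq[OF _ sub] cD by simp
  qed
  show ?thesis
    using inj_on_image_mem_iff[OF assms(1,5,3)] eq by auto
qed

text \<open>The elements of \<open>s\<close> to the left of \<open>x\<close> come first in
  \<open>s\<close>, so their number says which ones they are. Thus points of different permutations
  with equal coordinates compare alike with the respective occurrences.\<close>

lemma nth_less_P_iff:
  assumes "occurrence \<pi> \<sigma> s" "a < length \<pi>"
  shows "s ! a <\<^sub>P x \<longleftrightarrow> a < col s x"
proof -
  let ?D = "{a. a < length \<pi> \<and> s ! a <\<^sub>P x}"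
  have len: "length s = length \<pi>"
    using assms by (auto simp: occurrence_def)
  have "{y \<in> set s. y <\<^sub>P x} = (!) s ` ?D"
    by (auto simp: in_set_conv_nth len intro: rev_image_eqI)
  moreover have "inj_on ((!) s) ?D"
    using occurrence_distinct[OF assms(1)] by (auto simp: inj_on_def nth_eq_iff_index_eq len)
  ultimately have "card ?D = col s x"
    by (simp add: col_def card_image)
  moreover have "a \<in> ?D \<longleftrightarrow> id a < card ?D"
  proof (rule down_closed_subset[where K = "{..<length \<pi>}"])
    show "b \<in> ?D" if "a \<in> ?D" "b \<in> {..<length \<pi>}" "id b < id a" for a b
      using that occurrence_nth_P[OF assms(1), of b a] by (auto simp: less_P_def)
  qed (use assms in auto)
  ultimately show ?thesis
    using assms(2) by auto
qed

text \<open>As for positions, except that \<open>s ! a\<close> has rank \<open>\<pi> ! a\<close> by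
  value, so \<pi> is the key.\<close>

lemma nth_less_V_iff:
  assumes "is_perm \<pi>" "occurrence \<pi> \<sigma> s" "a < length \<pi>"
  shows "s ! a <\<^sub>V x \<longleftrightarrow> \<pi> ! a < row s x"
proof -
  let ?D = "{a. a < length \<pi> \<and> s ! a <\<^sub>V x}"
  have len: "length s = length \<pi>"
    using assms by (auto simp: occurrence_def)
  have "{y \<in> set s. y <\<^sub>V x} = (!) s ` ?D"
    by (auto simp: in_set_conv_nth len intro: rev_image_eqI)
  moreover have "inj_on ((!) s) ?D"
    using occurrence_distinct[OF assms(2)] by (auto simp: inj_on_def nth_eq_iff_index_eq len)
  ultimately have "card ?D = row s x"
    by (simp add: row_def card_image)
  moreover have "a \<in> ?D \<longleftrightarrow> (!) \<pi> a < card ?D"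
  proof (rule down_closed_subset[where K = "{..<length \<pi>}" and k = "length \<pi>"])
    show "b \<in> ?D" if "a \<in> ?D" "b \<in> {..<length \<pi>}" "\<pi> ! b < \<pi> ! a" for a b
      using that occurrence_nth_V[OF assms(2), of b a] by (auto simp: less_V_def)
  qed (use assms is_perm_bij[of \<pi>] in \<open>auto simp: bij_betw_def\<close>)
  ultimately show ?thesis
    using assms(3) by auto
qed

text \<open>Moving to the right can only add elements of \<open>s\<close> on the left, so points in
  different columns are ordered like their columns.\<close>

lemma less_P_of_col_less: 
  assumes "col s x < col s y"
  shows "x <\<^sub>P y"
proof (rule ccontr)
  assume "\<not> x <\<^sub>P y"
  then have "{z \<in> set s. z <\<^sub>P y} \<subseteq> {z \<in> set s. z <\<^sub>P x}"
    by (auto simp: less_P_def)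
  then have "col s y \<le> col s x"
    by (simp add: col_def card_mono)
  then show False
    using assms by simp
qed

lemma less_V_of_row_less: 
  assumes "row s x < row s y"
  shows "x <\<^sub>V y"
proof (rule ccontr)
  assume "\<not> x <\<^sub>V y"
  then have "{z \<in> set s. z <\<^sub>V y} \<subseteq> {z \<in> set s. z <\<^sub>V x}"
    by (auto simp: less_V_def)
  then have "row s y \<le> row s x"
    by (simp add: row_def card_mono)
  then show False
    using assms by simp
qed

text \<open>The cells are disjoint and exhaust the points outside \<open>s\<close>, which turns the
  double sum into the size of one set.\<close>

lemma off_diagonal_sum:
  assumes "length s = k"
  shows "(\<Sum>i\<le>k. \<Sum>j\<in>{..k} - {i}. cell_matrix \<sigma> s i j)
    = card {x \<in> diagram \<sigma> - set s. row s x \<noteq> col s x}"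
proof -
  have "{x \<in> diagram \<sigma> - set s. row s x \<noteq> col s x}
      = (\<Union>ij \<in> (SIGMA i:{..k}. {..k} - {i}). cell \<sigma> s (fst ij) (snd ij))"
    using row_le[of s] col_le[of s] assms by (auto simp: cell_alt)
  also have "card \<dots> = (\<Sum>ij \<in> (SIGMA i:{..k}. {..k} - {i}). card (cell \<sigma> s (fst ij) (snd ij)))"
    by (rule card_UN_disjoint) (auto simp: cell_alt)
  also have "\<dots> = (\<Sum>i\<le>k. \<Sum>j\<in>{..k} - {i}. cell_matrix \<sigma> s i j)"
    by (simp add: sum.Sigma cell_matrix_def split_def)
  finally show ?thesis
    by simp
qed

text \<open>Counting numbers in place of points makes rows and columns comparable: for a stable
  occurrence the sets of numbers counted here and in \<open>col_alt\<close> coincide.\<close>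

lemma row_alt:
  assumes "is_perm \<sigma>" "set s \<subseteq> diagram \<sigma>"
  shows "row s x = card {f \<in> snd ` set s. f < snd x}"
proof -
  have "{f \<in> snd ` set s. f < snd x} = snd ` {y \<in> set s. y <\<^sub>V x}"
    by (auto simp: less_V_def)
  then show ?thesis
    using card_image[OF inj_on_subset[OF inj_on_snd_diagram[OF assms(1)], of "{y \<in> set s. y <\<^sub>V x}"]]
      assms(2) by (simp add: row_def subset_iff)
qed

lemma col_alt:
  assumes "set s \<subseteq> diagram \<sigma>"
  shows "col s x = card {f \<in> fst ` set s. f < fst x}"
proof -
  have "{f \<in> fst ` set s. f < fst x} = fst ` {y \<in> set s. y <\<^sub>P x}"
    by (auto simp: less_P_def)
  then show ?thesis
    using card_image[OF inj_on_subset[OF inj_on_fst_diagram[of \<sigma>], of "{y \<in> set s. y <\<^sub>P x}"]]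
      assms by (simp add: col_def subset_iff)
qed

text \<open>Stability makes the positions and the values of \<open>s\<close> the same set, so both line sums count
  the numbers outside this set with exactly \<open>i\<close> of its elements below.\<close>

lemma row_sum_eq_col_sum:
  assumes "is_perm \<sigma>" "stable_occurrence \<pi> \<sigma> s" "i \<le> length \<pi>"
  shows "(\<Sum>j\<le>length \<pi>. cell_matrix \<sigma> s i j) = (\<Sum>j\<le>length \<pi>. cell_matrix \<sigma> s j i)"
proof -
  let ?k = "length \<pi>" and ?F = "fst ` set s"
  let ?Z = "{p \<in> {..<length \<sigma>} - ?F. card {f \<in> ?F. f < p} = i}"
  have sub: "set s \<subseteq> diagram \<sigma>" and len: "length s = ?k" and F: "snd ` set s = ?F"
    using assms(2) by (auto simp: stable_occurrence_alt occurrence_def)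
  have row: "row s x = card {f \<in> ?F. f < snd x}" for x
    using row_alt[OF assms(1) sub] by (simp add: F)
  have col: "col s x = card {f \<in> ?F. f < fst x}" for x
    using col_alt[OF sub] .
  have "(\<Sum>j\<le>?k. cell_matrix \<sigma> s i j) = card (\<Union>j\<le>?k. cell \<sigma> s i j)"
    unfolding cell_matrix_def by (rule card_UN_disjoint[symmetric]) (auto simp: cell_alt)
  also have "(\<Union>j\<le>?k. cell \<sigma> s i j) = {x \<in> diagram \<sigma> - set s. row s x = i}"
    using col_le[of s] by (auto simp: cell_alt len)
  also have "card \<dots> = card (snd ` \<dots>)"
    by (rule card_image[symmetric], rule inj_on_subset[OF inj_on_snd_diagram[OF assms(1)]]) auto
  also have "snd ` {x \<in> diagram \<sigma> - set s. row s x = i} = ?Z"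
  proof -
    have "snd ` (diagram \<sigma> - set s) = {..<length \<sigma>} - ?F"
      using inj_on_image_set_diff[OF inj_on_snd_diagram[OF assms(1)] _ sub, of "diagram \<sigma>"]
      by (simp add: snd_diagram[OF assms(1)] F)
    then show ?thesis
      unfolding row by auto
  qed
  also have "?Z = fst ` {x \<in> diagram \<sigma> - set s. col s x = i}"
  proof -
    have "fst ` (diagram \<sigma> - set s) = {..<length \<sigma>} - ?F"
      using inj_on_image_set_diff[OF inj_on_fst_diagram _ sub, of "diagram \<sigma>"]
      by (simp add: fst_diagram)
    then show ?thesis
      unfolding col by auto
  qed
  also have "card \<dots> = card {x \<in> diagram \<sigma> - set s. col s x = i}"
    by (rule card_image, rule inj_on_subset[OF inj_on_fst_diagram]) auto
  also have "\<dots> = card (\<Union>j\<le>?k. cell \<sigma> s j i)"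
    using row_le[of s] by (intro arg_cong[where f = card]) (auto simp: cell_alt len)
  also have "\<dots> = (\<Sum>j\<le>?k. cell_matrix \<sigma> s j i)"
    unfolding cell_matrix_def by (rule card_UN_disjoint) (auto simp: cell_alt)
  finally show ?thesis .
qed

section \<open>First-order definability\<close>

lemma satisfies_cong:
  "(\<And>x. x \<in> free_vars \<phi> \<Longrightarrow> e x = e' x) \<Longrightarrow> satisfies A e \<phi> \<longleftrightarrow> satisfies A e' \<phi>"
proof (induction \<phi> arbitrary: e e')
  case (Exists x \<phi>)
  have "satisfies A (e(x := a)) \<phi> \<longleftrightarrow> satisfies A (e'(x := a)) \<phi>" for a
    using Exists.prems by (intro Exists.IH) auto
  then show ?case
    by simp
next
  case (Conj \<phi> \<psi>)
  then show ?case
    by (metis UnCI free_vars.simps(5) satisfies.simps(5))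
next
  case (Neg \<phi>)
  then show ?case
    by (metis free_vars.simps(4) satisfies.simps(4))
qed (metis free_vars.simps(1-3) insertCI satisfies.simps(1-3))+

text \<open>Isomorphic structures satisfy the same formulas. Assignments are total, so every
  variable must have its value in \<open>A\<close>; partial assignments have to be padded before
  this is applied.\<close>

lemma satisfies_image:
  assumes "inj_on f A"
    and "\<And>x y. x \<in> A \<Longrightarrow> y \<in> A \<Longrightarrow> f x <\<^sub>P f y \<longleftrightarrow> x <\<^sub>P y"
    and "\<And>x y. x \<in> A \<Longrightarrow> y \<in> A \<Longrightarrow> f x <\<^sub>V f y \<longleftrightarrow> x <\<^sub>V y"
    and "\<And>i. e i \<in> A"
  shows "satisfies (f ` A) (f \<circ> e) \<phi> \<longleftrightarrow> satisfies A e \<phi>"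
  using assms(4)
proof (induction \<phi> arbitrary: e)
  case (Equal x y)
  then show ?case
    using assms(1) by (auto dest: inj_onD)
next
  case (Exists x \<phi>)
  have "satisfies (f ` A) ((f \<circ> e)(x := f a)) \<phi> \<longleftrightarrow> satisfies A (e(x := a)) \<phi>" if "a \<in> A" for a
  proof -
    have "(f \<circ> e)(x := f a) = f \<circ> e(x := a)"
      by auto
    then show ?thesis
      using Exists.prems that by (simp only:) (rule Exists.IH, simp)
  qed
  then show ?case
    by (auto simp: o_def)
qed (use assms(2,3) in auto)

text \<open>Stated for predicates, so that the formula needed in the end is assembled by closure
  rules and never written out. The conditions on \<open>A\<close> hold for diagrams of permutations
  and are what counting by descent relies on.\<close>

definition definable :: "nat \<Rightarrow> (point set \<Rightarrow> (nat \<Rightarrow> point) \<Rightarrow> bool) \<Rightarrow> bool" where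
  "definable k Q \<longleftrightarrow> (\<exists>\<phi>. free_vars \<phi> \<subseteq> {..<k} \<and>
     (\<forall>A e. finite A \<and> inj_on fst A \<and> inj_on snd A \<longrightarrow> (satisfies A e \<phi> \<longleftrightarrow> Q A e)))"

lemma definable_Not: "definable k Q \<Longrightarrow> definable k (\<lambda>A e. \<not> Q A e)"
  unfolding definable_def by (metis free_vars.simps(4) satisfies.simps(4))

lemma definable_conj: "definable k Q \<Longrightarrow> definable k R \<Longrightarrow> definable k (\<lambda>A e. Q A e \<and> R A e)"
  unfolding definable_def
proof (elim exE conjE, goal_cases)
  case (1 \<phi> \<psi>)
  then show ?case
    by (intro exI[of _ "Conj \<phi> \<psi>"]) auto
qed

lemma definable_True: "definable k (\<lambda>A e. True)"
  \<comment> \<open>A closed sentence, so that the case \<open>k = 0\<close> is covered.\<close>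
  unfolding definable_def by (rule exI[of _ "Neg (Exists 0 (Neg (Equal 0 0)))"]) auto

lemma definable_const: "definable k (\<lambda>A e. b)"
  using definable_True definable_Not[OF definable_True] by (cases b) auto

lemma definable_iff:
  assumes "definable k Q" "definable k R"
  shows "definable k (\<lambda>A e. Q A e \<longleftrightarrow> R A e)"
proof -
  have "(\<lambda>A e. Q A e \<longleftrightarrow> R A e) = (\<lambda>A e. \<not> (Q A e \<and> \<not> R A e) \<and> \<not> (\<not> Q A e \<and> R A e))"
    by auto
  then show ?thesis
    using assms by (simp only:) (intro definable_conj definable_Not)
qed

lemma definable_All_less:
  assumes "\<And>i. i < n \<Longrightarrow> definable k (Q i)"
  shows "definable k (\<lambda>A e. \<forall>i<(n::nat). Q i A e)"
  using assms
proof (induction n)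
  case 0
  then show ?case
    by (simp add: definable_True)
next
  case (Suc n)
  then have "definable k (\<lambda>A e. (\<forall>i<n. Q i A e) \<and> Q n A e)"
    by (intro definable_conj) auto
  then show ?case
    by (simp add: All_less_Suc conj_commute)
qed

lemma definable_Ex_less:
  assumes "\<And>i. i < n \<Longrightarrow> definable k (Q i)"
  shows "definable k (\<lambda>A e. \<exists>i<(n::nat). Q i A e)"
  using definable_Not[OF definable_All_less[OF definable_Not[OF assms]]] by simp

lemma definable_atomic:
  assumes "a < k" "b < k"
  shows "definable k (\<lambda>A e. e a <\<^sub>P e b)" "definable k (\<lambda>A e. e a <\<^sub>V e b)"
  unfolding definable_def
  by (intro exI[of _ "Less_P a b"], simp add: assms) (intro exI[of _ "Less_V a b"], simp add: assms)

text \<open>\<open>at_least k R S n z b\<close> says that at least \<open>n\<close> elements are \<open>R\<close>-below \<open>z\<close> and not \<open>S\<close>-below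
  \<open>b\<close>. It descends from the \<open>R\<close>-largest such element and binds the variables \<open>k, \<dots>, k + n - 1\<close>.\<close>

primrec at_least ::
    "nat \<Rightarrow> (nat \<Rightarrow> nat \<Rightarrow> toto) \<Rightarrow> (nat \<Rightarrow> nat \<Rightarrow> toto) \<Rightarrow> nat \<Rightarrow> nat \<Rightarrow> nat \<Rightarrow> toto" where
  "at_least k R S 0 z b = Equal z z"
| "at_least k R S (Suc n) z b =
     Exists (k + n) (Conj (R (k + n) z) (Conj (Neg (S (k + n) b)) (at_least k R S n (k + n) b)))"

lemma free_vars_at_least:
  assumes "\<And>x y. free_vars (R x y) = {x, y}" "\<And>x y. free_vars (S x y) = {x, y}"
  shows "free_vars (at_least k R S n z b) \<subseteq> {z, b}"
  using assms by (induction n arbitrary: z) auto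

text \<open>There are \<open>n + 1\<close> such elements iff one of them has \<open>n\<close>
  further ones below it. The conditions on \<open>b\<close> and \<open>z\<close> keep both away from
  the variables \<open>k, ..., k + n - 1\<close> that get bound.\<close>

lemma satisfies_at_least:
  fixes key key' :: "point \<Rightarrow> nat"
  assumes R: "\<And>e x y. satisfies A e (R x y) \<longleftrightarrow> key (e x) < key (e y)"
    and S: "\<And>e x y. satisfies A e (S x y) \<longleftrightarrow> key' (e x) < key' (e y)"
    and A: "finite A" "inj_on key A" and "b < k" "z < k \<or> k + n \<le> z"
  shows "satisfies A e (at_least k R S n z b)
    \<longleftrightarrow> n \<le> card {x \<in> A. key x < key (e z) \<and> \<not> key' x < key' (e b)}"
  using \<open>z < k \<or> k + n \<le> z\<close>
proof (induction n arbitrary: e z)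
  case (Suc n)
  let ?D = "\<lambda>m. {x \<in> A. key x < m \<and> \<not> key' x < key' (e b)}"
  have fin: "finite (?D m)" for m
    using A(1) by simp
  have "satisfies A e (at_least k R S (Suc n) z b)
      \<longleftrightarrow> (\<exists>a\<in>?D (key (e z)). n \<le> card (?D (key a)))" (is "_ \<longleftrightarrow> ?E")
  proof -
    have "satisfies A (e(k + n := a)) (at_least k R S n (k + n) b) \<longleftrightarrow> n \<le> card (?D (key a))" for a
    proof -
      have "(e(k + n := a)) b = e b" "(e(k + n := a)) (k + n) = a"
        using \<open>b < k\<close> by auto
      then show ?thesis
        using Suc.IH[of "k + n" "e(k + n := a)"] by (simp only: le_refl simp_thms)
    qed
    moreover have "z \<noteq> k + n" "b \<noteq> k + n"
      using Suc.prems \<open>b < k\<close> by auto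
    ultimately show ?thesis
      by (simp add: R S Bex_def conj_assoc)
  qed
  also have "?E \<longleftrightarrow> Suc n \<le> card (?D (key (e z)))"
  proof
    assume ?E
    then obtain a where a: "a \<in> ?D (key (e z))" "n \<le> card (?D (key a))"
      by auto
    have "insert a (?D (key a)) \<subseteq> ?D (key (e z))"
      using a(1) by auto
    then have "card (insert a (?D (key a))) \<le> card (?D (key (e z)))"
      by (rule card_mono[OF fin])
    then show "Suc n \<le> card (?D (key (e z)))"
      using a(2) fin by simp
  next
    assume n: "Suc n \<le> card (?D (key (e z)))"
    then have "?D (key (e z)) \<noteq> {}"
      by (metis card.empty not_less_eq_eq le0)
    \<comment> \<open>Take the element with the largest key: by injectivity all the others lie below
      it, so only one element is lost.\<close>
    then have "Max (key ` ?D (key (e z))) \<in> key ` ?D (key (e z))"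
      using fin by (intro Max_in) auto
    then obtain a where a: "a \<in> ?D (key (e z))" "key a = Max (key ` ?D (key (e z)))"
      by (metis (no_types, lifting) imageE)
    have max: "key y \<le> key a" if "y \<in> ?D (key (e z))" for y
      unfolding a(2) using that fin by (intro Max_ge) auto
    have "?D (key (e z)) \<subseteq> insert a (?D (key a))"
    proof
      fix y assume y: "y \<in> ?D (key (e z))"
      then have "key y < key a \<or> y = a"
        using max[OF y] A(2) a(1) by (auto simp: inj_on_def le_less)
      then show "y \<in> insert a (?D (key a))"
        using y by auto
    qed
    then have "card (?D (key (e z))) \<le> card (insert a (?D (key a)))"
      by (intro card_mono) (use fin in auto)
    then have "n \<le> card (?D (key a))"
      using n fin by simp
    then show ?E
      using a(1) by blast
  qed
  finally show ?case .
qed simp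

text \<open>Exactly \<open>n\<close> means at least \<open>n\<close> but not at least
  \<open>n + 1\<close>. The orders are parameters, since the two differences of a position count and
  a value count are obtained from each other by exchanging them.\<close>

lemma definable_card_eq:
  fixes key key' :: "point \<Rightarrow> nat"
  assumes R: "\<And>A e x y. satisfies A e (R x y) \<longleftrightarrow> key (e x) < key (e y)"
    and S: "\<And>A e x y. satisfies A e (S x y) \<longleftrightarrow> key' (e x) < key' (e y)"
    and fv: "\<And>x y. free_vars (R x y) = {x, y}" "\<And>x y. free_vars (S x y) = {x, y}"
    and key: "\<And>A. inj_on fst A \<and> inj_on snd A \<Longrightarrow> inj_on key A"
    and ab: "a < k" "b < k"
  shows "definable k (\<lambda>A e. card {x \<in> A. key x < key (e a) \<and> \<not> key' x < key' (e b)} = n)"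
  unfolding definable_def
proof (intro exI conjI allI impI)
  let ?\<phi> = "Conj (at_least k R S n a b) (Neg (at_least k R S (Suc n) a b))"
  show "free_vars ?\<phi> \<subseteq> {..<k}"
    using free_vars_at_least[of R S k n a b, OF fv] free_vars_at_least[of R S k "Suc n" a b, OF fv] ab
    by fastforce
  fix A :: "point set" and e
  assume A: "finite A \<and> inj_on fst A \<and> inj_on snd A"
  have "satisfies A e (at_least k R S m a b)
      \<longleftrightarrow> m \<le> card {x \<in> A. key x < key (e a) \<and> \<not> key' x < key' (e b)}" for m
    using A key ab by (intro satisfies_at_least[where key = key and key' = key', OF R S]) auto
  from this[of n] this[of "Suc n"]
  show "satisfies A e ?\<phi> \<longleftrightarrow> card {x \<in> A. key x < key (e a) \<and> \<not> key' x < key' (e b)} = n"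
    unfolding satisfies.simps(4,5) by linarith
qed

text \<open>A finite set of numbers has only one increasing enumeration. By position it is
  enumerated by \<open>s\<close> itself, by value the element \<open>s ! a\<close> comes at place
  \<open>\<pi> ! a\<close>.\<close>

lemma stable_occurrence_iff_pointwise:
  assumes pi: "is_perm \<pi>" and occ: "occurrence \<pi> \<sigma> s"
  shows "stable_occurrence \<pi> \<sigma> s \<longleftrightarrow> (\<forall>a<length \<pi>. fst (s ! (\<pi> ! a)) = snd (s ! a))"
proof
  have len: "length s = length \<pi>"
    using occ by (auto simp: occurrence_def)
  have F: "fst ` set s = (\<lambda>a. fst (s ! a)) ` {..<length \<pi>}" "snd ` set s = (\<lambda>a. snd (s ! a)) ` {..<length \<pi>}"
    by (auto simp: set_conv_nth len)
  {
    assume *: "\<forall>a<length \<pi>. fst (s ! (\<pi> ! a)) = snd (s ! a)"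
    have "fst ` set s = (\<lambda>a. fst (s ! a)) ` ((!) \<pi> ` {..<length \<pi>})"
      using is_perm_bij[OF pi] F(1) by (simp add: bij_betw_def)
    then have "snd ` set s = fst ` set s"
      using * F(2) by (auto simp: image_image)
    then show "stable_occurrence \<pi> \<sigma> s"
      using occ by (simp add: stable_occurrence_alt)
  }
  assume "stable_occurrence \<pi> \<sigma> s"
  then have eq: "snd ` set s = fst ` set s"
    by (simp add: stable_occurrence_alt)
  show "\<forall>a<length \<pi>. fst (s ! (\<pi> ! a)) = snd (s ! a)"
  proof (intro allI impI)
    fix a assume a: "a < length \<pi>"
    then have "snd (s ! a) \<in> fst ` set s"
      using F eq by auto
    then obtain b where b: "b < length \<pi>" "snd (s ! a) = fst (s ! b)"
      using F by auto
    \<comment> \<open>Both \<open>\<pi> ! a\<close> and \<open>b\<close> count the members of the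
      common set below \<open>snd (s ! a)\<close>, the former as values and the latter as
      positions.\<close>
    have "\<pi> ! a = card {..<\<pi> ! a}"
      by simp
    also have "{..<\<pi> ! a} = (!) \<pi> ` {c. c < length \<pi> \<and> \<pi> ! c < \<pi> ! a}"
    proof -
      have "m \<in> (!) \<pi> ` {..<length \<pi>}" if "m < \<pi> ! a" for m
        using is_perm_bij[OF pi] is_perm_nth_less[OF pi a] that by (auto simp: bij_betw_def)
      then show ?thesis
        by auto
    qed
    also have "card \<dots> = card {c. c < length \<pi> \<and> \<pi> ! c < \<pi> ! a}"
      using is_perm_bij[OF pi] by (intro card_image) (auto simp: bij_betw_def inj_on_def)
    also have "\<dots> = card {c. c < length \<pi> \<and> snd (s ! c) < snd (s ! a)}"
      using occurrence_nth_V[OF occ] a by (intro arg_cong[where f = card]) (auto simp: less_V_def)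
    also have "\<dots> = card ((\<lambda>c. snd (s ! c)) ` {c. c < length \<pi> \<and> snd (s ! c) < snd (s ! a)})"
    proof (rule card_image[symmetric], rule inj_onI)
      fix c d assume cd: "c \<in> {c. c < length \<pi> \<and> snd (s ! c) < snd (s ! a)}"
        "d \<in> {c. c < length \<pi> \<and> snd (s ! c) < snd (s ! a)}" "snd (s ! c) = snd (s ! d)"
      then have "c < length \<pi>" "d < length \<pi>" "\<not> s ! c <\<^sub>V s ! d" "\<not> s ! d <\<^sub>V s ! c"
        by (simp_all add: less_V_def)
      then show "c = d"
        using occurrence_nth_V[OF occ] is_perm_nth_eq_iff[OF pi] by (metis linorder_neqE_nat)
    qed
    also have "(\<lambda>c. snd (s ! c)) ` {c. c < length \<pi> \<and> snd (s ! c) < snd (s ! a)}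
        = {v \<in> snd ` set s. v < snd (s ! a)}"
      by (auto simp: F)
    \<comment> \<open>Values turn into positions here: \<open>eq\<close> identifies the two sets,
      and the choice of \<open>b\<close> the two thresholds.\<close>
    also have "\<dots> = (\<lambda>c. fst (s ! c)) ` {c. c < length \<pi> \<and> fst (s ! c) < fst (s ! b)}"
      unfolding eq unfolding F b by auto
    also have "{c. c < length \<pi> \<and> fst (s ! c) < fst (s ! b)} = {..<b}"
      using occurrence_nth_P[OF occ _ b(1)] b(1) by (auto simp: less_P_def)
    also have "card ((\<lambda>c. fst (s ! c)) ` {..<b}) = b"
    proof -
      have "inj_on (\<lambda>c. fst (s ! c)) {..<b}"
      proof (rule inj_onI)
        fix c d assume "c \<in> {..<b}" "d \<in> {..<b}" "fst (s ! c) = fst (s ! d)"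
        then show "c = d"
          using occurrence_nth_P[OF occ, of c d] occurrence_nth_P[OF occ, of d c] b(1)
          by (auto simp: less_P_def)
      qed
      then show ?thesis
        by (simp add: card_image)
    qed
    finally show "fst (s ! (\<pi> ! a)) = snd (s ! a)"
      using b by simp
  qed
qed

text \<open>For a point \<open>x\<close> of a permutation diagram, \<open>fst x\<close> and \<open>snd x\<close> count the points before and
  below it. The common part of two such counts cancels, so that only boundedly many points
  have to be counted.\<close>

lemma fst_eq_snd_iff:
  assumes "is_perm \<sigma>" "x \<in> diagram \<sigma>" "y \<in> diagram \<sigma>"
  shows "fst x = snd y \<longleftrightarrow> card {z \<in> diagram \<sigma>. fst z < fst x \<and> \<not> snd z < snd y}
    = card {z \<in> diagram \<sigma>. snd z < snd y \<and> \<not> fst z < fst x}" (is "_ \<longleftrightarrow> card ?D = card ?E")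
proof -
  let ?I = "{z \<in> diagram \<sigma>. fst z < fst x \<and> snd z < snd y}"
  have "fst ` {z \<in> diagram \<sigma>. fst z < fst x} = {..<fst x}"
    using assms(2) by (force simp: diagram_def)
  then have "fst x = card {z \<in> diagram \<sigma>. fst z < fst x}"
    using card_image[OF inj_on_subset[OF inj_on_fst_diagram], of "{z \<in> diagram \<sigma>. fst z < fst x}" \<sigma>]
    by auto
  also have "{z \<in> diagram \<sigma>. fst z < fst x} = ?I \<union> ?D"
    by auto
  also have "card \<dots> = card ?I + card ?D"
    by (rule card_Un_disjoint) auto
  finally have 1: "fst x = card ?I + card ?D" .
  have "snd y < length \<sigma>"
    using assms(1,3) by (auto simp: mem_diagram_iff is_perm_nth_less)
  then have "{..<snd y} \<subseteq> snd ` diagram \<sigma>"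
    by (simp add: snd_diagram[OF assms(1)])
  then have "snd ` {z \<in> diagram \<sigma>. snd z < snd y} = {..<snd y}"
    by blast
  then have "snd y = card {z \<in> diagram \<sigma>. snd z < snd y}"
    using card_image[OF inj_on_subset[OF inj_on_snd_diagram[OF assms(1)]], of "{z \<in> diagram \<sigma>. snd z < snd y}"]
    by auto
  also have "{z \<in> diagram \<sigma>. snd z < snd y} = ?I \<union> ?E"
    by auto
  also have "card \<dots> = card ?I + card ?E"
    by (rule card_Un_disjoint) auto
  finally show ?thesis
    using 1 by linarith
qed

text \<open>Elements of \<open>s\<close> may also belong to the sets that are counted, whence the
  bound \<open>M + length \<pi>\<close>. For an occurrence that is not stable no bound is available,
  but then two of the counts differ and the formula fails whatever their size.\<close>

lemma off_diagonal_bounded_imp_definable: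
  assumes pi: "is_perm \<pi>" and C: "perm_class C" and bdd: "off_diagonal_bounded \<pi> C"
  shows "stable_occurrences_definable \<pi> C"
proof -
  let ?k = "length \<pi>"
  obtain M where M: "\<And>\<sigma> s. \<sigma> \<in> C \<Longrightarrow> stable_occurrence \<pi> \<sigma> s \<Longrightarrow>
      (\<Sum>i\<le>?k. \<Sum>j\<in>{..?k} - {i}. cell_matrix \<sigma> s i j) \<le> M"
    using bdd by (auto simp: off_diagonal_bounded_def)
  \<comment> \<open>What is left of the position of \<open>s ! (\<pi> ! a)\<close> and of the value
    of \<open>s ! a\<close> once their common part is removed.\<close>
  let ?D = "\<lambda>A e a. {x \<in> A. fst x < fst (e (\<pi> ! a) :: point) \<and> \<not> snd x < snd (e a :: point)}"
  let ?E = "\<lambda>A e a. {x \<in> A. snd x < snd (e a :: point) \<and> \<not> fst x < fst (e (\<pi> ! a) :: point)}"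
  have P: "\<And>A e x y. satisfies A e (Less_P x y) \<longleftrightarrow> fst (e x) < fst (e y)"
    and V: "\<And>A e x y. satisfies A e (Less_V x y) \<longleftrightarrow> snd (e x) < snd (e y)"
    by (auto simp: less_P_def less_V_def)
  \<comment> \<open>Equality of two counts is not first-order as such; bounded by
    \<open>M + ?k\<close>, it is a finite disjunction over the common value
    \<open>n\<close>.\<close>
  have "definable ?k (\<lambda>A e. (\<forall>a<?k. \<forall>b<?k. (e a <\<^sub>P e b \<longleftrightarrow> a < b) \<and> (e a <\<^sub>V e b \<longleftrightarrow> \<pi> ! a < \<pi> ! b)) \<and>
      (\<forall>a<?k. \<exists>n<Suc (M + ?k). card (?D A e a) = n \<and> card (?E A e a) = n))"
    by (intro definable_conj definable_All_less definable_Ex_less definable_iff definable_const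
        definable_atomic definable_card_eq[where key = fst and key' = snd, OF P V]
        definable_card_eq[where key = snd and key' = fst, OF V P])
      (auto simp: is_perm_nth_less[OF pi])
  then obtain \<phi> where \<phi>: "free_vars \<phi> \<subseteq> {..<?k}"
    "\<forall>A e. finite A \<and> inj_on fst A \<and> inj_on snd A \<longrightarrow> (satisfies A e \<phi> \<longleftrightarrow>
      (\<forall>a<?k. \<forall>b<?k. (e a <\<^sub>P e b \<longleftrightarrow> a < b) \<and> (e a <\<^sub>V e b \<longleftrightarrow> \<pi> ! a < \<pi> ! b)) \<and>
      (\<forall>a<?k. \<exists>n<Suc (M + ?k). card (?D A e a) = n \<and> card (?E A e a) = n))"
    unfolding definable_def by (elim exE conjE) (rule that)
  have "models \<sigma> s \<phi> \<longleftrightarrow> stable_occurrence \<pi> \<sigma> s"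
    if \<sigma>: "\<sigma> \<in> C" and s: "length s = ?k" "set s \<subseteq> diagram \<sigma>" for \<sigma> s
  proof -
    have perm: "is_perm \<sigma>"
      using C \<sigma> by (auto simp: perm_class_def)
    have occ: "occurrence \<pi> \<sigma> s \<longleftrightarrow>
        (\<forall>a<?k. \<forall>b<?k. (s ! a <\<^sub>P s ! b \<longleftrightarrow> a < b) \<and> (s ! a <\<^sub>V s ! b \<longleftrightarrow> \<pi> ! a < \<pi> ! b))"
      using s occurrence_nth_P[of \<pi> \<sigma> s] occurrence_nth_V[of \<pi> \<sigma> s]
      by (auto simp: occurrence_def sorted_wrt_iff_nth_less)
    have "stable_occurrence \<pi> \<sigma> s \<longleftrightarrow>
        (\<forall>a<?k. \<exists>n<Suc (M + ?k). card (?D (diagram \<sigma>) ((!) s) a) = n \<and> card (?E (diagram \<sigma>) ((!) s) a) = n)"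
      if o: "occurrence \<pi> \<sigma> s"
    proof -
      have mem: "s ! a \<in> diagram \<sigma>" "s ! (\<pi> ! a) \<in> diagram \<sigma>" if "a < ?k" for a
        using occurrence_nth_mem[OF o] is_perm_nth_less[OF pi] that by auto
      have "card (?D (diagram \<sigma>) ((!) s) a) < Suc (M + ?k)"
        if a: "a < ?k" and st: "stable_occurrence \<pi> \<sigma> s" for a
      proof -
        have "?D (diagram \<sigma>) ((!) s) a \<subseteq> {x \<in> diagram \<sigma> - set s. row s x \<noteq> col s x} \<union> set s"
        proof
          fix x assume x: "x \<in> ?D (diagram \<sigma>) ((!) s) a"
          \<comment> \<open>Such a point is above \<open>s ! a\<close>, which has rank
            \<open>\<pi> ! a\<close> by value, but not to the right of
            \<open>s ! (\<pi> ! a)\<close>; so its row exceeds its column.\<close>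
          have "row s x \<noteq> col s x" if "x \<notin> set s"
          proof -
            have "snd (s ! a) \<noteq> snd x"
              using diagram_eq_iff_snd[OF perm, of "s ! a" x] that x mem[OF a] a s by force
            then have "s ! a <\<^sub>V x"
              using x by (simp add: less_V_def)
            then have "\<pi> ! a < row s x"
              using nth_less_V_iff[OF pi o a] by simp
            moreover have "\<not> s ! (\<pi> ! a) <\<^sub>P x"
              using x by (simp add: less_P_def)
            then have "\<not> \<pi> ! a < col s x"
              using nth_less_P_iff[OF o is_perm_nth_less[OF pi a]] by simp
            ultimately show ?thesis
              by simp
          qed
          then show "x \<in> {x \<in> diagram \<sigma> - set s. row s x \<noteq> col s x} \<union> set s"
            using x by auto
        qed
        then have "card (?D (diagram \<sigma>) ((!) s) a)
            \<le> card ({x \<in> diagram \<sigma> - set s. row s x \<noteq> col s x} \<union> set s)"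
          by (intro card_mono) auto
        also have "\<dots> \<le> card {x \<in> diagram \<sigma> - set s. row s x \<noteq> col s x} + card (set s)"
          by (rule card_Un_le)
        also have "\<dots> \<le> M + ?k"
          using M[OF \<sigma> st] off_diagonal_sum[OF s(1), of \<sigma>] card_length[of s] s(1) by simp
        finally show ?thesis
          by simp
      qed
      moreover have "stable_occurrence \<pi> \<sigma> s \<longleftrightarrow>
          (\<forall>a<?k. card (?D (diagram \<sigma>) ((!) s) a) = card (?E (diagram \<sigma>) ((!) s) a))"
        unfolding stable_occurrence_iff_pointwise[OF pi o]
        using fst_eq_snd_iff[OF perm mem(2) mem(1)] by simp
      ultimately show ?thesis
        by auto
    qed
    moreover have "satisfies (diagram \<sigma>) ((!) s) \<phi> \<longleftrightarrow> occurrence \<pi> \<sigma> s \<and>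
        (\<forall>a<?k. \<exists>n<Suc (M + ?k). card (?D (diagram \<sigma>) ((!) s) a) = n \<and> card (?E (diagram \<sigma>) ((!) s) a) = n)"
      unfolding occ by (rule \<phi>(2)[THEN spec, THEN spec, THEN mp])
        (simp add: inj_on_fst_diagram inj_on_snd_diagram[OF perm])
    ultimately show ?thesis
      unfolding models_def using stable_occurrence_alt by blast
  qed
  then show ?thesis
    unfolding stable_occurrences_definable_def using \<phi>(1) by blast
qed

section \<open>Deleting a point from a long monotone interval\<close>

primrec quantifier_rank :: "toto \<Rightarrow> nat" where
  "quantifier_rank (Equal x y) = 0"
| "quantifier_rank (Less_P x y) = 0"
| "quantifier_rank (Less_V x y) = 0"
| "quantifier_rank (Neg \<phi>) = quantifier_rank \<phi>"
| "quantifier_rank (Conj \<phi> \<psi>) = max (quantifier_rank \<phi>) (quantifier_rank \<psi>)"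
| "quantifier_rank (Exists x \<phi>) = Suc (quantifier_rank \<phi>)"

text \<open>A monotone interval, as produced by one block of an inflation: no other point separates
  two of its points in either order. It is given by an enumeration so that it can be cut at an
  index.\<close>

definition monotone_run :: "point set \<Rightarrow> (nat \<Rightarrow> point) \<Rightarrow> nat \<Rightarrow> bool" where
  "monotone_run A g N \<longleftrightarrow> g ` {..<N} \<subseteq> A \<and>
     (\<forall>i<N. \<forall>j<N. g i <\<^sub>P g j \<longleftrightarrow> i < j) \<and>
     ((\<forall>i<N. \<forall>j<N. g i <\<^sub>V g j \<longleftrightarrow> i < j) \<or> (\<forall>i<N. \<forall>j<N. g i <\<^sub>V g j \<longleftrightarrow> j < i)) \<and>
     (\<forall>x\<in>A - g ` {..<N}. \<forall>i<N. \<forall>j<N.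
        (x <\<^sub>P g i \<longleftrightarrow> x <\<^sub>P g j) \<and> (g i <\<^sub>P x \<longleftrightarrow> g j <\<^sub>P x) \<and>
        (x <\<^sub>V g i \<longleftrightarrow> x <\<^sub>V g j) \<and> (g i <\<^sub>V x \<longleftrightarrow> g j <\<^sub>V x))"

lemma monotone_runD:
  assumes "monotone_run A g N"
  shows "i < N \<Longrightarrow> g i \<in> A"
    and "i < N \<Longrightarrow> j < N \<Longrightarrow> g i <\<^sub>P g j \<longleftrightarrow> i < j"
    and "(\<forall>i<N. \<forall>j<N. g i <\<^sub>V g j \<longleftrightarrow> i < j) \<or> (\<forall>i<N. \<forall>j<N. g i <\<^sub>V g j \<longleftrightarrow> j < i)"
    and "x \<in> A \<Longrightarrow> x \<notin> g ` {..<N} \<Longrightarrow> i < N \<Longrightarrow> j < N \<Longrightarrow>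
        (x <\<^sub>P g i \<longleftrightarrow> x <\<^sub>P g j) \<and> (g i <\<^sub>P x \<longleftrightarrow> g j <\<^sub>P x) \<and>
        (x <\<^sub>V g i \<longleftrightarrow> x <\<^sub>V g j) \<and> (g i <\<^sub>V x \<longleftrightarrow> g j <\<^sub>V x)"
proof -
  note r = assms[unfolded monotone_run_def]
  show "i < N \<Longrightarrow> g i \<in> A"
    using conjunct1[OF r] by auto
  show "i < N \<Longrightarrow> j < N \<Longrightarrow> g i <\<^sub>P g j \<longleftrightarrow> i < j"
    using conjunct1[OF conjunct2[OF r]] by simp
  show "(\<forall>i<N. \<forall>j<N. g i <\<^sub>V g j \<longleftrightarrow> i < j) \<or> (\<forall>i<N. \<forall>j<N. g i <\<^sub>V g j \<longleftrightarrow> j < i)"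
    by (rule conjunct1[OF conjunct2[OF conjunct2[OF r]]])
  show "(x <\<^sub>P g i \<longleftrightarrow> x <\<^sub>P g j) \<and> (g i <\<^sub>P x \<longleftrightarrow> g j <\<^sub>P x) \<and>
        (x <\<^sub>V g i \<longleftrightarrow> x <\<^sub>V g j) \<and> (g i <\<^sub>V x \<longleftrightarrow> g j <\<^sub>V x)"
    if "x \<in> A" "x \<notin> g ` {..<N}" "i < N" "j < N"
    using that
    by (intro conjunct2[OF conjunct2[OF conjunct2[OF r]], THEN bspec, THEN spec, THEN mp, THEN spec, THEN mp] DiffI)
qed

lemma monotone_run_eq_iff:
  assumes "monotone_run A g N" "i < N" "j < N"
  shows "g i = g j \<longleftrightarrow> i = j"
proof
  assume "g i = g j"
  then show "i = j"
    using monotone_runD(2)[OF assms(1), of i j] monotone_runD(2)[OF assms(1), of j i] assms(2,3)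
    by (auto simp: less_P_def)
qed simp

text \<open>A run point that is left out has its index entirely on one side of the indices kept,
  hence it does not separate the points kept, although it now counts as an outside point.\<close>

lemma monotone_run_sub:
  assumes run: "monotone_run A g N" and le: "m + L \<le> N"
  shows "monotone_run A (\<lambda>j. g (m + j)) L"
proof -
  have idx: "m + i < N" if "i < L" for i
    using le that by simp
  have uniform: "(x <\<^sub>P g (m + i) \<longleftrightarrow> x <\<^sub>P g (m + j)) \<and> (g (m + i) <\<^sub>P x \<longleftrightarrow> g (m + j) <\<^sub>P x) \<and>
        (x <\<^sub>V g (m + i) \<longleftrightarrow> x <\<^sub>V g (m + j)) \<and> (g (m + i) <\<^sub>V x \<longleftrightarrow> g (m + j) <\<^sub>V x)"
    if x: "x \<in> A" "x \<notin> (\<lambda>j. g (m + j)) ` {..<L}" and ij: "i < L" "j < L" for x i j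
  proof (cases "x \<in> g ` {..<N}")
    case True
    then obtain l where l: "l < N" "x = g l"
      by auto
    have "l < m \<or> m + L \<le> l"
    proof (rule ccontr)
      assume "\<not> (l < m \<or> m + L \<le> l)"
      then have "x = g (m + (l - m))" "l - m \<in> {..<L}"
        using l by auto
      then show False
        using x(2) by blast
    qed
    then show ?thesis
      using monotone_runD(2,3)[OF run] idx[OF ij(1)] idx[OF ij(2)] ij l by (auto 0 0)
  next
    case False
    then show ?thesis
      using monotone_runD(4)[OF run x(1)] idx ij by blast
  qed
  have "(\<forall>i<L. \<forall>j<L. g (m + i) <\<^sub>V g (m + j) \<longleftrightarrow> i < j) \<or>
      (\<forall>i<L. \<forall>j<L. g (m + i) <\<^sub>V g (m + j) \<longleftrightarrow> j < i)"
    using monotone_runD(3)[OF run] idx by auto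
  moreover have "(\<lambda>j. g (m + j)) ` {..<L} \<subseteq> A"
    using monotone_runD(1)[OF run] idx by auto
  moreover have "\<forall>i<L. \<forall>j<L. g (m + i) <\<^sub>P g (m + j) \<longleftrightarrow> i < j"
    using monotone_runD(2)[OF run] idx by auto
  ultimately show ?thesis
    unfolding monotone_run_def
  proof (intro conjI)
    show "\<forall>x\<in>A - (\<lambda>j. g (m + j)) ` {..<L}. \<forall>i<L. \<forall>j<L.
        (x <\<^sub>P g (m + i) \<longleftrightarrow> x <\<^sub>P g (m + j)) \<and> (g (m + i) <\<^sub>P x \<longleftrightarrow> g (m + j) <\<^sub>P x) \<and>
        (x <\<^sub>V g (m + i) \<longleftrightarrow> x <\<^sub>V g (m + j)) \<and> (g (m + i) <\<^sub>V x \<longleftrightarrow> g (m + j) <\<^sub>V x)"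
      by (intro ballI allI impI uniform) auto
  qed assumption+
qed

section \<open>Enumerations omitting one index\<close>

definition skip :: "nat \<Rightarrow> nat \<Rightarrow> nat" where
  "skip p j = (if j < p then j else Suc j)"

text \<open>Left inverse of \<open>skip p\<close>; its value at \<open>p\<close> itself is
  arbitrary.\<close>

definition unskip :: "nat \<Rightarrow> nat \<Rightarrow> nat" where
  "unskip p i = (if i < p then i else i - 1)"

lemma skip_unskip: "i \<noteq> p \<Longrightarrow> skip p (unskip p i) = i"
  and unskip_skip: "unskip p (skip p j) = j"
  and skip_neq: "skip p j \<noteq> p"
  and skip_less_iff: "skip p j < skip p j' \<longleftrightarrow> j < j'"
  and skip_less: "j < N - 1 \<Longrightarrow> skip p j < N"
  and unskip_less: "i < N \<Longrightarrow> p < N \<Longrightarrow> i \<noteq> p \<Longrightarrow> unskip p i < N - 1"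
  by (auto simp: skip_def unskip_def)

text \<open>Up to isomorphism it does not matter which point of a run is deleted: send the
  \<open>j\<close>-th survivor to the \<open>j\<close>-th survivor and fix everything outside the
  run.\<close>

lemma monotone_run_move:
  assumes run: "monotone_run A g N" and p: "p < N" "p' < N"
  obtains f where "inj_on f (A - {g p})" "f ` (A - {g p}) = A - {g p'}"
    "\<forall>x\<in>A - {g p}. \<forall>y\<in>A - {g p}. f x <\<^sub>P f y \<longleftrightarrow> x <\<^sub>P y"
    "\<forall>x\<in>A - {g p}. \<forall>y\<in>A - {g p}. f x <\<^sub>V f y \<longleftrightarrow> x <\<^sub>V y"
    "\<forall>x. x \<notin> g ` {..<N} \<longrightarrow> f x = x"
    "\<forall>j<N - 1. f (g (skip p j)) = g (skip p' j)"
proof -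
  define f where
    "f x = (if x \<in> g ` {..<N} then g (skip p' (unskip p (THE i. i < N \<and> g i = x))) else x)" for x
  have f_g: "f (g i) = g (skip p' (unskip p i))" if "i < N" for i
  proof -
    have "(THE i'. i' < N \<and> g i' = g i) = i"
      using that monotone_run_eq_iff[OF run] by blast
    then show ?thesis
      using that by (simp add: f_def)
  qed
  have f_out: "f x = x" if "x \<notin> g ` {..<N}" for x
    using that by (simp add: f_def)
  have f_skip: "f (g (skip p j)) = g (skip p' j)" if "j < N - 1" for j
    using that by (simp add: f_g skip_less unskip_skip)
  have cases: "(\<exists>j<N - 1. x = g (skip p j)) \<or> (x \<in> A \<and> x \<notin> g ` {..<N})" if "x \<in> A - {g p}" for x
  proof (cases "x \<in> g ` {..<N}")
    case True
    then obtain i where i: "i < N" "x = g i"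
      by auto
    then have "i \<noteq> p"
      using that by auto
    then have "unskip p i < N - 1" "x = g (skip p (unskip p i))"
      using i p unskip_less skip_unskip by auto
    then show ?thesis
      by blast
  qed (use that in auto)
  have sk: "skip p j < N" "skip p' j < N" if "j < N - 1" for j
    using that by (auto simp: skip_less)
  have img: "f ` (A - {g p}) = A - {g p'}"
  proof (intro subset_antisym subsetI)
    fix y assume "y \<in> f ` (A - {g p})"
    then obtain x where x: "x \<in> A - {g p}" "y = f x"
      by blast
    from cases[OF x(1)] show "y \<in> A - {g p'}"
    proof
      assume "\<exists>j<N - 1. x = g (skip p j)"
      then obtain j where "j < N - 1" "y = g (skip p' j)"
        using x f_skip by auto
      then show ?thesis
        using monotone_runD(1)[OF run sk(2)] monotone_run_eq_iff[OF run sk(2) p(2)] skip_neq by auto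
    next
      assume "x \<in> A \<and> x \<notin> g ` {..<N}"
      then show ?thesis
        using x f_out p by auto
    qed
  next
    fix y assume y: "y \<in> A - {g p'}"
    show "y \<in> f ` (A - {g p})"
    proof (cases "y \<in> g ` {..<N}")
      case True
      then obtain i where i: "i < N" "y = g i"
        by auto
      then have "i \<noteq> p'"
        using y by auto
      then have j: "unskip p' i < N - 1" "y = g (skip p' (unskip p' i))"
        using i p unskip_less skip_unskip by auto
      then have "y = f (g (skip p (unskip p' i)))"
        using f_skip by simp
      moreover have "g (skip p (unskip p' i)) \<in> A - {g p}"
        using monotone_runD(1)[OF run sk(1)[OF j(1)]] monotone_run_eq_iff[OF run sk(1)[OF j(1)] p(1)] skip_neq
        by auto
      ultimately show ?thesis
        by blast
    next
      case False
      then show ?thesis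
        using f_out[OF False] y p by (intro image_eqI[of y f y]) auto
    qed
  qed
  have P: "f x <\<^sub>P f y \<longleftrightarrow> x <\<^sub>P y" and V: "f x <\<^sub>V f y \<longleftrightarrow> x <\<^sub>V y"
    if "x \<in> A - {g p}" "y \<in> A - {g p}" for x y
  proof -
    have "(f x <\<^sub>P f y \<longleftrightarrow> x <\<^sub>P y) \<and> (f x <\<^sub>V f y \<longleftrightarrow> x <\<^sub>V y)"
      using cases[OF that(1)] cases[OF that(2)]
    proof (elim disjE exE conjE)
      fix i j assume ij: "i < N - 1" "x = g (skip p i)" "j < N - 1" "y = g (skip p j)"
      show ?thesis
        using monotone_runD(2)[OF run] monotone_runD(3)[OF run] sk[OF ij(1)] sk[OF ij(3)]
        unfolding ij f_skip[OF ij(1)] f_skip[OF ij(3)] by (auto simp: skip_less_iff)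
    next
      fix i assume i: "i < N - 1" "x = g (skip p i)" and y: "y \<in> A" "y \<notin> g ` {..<N}"
      show ?thesis
        using monotone_runD(4)[OF run y sk(1)[OF i(1)] sk(2)[OF i(1)]] by (simp add: i f_skip[OF i(1)] f_out[OF y(2)])
    next
      fix i assume i: "i < N - 1" "y = g (skip p i)" and x: "x \<in> A" "x \<notin> g ` {..<N}"
      show ?thesis
        using monotone_runD(4)[OF run x sk(1)[OF i(1)] sk(2)[OF i(1)]] by (simp add: i f_skip[OF i(1)] f_out[OF x(2)])
    qed (simp add: f_out)
    then show "f x <\<^sub>P f y \<longleftrightarrow> x <\<^sub>P y" "f x <\<^sub>V f y \<longleftrightarrow> x <\<^sub>V y"
      by auto
  qed
  have inj: "inj_on f (A - {g p})"
  proof (rule inj_onI)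
    fix x y assume xy: "x \<in> A - {g p}" "y \<in> A - {g p}" "f x = f y"
    from cases[OF xy(1)] cases[OF xy(2)] show "x = y"
    proof (elim disjE exE conjE)
      fix i j assume ij: "i < N - 1" "x = g (skip p i)" "j < N - 1" "y = g (skip p j)"
      then have "skip p' i = skip p' j"
        using xy(3) monotone_run_eq_iff[OF run sk(2)[OF ij(1)] sk(2)[OF ij(3)]] by (simp add: f_skip)
      then have "i = j"
        using unskip_skip by metis
      then show ?thesis
        using ij by simp
    next
      fix i assume i: "i < N - 1" "x = g (skip p i)" "y \<notin> g ` {..<N}"
      then have "y = g (skip p' i)"
        using xy(3) f_skip[OF i(1)] f_out[OF i(3)] by simp
      then show ?thesis
        using i(3) sk(2)[OF i(1)] by blast
    next
      fix i assume i: "i < N - 1" "y = g (skip p i)" "x \<notin> g ` {..<N}"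
      then have "x = g (skip p' i)"
        using xy(3) f_skip[OF i(1)] f_out[OF i(3)] by simp
      then show ?thesis
        using i(3) sk(2)[OF i(1)] by blast
    qed (use xy(3) in \<open>simp add: f_out\<close>)
  qed
  show ?thesis
    by (rule that[OF inj img]) (use P V f_out f_skip in \<open>simp_all\<close>)
qed

text \<open>All variables but \<open>x\<close> have values outside the run and are fixed by the
  isomorphism. This allows the deletion to be moved to either end of the run while \<open>x\<close>
  holds a run point.\<close>

lemma satisfies_move:
  assumes run: "monotone_run A g N" and p: "p < N" "p' < N" and e: "\<And>y. e y \<in> A - g ` {..<N}"
    and j: "j < N - 1"
  shows "satisfies (A - {g p}) (e(x := g (skip p j))) \<phi>
    \<longleftrightarrow> satisfies (A - {g p'}) (e(x := g (skip p' j))) \<phi>"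
proof -
  obtain f where f: "inj_on f (A - {g p})" "f ` (A - {g p}) = A - {g p'}"
    "\<forall>x\<in>A - {g p}. \<forall>y\<in>A - {g p}. f x <\<^sub>P f y \<longleftrightarrow> x <\<^sub>P y"
    "\<forall>x\<in>A - {g p}. \<forall>y\<in>A - {g p}. f x <\<^sub>V f y \<longleftrightarrow> x <\<^sub>V y"
    "\<forall>x. x \<notin> g ` {..<N} \<longrightarrow> f x = x"
    "\<forall>j<N - 1. f (g (skip p j)) = g (skip p' j)"
    by (rule monotone_run_move[OF run p])
  have "f \<circ> e(x := g (skip p j)) = e(x := g (skip p' j))"
  proof (rule ext)
    fix y
    have "f (e y) = e y"
      using f(5) e[of y] by blast
    then show "(f \<circ> e(x := g (skip p j))) y = (e(x := g (skip p' j))) y"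
      using f(6) j by simp
  qed
  moreover have "(e(x := g (skip p j))) y \<in> A - {g p}" for y
    using e[of y] p monotone_runD(1)[OF run skip_less[OF j, of p]]
      monotone_run_eq_iff[OF run skip_less[OF j, of p] p(1)] skip_neq by auto
  ultimately show ?thesis
    using satisfies_image[of f "A - {g p}" "e(x := g (skip p j))" \<phi>, OF f(1)] f(2,3,4) by simp
qed

text \<open>A quantified element inside the run splits it. The longer part still has at least half of the
  required length, and the deleted point can be moved into it by an isomorphism.\<close>

lemma satisfies_delete:
  assumes "monotone_run A g N" "p < N" "2 ^ quantifier_rank \<phi> \<le> N"
    and "\<And>y. e y \<in> A - g ` {..<N}"
  shows "satisfies (A - {g p}) e \<phi> \<longleftrightarrow> satisfies A e \<phi>"
  using assms
proof (induction \<phi> arbitrary: g N p e)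
  case (Exists x \<phi>)
  let ?q = "2 ^ quantifier_rank \<phi> :: nat"
  note run = Exists.prems(1) and p = Exists.prems(2) and e = Exists.prems(4)
  have q: "2 * ?q \<le> N" "1 \<le> ?q"
    using Exists.prems(3) by auto
  \<comment> \<open>Here the part of the run after the quantified element \<open>g i\<close> is
    still long. The induction hypothesis deletes its last point, with \<open>g i\<close> now
    counting as an outside point.\<close>
  have upper: "satisfies (A - {g (N - 1)}) (e(x := g i)) \<phi> \<longleftrightarrow> satisfies A (e(x := g i)) \<phi>"
    if i: "i < N" "?q \<le> N - 1 - i" for i
  proof -
    have "satisfies (A - {g (Suc i + (N - 2 - i))}) (e(x := g i)) \<phi> \<longleftrightarrow> satisfies A (e(x := g i)) \<phi>"
    proof (rule Exists.IH[where g = "\<lambda>j. g (Suc i + j)" and N = "N - 1 - i" and p = "N - 2 - i"])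
      show "monotone_run A (\<lambda>j. g (Suc i + j)) (N - 1 - i)"
        using i by (intro monotone_run_sub[OF run]) auto
      show "(e(x := g i)) y \<in> A - (\<lambda>j. g (Suc i + j)) ` {..<N - 1 - i}" for y
      proof -
        have idx: "Suc i + j < N" if "j < N - 1 - i" for j
          using that by simp
        have "g i \<noteq> g (Suc i + j)" if "j < N - 1 - i" for j
          using monotone_run_eq_iff[OF run i(1) idx[OF that]] by simp
        moreover have "(\<lambda>j. g (Suc i + j)) ` {..<N - 1 - i} \<subseteq> g ` {..<N}"
          using idx by auto
        ultimately show ?thesis
          using e[of y] monotone_runD(1)[OF run i(1)] by (auto simp del: add_Suc)
      qed
    qed (use i q(2) order.trans[OF q(2) i(2)] in auto)
    moreover have "Suc i + (N - 2 - i) = N - 1"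
      using i(2) q(2) by linarith
    ultimately show ?thesis
      by (simp only:)
  qed
  \<comment> \<open>The mirror image: the part before \<open>g i\<close> is long, and its first
    point is deleted.\<close>
  have lower: "satisfies (A - {g 0}) (e(x := g i)) \<phi> \<longleftrightarrow> satisfies A (e(x := g i)) \<phi>"
    if i: "i < N" "?q \<le> i" for i
  proof (rule Exists.IH[where N = i])
    show "monotone_run A g i"
      using monotone_run_sub[OF run, of 0 i] i by simp
    show "(e(x := g i)) y \<in> A - g ` {..<i}" for y
    proof -
      have "g i \<noteq> g j" if "j < i" for j
        using monotone_run_eq_iff[OF run i(1), of j] i(1) that by simp
      moreover have "g ` {..<i} \<subseteq> g ` {..<N}"
        using i(1) by auto
      ultimately show ?thesis
        using e[of y] monotone_runD(1)[OF run i(1)] by auto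
    qed
  qed (use i order.trans[OF q(2) i(2)] in auto)
  have outside: "satisfies (A - {g p}) (e(x := a)) \<phi> \<longleftrightarrow> satisfies A (e(x := a)) \<phi>"
    if "a \<in> A" "a \<notin> g ` {..<N}" for a
    using e that q by (intro Exists.IH[OF run p]) auto
  show ?case
  proof
    assume "satisfies (A - {g p}) e (Exists x \<phi>)"
    then obtain a where a: "a \<in> A" "a \<noteq> g p" "satisfies (A - {g p}) (e(x := a)) \<phi>"
      by auto
    show "satisfies A e (Exists x \<phi>)"
    proof (cases "a \<in> g ` {..<N}")
      case True
      then obtain i where i: "i < N" "i \<noteq> p" "a = g i"
        using a(2) by auto
      define j where "j = unskip p i"
      have j: "j < N - 1" "a = g (skip p j)"
        using unskip_less[OF i(1) p i(2)] skip_unskip[OF i(2)] i(3) by (simp_all add: j_def)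
      have move: "satisfies (A - {g p'}) (e(x := g (skip p' j))) \<phi>" if "p' < N" for p'
        using satisfies_move[OF run p that e j(1)] a(3) j(2) by simp
      have N: "0 < N" "N - 1 < N"
        using p by auto
      \<comment> \<open>The two numbers add up to \<open>N\<close>, which is at least
        \<open>2 * ?q\<close>. If \<open>g 0\<close> is deleted, survivor \<open>j\<close> is
        \<open>g (Suc j)\<close>, with \<open>Suc j\<close> run points before it; if
        \<open>g (N - 1)\<close> is deleted, it is \<open>g j\<close>, with \<open>N - 1 - j\<close>
        run points after it.\<close>
      consider "?q \<le> Suc j" | "?q \<le> N - 1 - j"
        using q j by linarith
      then show ?thesis
      proof cases
        case 1
        then have "satisfies A (e(x := g (Suc j))) \<phi>"
          using move[OF N(1)] lower[of "Suc j"] j(1) by (simp add: skip_def)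
        then show ?thesis
          using monotone_runD(1)[OF run, of "Suc j"] j(1) by auto
      next
        case 2
        then have "satisfies A (e(x := g j)) \<phi>"
          using move[OF N(2)] upper[of j] j(1) by (simp add: skip_def)
        then show ?thesis
          using monotone_runD(1)[OF run, of j] j(1) by auto
      qed
    next
      case False
      then show ?thesis
        using outside[OF a(1) False] a(1,3) by auto
    qed
  next
    assume "satisfies A e (Exists x \<phi>)"
    then obtain a where a: "a \<in> A" "satisfies A (e(x := a)) \<phi>"
      by auto
    show "satisfies (A - {g p}) e (Exists x \<phi>)"
    proof (cases "a \<in> g ` {..<N}")
      case True
      then obtain i where i: "i < N" "a = g i"
        by auto
      have N: "0 < N" "N - 1 < N"
        using p by auto
      \<comment> \<open>The answering move: \<open>g i\<close> itself survives once the deletion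
        takes place at the end of a part of length at least \<open>?q\<close>; its counterpart for
        the deletion at \<open>p\<close> is the survivor with the same number.\<close>
      have *: "\<exists>j<N - 1. satisfies (A - {g p}) (e(x := g (skip p j))) \<phi>"
      proof (cases "?q \<le> i")
        case True
        have "i - 1 < N - 1" "i = skip 0 (i - 1)"
          using i(1) order.trans[OF q(2) True] by (auto simp: skip_def)
        then show ?thesis
          using satisfies_move[OF run p N(1) e, of "i - 1"] lower[OF i(1) True] a(2) i(2) by auto
      next
        case False
        then have "i < N - 1" "?q \<le> N - 1 - i"
          using i(1) q by linarith+
        moreover from this have "i = skip (N - 1) i"
          by (simp add: skip_def)
        ultimately have "i < N - 1" "i = skip (N - 1) i" "?q \<le> N - 1 - i"
          by simp_all
        then show ?thesis
          using satisfies_move[OF run p N(2) e, of i] upper[OF i(1)] a(2) i(2) by auto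
      qed
      then obtain j where j: "j < N - 1" "satisfies (A - {g p}) (e(x := g (skip p j))) \<phi>"
        by blast
      then have "g (skip p j) \<in> A - {g p}"
        using monotone_runD(1)[OF run skip_less] monotone_run_eq_iff[OF run skip_less p] skip_neq by auto
      then show ?thesis
        using j by auto
    next
      case False
      then have "a \<in> A - {g p}"
        using a(1) p by auto
      then show ?thesis
        using outside[OF a(1) False] a(2) by auto
    qed
  qed
next
  case (Conj \<phi> \<psi>)
  have "2 ^ quantifier_rank \<phi> \<le> N" "2 ^ quantifier_rank \<psi> \<le> N"
    using order.trans[OF power_increasing Conj.prems(3)] by auto
  then show ?case
    using Conj.IH(1)[OF Conj.prems(1,2) _ Conj.prems(4)] Conj.IH(2)[OF Conj.prems(1,2) _ Conj.prems(4)]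
    by simp
qed auto

section \<open>Inflations\<close>

lemma length_concat_upt: "length (concat (map f [0..<n])) = (\<Sum>p<n. length (f p))"
  by (induction n) auto

lemma nth_concat_upt:
  assumes "q < n" "i < length (f q)"
  shows "concat (map f [0..<n]) ! ((\<Sum>p<q. length (f p)) + i) = f q ! i"
  using assms
proof (induction n)
  case (Suc n)
  show ?case
  proof (cases "q = n")
    case True
    then show ?thesis
      using Suc.prems by (simp add: nth_append length_concat_upt[symmetric])
  next
    case False
    then have q: "q < n"
      using Suc.prems by simp
    have "(\<Sum>p<q. length (f p)) + i < (\<Sum>p<Suc q. length (f p))"
      using Suc.prems by simp
    also have "\<dots> \<le> (\<Sum>p<n. length (f p))"
      using q by (intro sum_mono2) auto
    finally show ?thesis
      using Suc.IH[OF q Suc.prems(2)] by (simp add: nth_append length_concat_upt)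
  qed
qed simp

text \<open>Locates position \<open>m\<close> of a concatenation: the block \<open>q\<close> and the
  index \<open>i\<close> within it.\<close>

lemma sum_lessThan_split:
  fixes w :: "nat \<Rightarrow> nat"
  assumes "m < (\<Sum>p<n. w p)"
  obtains q i where "q < n" "i < w q" "m = (\<Sum>p<q. w p) + i"
  using assms
proof (induction n arbitrary: thesis)
  case (Suc n)
  show ?case
  proof (cases "m < (\<Sum>p<n. w p)")
    case True
    then show ?thesis
      using Suc.IH Suc.prems(1) less_SucI by metis
  next
    case False
    then show ?thesis
      using Suc.prems(2) by (intro Suc.prems(1)[of n "m - (\<Sum>p<n. w p)"]) auto
  qed
qed simp

lemma sum_lessThan_mono:
  fixes w :: "nat \<Rightarrow> nat"
  assumes "q < q'"
  shows "(\<Sum>p<q. w p) + w q \<le> (\<Sum>p<q'. w p)"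
proof -
  have "(\<Sum>p<q. w p) + w q = (\<Sum>p<Suc q. w p)"
    by simp
  also have "\<dots> \<le> (\<Sum>p<q'. w p)"
    using assms by (intro sum_mono2) auto
  finally show ?thesis .
qed

section \<open>Coordinates of the points of an inflation\<close>

definition pos_offset :: "nat list list \<Rightarrow> nat \<Rightarrow> nat" where
  "pos_offset \<alpha>s q = (\<Sum>p<q. length (\<alpha>s ! p))"

definition val_offset :: "nat list \<Rightarrow> nat list list \<Rightarrow> nat \<Rightarrow> nat" where
  "val_offset \<sigma> \<alpha>s q = (\<Sum>p | p < length \<sigma> \<and> \<sigma> ! p < \<sigma> ! q. length (\<alpha>s ! p))"

text \<open>Every point of the inflation has this form, so comparing two points reduces to comparing
  the pairs \<open>(q, i)\<close>, by position, or the values they stand for.\<close>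

definition block_point :: "nat list \<Rightarrow> nat list list \<Rightarrow> nat \<Rightarrow> nat \<Rightarrow> point" where
  "block_point \<sigma> \<alpha>s q i = (pos_offset \<alpha>s q + i, val_offset \<sigma> \<alpha>s q + \<alpha>s ! q ! i)"

lemma length_inflate: "length (inflate \<sigma> \<alpha>s) = pos_offset \<alpha>s (length \<sigma>)"
  by (simp add: inflate_def length_concat_upt pos_offset_def)

lemma inflate_nth:
  assumes "q < length \<sigma>" "i < length (\<alpha>s ! q)"
  shows "inflate \<sigma> \<alpha>s ! (pos_offset \<alpha>s q + i) = val_offset \<sigma> \<alpha>s q + \<alpha>s ! q ! i"
  using nth_concat_upt[of q "length \<sigma>" i
      "\<lambda>p. map (\<lambda>v. val_offset \<sigma> \<alpha>s p + v) (\<alpha>s ! p)"] assms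
  by (simp add: inflate_def pos_offset_def val_offset_def)

lemma diagram_inflate:
  "x \<in> diagram (inflate \<sigma> \<alpha>s) \<longleftrightarrow>
    (\<exists>q i. q < length \<sigma> \<and> i < length (\<alpha>s ! q) \<and> x = block_point \<sigma> \<alpha>s q i)"
proof
  assume x: "x \<in> diagram (inflate \<sigma> \<alpha>s)"
  then have "fst x < (\<Sum>p<length \<sigma>. length (\<alpha>s ! p))"
    by (simp add: mem_diagram_iff length_inflate pos_offset_def)
  then obtain q i where q: "q < length \<sigma>" "i < length (\<alpha>s ! q)" "fst x = pos_offset \<alpha>s q + i"
    unfolding pos_offset_def by (rule sum_lessThan_split)
  then have "x = block_point \<sigma> \<alpha>s q i"
    using x inflate_nth[OF q(1,2)] by (simp add: mem_diagram_iff block_point_def prod_eq_iff)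
  then show "\<exists>q i. q < length \<sigma> \<and> i < length (\<alpha>s ! q) \<and> x = block_point \<sigma> \<alpha>s q i"
    using q by blast
next
  assume "\<exists>q i. q < length \<sigma> \<and> i < length (\<alpha>s ! q) \<and> x = block_point \<sigma> \<alpha>s q i"
  then obtain q i where q: "q < length \<sigma>" "i < length (\<alpha>s ! q)" "x = block_point \<sigma> \<alpha>s q i"
    by blast
  then show "x \<in> diagram (inflate \<sigma> \<alpha>s)"
    using inflate_nth[OF q(1,2)] sum_lessThan_mono[OF q(1), of "\<lambda>p. length (\<alpha>s ! p)"]
    by (simp add: mem_diagram_iff block_point_def length_inflate pos_offset_def)
qed

lemma block_point_less_P:
  assumes "i < length (\<alpha>s ! q)" "i' < length (\<alpha>s ! q')"
  shows "block_point \<sigma> \<alpha>s q i <\<^sub>P block_point \<sigma> \<alpha>s q' i' \<longleftrightarrow> q < q' \<or> q = q' \<and> i < i'"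
  using sum_lessThan_mono[of q q' "\<lambda>p. length (\<alpha>s ! p)"] sum_lessThan_mono[of q' q "\<lambda>p. length (\<alpha>s ! p)"]
    assms
  by (cases q q' rule: linorder_cases) (auto simp: block_point_def less_P_def pos_offset_def)

text \<open>The sum on the right includes the block of \<open>q\<close> itself. The threshold
  \<open>v\<close> need not be a value of \<sigma>: with \<open>v = length \<sigma>\<close> it
  bounds all values of the inflation.\<close>

lemma val_offset_mono:
  assumes "q < length \<sigma>" "\<sigma> ! q < v"
  shows "val_offset \<sigma> \<alpha>s q + length (\<alpha>s ! q) \<le> (\<Sum>p | p < length \<sigma> \<and> \<sigma> ! p < v. length (\<alpha>s ! p))"
proof -
  have "val_offset \<sigma> \<alpha>s q + length (\<alpha>s ! q)
      = (\<Sum>p\<in>insert q {p. p < length \<sigma> \<and> \<sigma> ! p < \<sigma> ! q}. length (\<alpha>s ! p))"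
    by (simp add: val_offset_def)
  also have "\<dots> \<le> (\<Sum>p | p < length \<sigma> \<and> \<sigma> ! p < v. length (\<alpha>s ! p))"
    using assms by (intro sum_mono2) auto
  finally show ?thesis .
qed

lemma block_point_less_V:
  assumes "is_perm \<sigma>" "q < length \<sigma>" "q' < length \<sigma>" "is_perm (\<alpha>s ! q)" "is_perm (\<alpha>s ! q')"
    and "i < length (\<alpha>s ! q)" "i' < length (\<alpha>s ! q')"
  shows "block_point \<sigma> \<alpha>s q i <\<^sub>V block_point \<sigma> \<alpha>s q' i'
    \<longleftrightarrow> \<sigma> ! q < \<sigma> ! q' \<or> q = q' \<and> \<alpha>s ! q ! i < \<alpha>s ! q' ! i'"
proof -
  have "\<alpha>s ! q ! i < length (\<alpha>s ! q)" "\<alpha>s ! q' ! i' < length (\<alpha>s ! q')"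
    using assms by (auto intro: is_perm_nth_less)
  then show ?thesis
    using val_offset_mono[of q \<sigma> "\<sigma> ! q'" \<alpha>s] val_offset_mono[of q' \<sigma> "\<sigma> ! q" \<alpha>s] assms(2,3)
      is_perm_nth_eq_iff[OF assms(1-3)]
    by (cases "\<sigma> ! q" "\<sigma> ! q'" rule: linorder_cases)
      (auto simp: block_point_def less_V_def val_offset_def[of _ _ q] val_offset_def[of _ _ q'])
qed

lemma is_perm_inflate:
  assumes \<sigma>: "is_perm \<sigma>" and \<alpha>s: "\<And>q. q < length \<sigma> \<Longrightarrow> is_perm (\<alpha>s ! q)"
  shows "is_perm (inflate \<sigma> \<alpha>s)"
proof (rule is_permI)
  let ?\<tau> = "inflate \<sigma> \<alpha>s"
  have point: "(m, ?\<tau> ! m) \<in> diagram ?\<tau>" if "m < length ?\<tau>" for m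
    using that by (simp add: mem_diagram_iff)
  show "distinct ?\<tau>"
  proof (rule distinct_conv_nth[THEN iffD2], intro allI impI)
    fix m m' assume m: "m < length ?\<tau>" "m' < length ?\<tau>" "m \<noteq> m'"
    obtain q i where q: "q < length \<sigma>" "i < length (\<alpha>s ! q)" "(m, ?\<tau> ! m) = block_point \<sigma> \<alpha>s q i"
      using point[OF m(1)] unfolding diagram_inflate by blast
    obtain q' i' where q': "q' < length \<sigma>" "i' < length (\<alpha>s ! q')"
        "(m', ?\<tau> ! m') = block_point \<sigma> \<alpha>s q' i'"
      using point[OF m(2)] unfolding diagram_inflate by blast
    have "(q, i) \<noteq> (q', i')"
      using q(3)[symmetric] q'(3) m(3) by auto
    then have "\<sigma> ! q \<noteq> \<sigma> ! q' \<or> q = q' \<and> \<alpha>s ! q ! i \<noteq> \<alpha>s ! q' ! i'"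
      using is_perm_nth_eq_iff[OF \<sigma> q(1) q'(1)] is_perm_nth_eq_iff[OF \<alpha>s[OF q(1)], of i i'] q(2) q'(2)
      by auto
    then have "(m, ?\<tau> ! m) <\<^sub>V (m', ?\<tau> ! m') \<or> (m', ?\<tau> ! m') <\<^sub>V (m, ?\<tau> ! m)"
      unfolding q(3) q'(3)
      using block_point_less_V[OF \<sigma> q(1) q'(1) \<alpha>s[OF q(1)] \<alpha>s[OF q'(1)] q(2) q'(2)]
        block_point_less_V[OF \<sigma> q'(1) q(1) \<alpha>s[OF q'(1)] \<alpha>s[OF q(1)] q'(2) q(2)]
      by (auto simp: linorder_neq_iff)
    then show "?\<tau> ! m \<noteq> ?\<tau> ! m'"
      by (auto simp: less_V_def)
  qed
  show "set ?\<tau> \<subseteq> {..<length ?\<tau>}"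
  proof
    fix v assume "v \<in> set ?\<tau>"
    then obtain m where m: "m < length ?\<tau>" "v = ?\<tau> ! m"
      by (auto simp: in_set_conv_nth)
    obtain q i where q: "q < length \<sigma>" "i < length (\<alpha>s ! q)" "(m, ?\<tau> ! m) = block_point \<sigma> \<alpha>s q i"
      using point[OF m(1)] unfolding diagram_inflate by blast
    have "v = val_offset \<sigma> \<alpha>s q + \<alpha>s ! q ! i"
      using q(3) m(2) inflate_nth[OF q(1,2)] by (simp add: block_point_def)
    also have "\<dots> < val_offset \<sigma> \<alpha>s q + length (\<alpha>s ! q)"
      using is_perm_nth_less[OF \<alpha>s[OF q(1)] q(2)] by simp
    also have "\<dots> \<le> (\<Sum>p | p < length \<sigma> \<and> \<sigma> ! p < length \<sigma>. length (\<alpha>s ! p))"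
      using q(1) is_perm_nth_less[OF \<sigma> q(1)] by (rule val_offset_mono)
    also have "\<dots> \<le> length ?\<tau>"
      unfolding length_inflate pos_offset_def by (intro sum_mono2) auto
    finally show "v \<in> {..<length ?\<tau>}"
      by simp
  qed
qed

definition outside_blocks :: "nat list \<Rightarrow> point list \<Rightarrow> nat list list \<Rightarrow> nat list list" where
  "outside_blocks \<sigma> s \<Theta> =
     map (\<lambda>p. if p \<in> fst ` set s then [0] else \<Theta> ! card ({..<p} - fst ` set s)) [0..<length \<sigma>]"

lemma inflate_outside_alt: "inflate_outside \<sigma> s \<Theta> = inflate \<sigma> (outside_blocks \<sigma> s \<Theta>)"
  by (simp add: inflate_outside_def outside_blocks_def)

lemma outside_blocks_nth:
  assumes "q < length \<sigma>"
  shows "q \<in> fst ` set s \<Longrightarrow> outside_blocks \<sigma> s \<Theta> ! q = [0]"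
    and "q \<notin> fst ` set s \<Longrightarrow> outside_blocks \<sigma> s \<Theta> ! q = \<Theta> ! card ({..<q} - fst ` set s)"
  using assms by (auto simp: outside_blocks_def)

text \<open>Keeps the index into the list of blocks in range: there are \<open>r\<close> positions
  outside \<open>s\<close>, and \<open>q\<close> is one that is not counted.\<close>

lemma card_outside_less:
  assumes "occurrence \<pi> \<sigma> s" "length \<sigma> = length \<pi> + r" "q < length \<sigma>" "q \<notin> fst ` set s"
  shows "card ({..<q} - fst ` set s) < r"
proof -
  have "fst ` set s \<subseteq> {..<length \<sigma>}"
    using assms(1) by (auto simp: occurrence_def mem_diagram_iff)
  moreover have "card (fst ` set s) = length \<pi>"
    using occurrence_distinct[OF assms(1)] card_image[OF inj_on_subset[OF inj_on_fst_diagram]] assms(1)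
    by (auto simp: occurrence_def distinct_card)
  ultimately have "card ({..<length \<sigma>} - fst ` set s) = r"
    using assms(2) by (simp add: card_Diff_subset finite_subset[of _ "{..<length \<sigma>}"])
  moreover have "{..<q} - fst ` set s \<subset> {..<length \<sigma>} - fst ` set s"
    using assms(3,4) by auto
  ultimately show ?thesis
    using psubset_card_mono[of "{..<length \<sigma>} - fst ` set s" "{..<q} - fst ` set s"] by simp
qed

section \<open>Standardization\<close>

definition rank_in :: "nat set \<Rightarrow> nat \<Rightarrow> nat" where
  "rank_in X x = card {z \<in> X. z < x}"

lemma rank_in_less_iff:
  assumes "finite X" "x \<in> X" "y \<in> X"
  shows "rank_in X x < rank_in X y \<longleftrightarrow> x < y"
proof -
  have *: "rank_in X x < rank_in X y" if "x < y" "x \<in> X" for x y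
    unfolding rank_in_def using that assms(1) by (intro psubset_card_mono) auto
  show ?thesis
    using *[of x y] *[of y x] assms by (cases x y rule: linorder_cases) auto
qed

lemma rank_in_eq_iff: "finite X \<Longrightarrow> x \<in> X \<Longrightarrow> y \<in> X \<Longrightarrow> rank_in X x = rank_in X y \<longleftrightarrow> x = y"
  using rank_in_less_iff[of X x y] rank_in_less_iff[of X y x] by (auto simp: linorder_neq_iff)

lemma rank_in_bij:
  assumes "finite X"
  shows "bij_betw (rank_in X) X {..<card X}"
proof -
  have inj: "inj_on (rank_in X) X"
    using rank_in_eq_iff[OF assms] by (auto simp: inj_on_def)
  have "rank_in X ` X \<subseteq> {..<card X}"
    unfolding rank_in_def using assms by (auto intro!: psubset_card_mono)
  then have "rank_in X ` X = {..<card X}"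
    using card_image[OF inj] by (intro card_subset_eq) auto
  then show ?thesis
    using inj by (simp add: bij_betw_def)
qed

text \<open>Standardization as a map on points and not merely as a permutation, because occurrences
  are lists of points and have to be carried along.\<close>

definition std :: "point set \<Rightarrow> point \<Rightarrow> point" where
  "std B x = (rank_in (fst ` B) (fst x), rank_in (snd ` B) (snd x))"

lemma std_less:
  assumes "finite B" "x \<in> B" "y \<in> B"
  shows "std B x <\<^sub>P std B y \<longleftrightarrow> x <\<^sub>P y" "std B x <\<^sub>V std B y \<longleftrightarrow> x <\<^sub>V y"
  using assms by (auto simp: std_def less_P_def less_V_def rank_in_less_iff)

lemma standardization:
  assumes "finite B" "inj_on fst B" "inj_on snd B"
  obtains \<tau> where "is_perm \<tau>" "length \<tau> = card B" "diagram \<tau> = std B ` B" "inj_on (std B) B"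
proof -
  let ?n = "card B"
  have bij1: "bij_betw (fst \<circ> std B) B {..<?n}"
  proof -
    have "fst \<circ> std B = rank_in (fst ` B) \<circ> fst"
      by (auto simp: std_def)
    then show ?thesis
      using bij_betw_trans[of fst B "fst ` B" "rank_in (fst ` B)" "{..<?n}"] rank_in_bij[of "fst ` B"] assms
      by (simp add: bij_betw_def card_image)
  qed
  have bij2: "bij_betw (snd \<circ> std B) B {..<?n}"
  proof -
    have "snd \<circ> std B = rank_in (snd ` B) \<circ> snd"
      by (auto simp: std_def)
    then show ?thesis
      using bij_betw_trans[of snd B "snd ` B" "rank_in (snd ` B)" "{..<?n}"] rank_in_bij[of "snd ` B"] assms
      by (simp add: bij_betw_def card_image)
  qed
  let ?inv = "inv_into B (fst \<circ> std B)"
  \<comment> \<open>The entry at \<open>i\<close> is the rank by value of the point whose rank by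
    position is \<open>i\<close>.\<close>
  define \<tau> where "\<tau> = map (\<lambda>i. (snd \<circ> std B) (?inv i)) [0..<?n]"
  have inv: "bij_betw ?inv {..<?n} B"
    using bij_betw_inv_into[OF bij1] .
  have bij: "bij_betw ((snd \<circ> std B) \<circ> ?inv) {..<?n} {..<?n}"
    by (rule bij_betw_trans[OF inv bij2])
  have len: "length \<tau> = ?n"
    by (simp add: \<tau>_def)
  have "set \<tau> = {..<?n}"
    using bij_betw_imp_surj_on[OF bij] by (simp add: \<tau>_def comp_def atLeast_upt lessThan_atLeast0)
  moreover have "distinct \<tau>"
    using bij_betw_imp_inj_on[OF bij] by (simp add: \<tau>_def distinct_map comp_def lessThan_atLeast0)
  ultimately have "is_perm \<tau>"
    by (simp add: is_perm_alt len)
  moreover have "diagram \<tau> = std B ` B"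
  proof -
    have "(i, \<tau> ! i) = std B (?inv i)" if "i < ?n" for i
      using bij_betw_inv_into_right[OF bij1, of i] that by (simp add: \<tau>_def prod_eq_iff)
    then have "diagram \<tau> = (\<lambda>i. std B (?inv i)) ` {..<?n}"
      unfolding diagram_image len by (intro image_cong) auto
    also have "\<dots> = std B ` ?inv ` {..<?n}"
      by (simp add: image_image)
    finally show ?thesis
      by (simp add: bij_betw_imp_surj_on[OF inv])
  qed
  moreover have "inj_on (std B) B"
    using bij_betw_imp_inj_on[OF bij1] by (rule inj_on_imageI2)
  ultimately show ?thesis
    using that len by blast
qed

lemma occurrence_self: "occurrence \<sigma> \<sigma> (map (\<lambda>i. (i, \<sigma> ! i)) [0..<length \<sigma>])"
  by (auto simp: occurrence_def mem_diagram_iff sorted_wrt_iff_nth_less less_P_def less_V_def)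

lemma is_pattern_self: "is_pattern \<sigma> \<sigma>"
  using occurrence_self by (auto simp: is_pattern_def)

lemma standardization_is_pattern:
  assumes "finite B" "B \<subseteq> diagram \<sigma>" "diagram \<tau> = std B ` B"
  shows "is_pattern \<tau> \<sigma>"
proof -
  let ?u = "map (\<lambda>i. (i, \<tau> ! i)) [0..<length \<tau>]"
  have u: "set ?u = std B ` B"
    unfolding assms(3)[symmetric] by (auto simp: diagram_def)
  have G: "inv_into B (std B) x \<in> B" "std B (inv_into B (std B) x) = x" if "x \<in> set ?u" for x
    using that unfolding u by (auto intro: inv_into_into f_inv_into_f)
  have "occurrence \<tau> \<sigma> (map (inv_into B (std B)) ?u)"
  proof (rule occurrence_map[OF occurrence_self])
    show "inv_into B (std B) x \<in> diagram \<sigma>" if "x \<in> set ?u" for x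
      using G(1)[OF that] assms(2) by blast
    show "x <\<^sub>P y \<longleftrightarrow> inv_into B (std B) x <\<^sub>P inv_into B (std B) y"
      if "x \<in> set ?u" "y \<in> set ?u" for x y
      using std_less(1)[OF assms(1) G(1)[OF that(1)] G(1)[OF that(2)]] G(2) that by simp
    show "x <\<^sub>V y \<longleftrightarrow> inv_into B (std B) x <\<^sub>V inv_into B (std B) y"
      if "x \<in> set ?u" "y \<in> set ?u" for x y
      using std_less(2)[OF assms(1) G(1)[OF that(1)] G(1)[OF that(2)]] G(2) that by simp
  qed
  then show ?thesis
    by (auto simp: is_pattern_def)
qed

text \<open>Deleting the point shifts the positions of \<open>s\<close> right of it and the values of \<open>s\<close> above it, so
  the sum of the positions and the sum of the values of \<open>s\<close> change by different amounts.\<close>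

lemma not_stable_delete:
  assumes perm: "is_perm \<sigma>" and st: "stable_occurrence \<pi> \<sigma> s"
    and z: "z \<in> diagram \<sigma> - set s" "row s z \<noteq> col s z"
  shows "\<not> stable_occurrence \<pi> \<tau> (map (std (diagram \<sigma> - {z})) s)"
proof
  let ?B = "diagram \<sigma> - {z}" and ?n = "length \<sigma>"
  let ?F = "fst ` set s"
  assume "stable_occurrence \<pi> \<tau> (map (std ?B) s)"
  then have eq: "snd ` std ?B ` set s = fst ` std ?B ` set s"
    by (simp add: stable_occurrence_alt)
  have sub: "set s \<subseteq> diagram \<sigma>" and F: "snd ` set s = ?F"
    using st by (auto simp: stable_occurrence_alt occurrence_def)
  have fstB: "fst ` ?B = {..<?n} - {fst z}"
    using inj_on_image_set_diff[OF inj_on_fst_diagram[of \<sigma>], of "diagram \<sigma>" "{z}"] z by (simp add: fst_diagram)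
  have sndB: "snd ` ?B = {..<?n} - {snd z}"
    using inj_on_image_set_diff[OF inj_on_snd_diagram[OF perm], of "diagram \<sigma>" "{z}"] z
    by (simp add: snd_diagram[OF perm])
  have zF: "fst z \<notin> ?F" "snd z \<notin> ?F"
    using inj_on_image_mem_iff[OF inj_on_fst_diagram[of \<sigma>] _ sub, of z]
      inj_on_image_mem_iff[OF inj_on_snd_diagram[OF perm] _ sub, of z] z(1) by (auto simp: F)
  have Fn: "?F \<subseteq> {..<?n}"
    using sub fst_diagram by blast
  \<comment> \<open>Removing \<open>p\<close> lowers precisely the numbers above \<open>p\<close>,
    each by one.\<close>
  have rank: "rank_in ({..<?n} - {p}) v + of_bool (p < v) = v" if "v < ?n" "p < ?n" for p v
  proof (cases "p < v")
    case True
    then have "{z \<in> {..<?n} - {p}. z < v} = {..<v} - {p}"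
      using that by auto
    then show ?thesis
      using True by (simp add: rank_in_def card_Diff_singleton)
  next
    case False
    then have "{z \<in> {..<?n} - {p}. z < v} = {..<v}"
      using that by auto
    then show ?thesis
      using False by (simp add: rank_in_def)
  qed
  \<comment> \<open>The sum thus drops by the number of elements above \<open>p\<close>. Sums are
    compared because stability after the deletion only says that two image sets agree.\<close>
  have sum: "sum (\<lambda>v. v) (rank_in ({..<?n} - {p}) ` ?F) + card {v \<in> ?F. p < v} = sum (\<lambda>v. v) ?F"
    if "p < ?n" "p \<notin> ?F" for p
  proof -
    have "inj_on (rank_in ({..<?n} - {p})) ({..<?n} - {p})"
      by (rule bij_betw_imp_inj_on[OF rank_in_bij]) simp
    then have "inj_on (rank_in ({..<?n} - {p})) ?F"
      by (rule inj_on_subset) (use Fn that(2) in blast)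
    then have "sum (\<lambda>v. v) (rank_in ({..<?n} - {p}) ` ?F) = sum (rank_in ({..<?n} - {p})) ?F"
      by (simp add: sum.reindex)
    moreover have "card {v \<in> ?F. p < v} = (\<Sum>v\<in>?F. of_bool (p < v))"
      by (simp add: Int_def)
    moreover have "(\<Sum>v\<in>?F. rank_in ({..<?n} - {p}) v + of_bool (p < v)) = (\<Sum>v\<in>?F. v)"
    proof (rule sum.cong)
      fix v assume "v \<in> ?F"
      then have "v < ?n"
        using Fn by blast
      then show "rank_in ({..<?n} - {p}) v + of_bool (p < v) = v"
        using that(1) by (rule rank)
    qed simp
    ultimately show ?thesis
      by (simp add: sum.distrib)
  qed
  have split: "card {v \<in> ?F. v < p} + card {v \<in> ?F. p < v} = card ?F" if "p \<notin> ?F" for p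
  proof -
    have "{v \<in> ?F. v < p} \<union> {v \<in> ?F. p < v} = ?F"
      using that by force
    moreover have "card ({v \<in> ?F. v < p} \<union> {v \<in> ?F. p < v}) = card {v \<in> ?F. v < p} + card {v \<in> ?F. p < v}"
      by (rule card_Un_disjoint) auto
    ultimately show ?thesis
      by simp
  qed
  have "snd ` std ?B ` set s = rank_in ({..<?n} - {snd z}) ` snd ` set s"
    "fst ` std ?B ` set s = rank_in ({..<?n} - {fst z}) ` ?F"
    by (simp_all add: std_def fstB sndB image_image)
  then have "rank_in ({..<?n} - {snd z}) ` ?F = rank_in ({..<?n} - {fst z}) ` ?F"
    using eq by (simp only: F)
  moreover have "fst z < ?n" "snd z < ?n"
    using z(1) perm by (auto simp: mem_diagram_iff is_perm_nth_less)
  ultimately have "card {v \<in> ?F. fst z < v} = card {v \<in> ?F. snd z < v}"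
    using sum[of "fst z"] sum[of "snd z"] zF by simp
  \<comment> \<open>Complementing within \<open>?F\<close> gives equal numbers of elements below,
    and these are the column and the row of \<open>z\<close>.\<close>
  then have "card {v \<in> ?F. v < fst z} = card {v \<in> ?F. v < snd z}"
    using split[OF zF(1)] split[OF zF(2)] by linarith
  then show False
    using z(2) row_alt[OF perm sub, of z] col_alt[OF sub, of z] by (simp add: F)
qed

text \<open>Deleting \<open>g 0\<close> gives a pattern of \<sigma>, hence a member of
  \<open>C\<close>, in which the formula still holds of the images of \<open>s\<close>. Since
  \<open>g 0\<close> lies off the diagonal, those images are no longer stable.\<close>

lemma no_long_monotone_run:
  assumes C: "perm_class C" and fv: "free_vars \<phi> \<subseteq> {..<length \<pi>}"
    and \<phi>: "\<And>\<sigma> s. \<sigma> \<in> C \<Longrightarrow> length s = length \<pi> \<Longrightarrow> set s \<subseteq> diagram \<sigma> \<Longrightarrow>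
      models \<sigma> s \<phi> \<longleftrightarrow> stable_occurrence \<pi> \<sigma> s"
    and \<sigma>: "\<sigma> \<in> C" and st: "stable_occurrence \<pi> \<sigma> s"
    and run: "monotone_run (diagram \<sigma>) g N" "g ` {..<N} \<inter> set s = {}" "2 ^ quantifier_rank \<phi> \<le> N"
    and off: "row s (g 0) \<noteq> col s (g 0)"
  shows False
proof -
  let ?A = "diagram \<sigma>" and ?B = "diagram \<sigma> - {g 0}"
  have perm: "is_perm \<sigma>"
    using C \<sigma> by (auto simp: perm_class_def)
  have len: "length s = length \<pi>" and sub: "set s \<subseteq> ?A"
    using st by (auto simp: stable_occurrence_alt occurrence_def)
  have N: "0 < N"
    using run(3) by (auto intro: less_le_trans[of 0 "2 ^ quantifier_rank \<phi>"])
  then have g0: "g 0 \<in> ?A - set s"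
    using run(2) monotone_runD(1)[OF run(1), of 0] by auto
  \<comment> \<open>An off-diagonal cell exists only if \<open>s\<close> is non-empty; this supplies
    a default element for the padding below.\<close>
  have k: "0 < length s"
    using off row_le[of s "g 0"] col_le[of s "g 0"] by auto
  \<comment> \<open>Beyond its length the list \<open>s\<close> has unspecified entries, while
    deletion and isomorphism require all variables to have values in the structure and off the run.
    The formula does not see the padded variables.\<close>
  define e where "e i = (if i < length s then s ! i else s ! 0)" for i
  have e_set: "e i \<in> set s" for i
    using k by (auto simp: e_def)
  have e: "e i \<in> ?A - g ` {..<N}" "e i \<in> ?B" for i
  proof -
    show "e i \<in> ?A - g ` {..<N}"
      using e_set[of i] sub run(2) by blast
    have "e i \<noteq> g 0"
      using e_set[of i] g0 by force
    then show "e i \<in> ?B"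
      using e_set[of i] sub by blast
  qed
  have finB: "finite ?B" and injB: "inj_on fst ?B" "inj_on snd ?B"
    using inj_on_fst_diagram[of \<sigma>] inj_on_snd_diagram[OF perm] by (auto intro: inj_on_diff)
  obtain \<tau> where \<tau>: "is_perm \<tau>" "diagram \<tau> = std ?B ` ?B" "inj_on (std ?B) ?B"
    by (rule standardization[OF finB injB]) (rule that)
  have "is_pattern \<tau> \<sigma>"
    by (rule standardization_is_pattern[OF finB _ \<tau>(2)]) blast
  then have \<tau>C: "\<tau> \<in> C"
    using \<tau>(1) C \<sigma> unfolding perm_class_def by blast
  have sB: "std ?B ` set s \<subseteq> diagram \<tau>"
    unfolding \<tau>(2) using sub g0 by blast
  have "satisfies ?A ((!) s) \<phi>"
    using \<phi>[OF \<sigma> len sub] st by (simp add: models_def)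
  also have "satisfies ?A ((!) s) \<phi> \<longleftrightarrow> satisfies ?A e \<phi>"
    using fv len by (intro satisfies_cong) (auto simp: e_def)
  also have "\<dots> \<longleftrightarrow> satisfies ?B e \<phi>"
    using satisfies_delete[OF run(1) N run(3)] e(1) by simp
  also have "\<dots> \<longleftrightarrow> satisfies (diagram \<tau>) (std ?B \<circ> e) \<phi>"
    unfolding \<tau>(2) by (rule satisfies_image[symmetric]) (use \<tau>(3) e(2) in \<open>simp_all add: std_less[OF finB]\<close>)
  also have "\<dots> \<longleftrightarrow> satisfies (diagram \<tau>) ((!) (map (std ?B) s)) \<phi>"
    using fv len by (intro satisfies_cong) (auto simp: e_def)
  finally have "stable_occurrence \<pi> \<tau> (map (std ?B) s)"
    using \<phi>[OF \<tau>C, of "map (std ?B) s"] len sB by (simp add: models_def)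
  then show False
    using not_stable_delete[OF perm st g0 off] by blast
qed

section \<open>Expansions\<close>

lemma cycle_matrix_le: "cycle_matrix c i j \<le> 1"
  by (simp add: cycle_matrix_def)

text \<open>The cyclic successor is injective, so a column of the cycle matrix contains at most one
  1, just as a row does.\<close>

lemma distinct_nth_Suc_mod_eq_iff:
  assumes "distinct c" "t < length c" "t' < length c"
  shows "c ! (Suc t mod length c) = c ! (Suc t' mod length c) \<longleftrightarrow> t = t'"
proof -
  have "Suc t mod length c = Suc t' mod length c \<longleftrightarrow> t = t'"
    using assms(2,3) by (auto simp: mod_Suc split: if_splits)
  moreover have "Suc t mod length c < length c" "Suc t' mod length c < length c"
    using assms(2) by (auto intro: mod_less_divisor)
  ultimately show ?thesis
    using nth_eq_iff_index_eq[OF assms(1)] by simp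
qed

text \<open>The cyclic successor is also onto, so the occupied columns have the same numbers as the
  occupied rows. This is the balance that a stable occurrence requires.\<close>

lemma set_nth_Suc_mod: "(\<lambda>t. c ! (Suc t mod length c)) ` {..<length c} = set c"
proof
  show "set c \<subseteq> (\<lambda>t. c ! (Suc t mod length c)) ` {..<length c}"
  proof
    fix x assume "x \<in> set c"
    then obtain t where t: "t < length c" "x = c ! t"
      by (auto simp: in_set_conv_nth)
    show "x \<in> (\<lambda>t. c ! (Suc t mod length c)) ` {..<length c}"
    proof (cases t)
      case 0
      then show ?thesis
        using t by (intro image_eqI[of _ _ "length c - 1"]) auto
    next
      case (Suc u)
      then show ?thesis
        using t by (intro image_eqI[of _ _ u]) auto
    qed
  qed
qed (auto intro!: nth_mem mod_less_divisor)

text \<open>The points of \<open>s\<close> get odd coordinates, and the point of cell \<open>(i, j)\<close> goes to \<open>(2 j, 2 i)\<close>.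
  The positions and the values used then form the same set, so standardizing keeps \<open>s\<close> stable.\<close>

lemma expansion_exists:
  assumes pi: "is_perm \<pi>" and c: "distinct c" "set c \<subseteq> {..length \<pi>}"
  obtains \<epsilon> s where "is_expansion \<pi> c \<epsilon> s"
proof -
  let ?k = "length \<pi>" and ?r = "length c"
  define S where "S j = (2 * j + 1, 2 * \<pi> ! j + 1)" for j
  define T where "T t = (2 * c ! (Suc t mod ?r), 2 * c ! t)" for t
  define Z where "Z = (\<lambda>j. 2 * j + 1) ` {..<?k} \<union> (\<lambda>j. 2 * j) ` set c"
  define B where "B = S ` {..<?k} \<union> T ` {..<?r}"
  have pi_img: "(!) \<pi> ` {..<?k} = {..<?k}"
    using is_perm_bij[OF pi] by (simp add: bij_betw_def)
  have odd_img: "(\<lambda>j. 2 * \<pi> ! j + 1) ` {..<?k} = (\<lambda>j. 2 * j + 1) ` {..<?k}"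
    using arg_cong[OF pi_img, of "image (\<lambda>j. 2 * j + 1)"] by (simp add: image_image)
  have fstB: "fst ` B = Z"
    using arg_cong[OF set_nth_Suc_mod[of c], of "image (\<lambda>j. 2 * j)"]
    by (simp add: B_def Z_def S_def T_def image_Un image_image)
  have sndB: "snd ` B = Z"
  proof -
    have "(\<lambda>t. snd (T t)) ` {..<?r} = (\<lambda>j. 2 * j) ` (!) c ` {..<?r}"
      by (simp add: T_def image_image)
    also have "(!) c ` {..<?r} = set c"
      by (auto simp: set_conv_nth)
    finally show ?thesis
      using odd_img by (simp add: B_def Z_def image_Un image_image S_def)
  qed
  have finB: "finite B"
    by (simp add: B_def)
  have eqs: "fst (S i) = fst (S j) \<longleftrightarrow> i = j" "snd (S i) = snd (S j) \<longleftrightarrow> \<pi> ! i = \<pi> ! j"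
    "fst (S i) \<noteq> fst (T t)" "snd (S i) \<noteq> snd (T t)" for i j t
    by (auto simp: S_def T_def) presburger+
  have eqT: "fst (T t) = fst (T t') \<longleftrightarrow> t = t'" "snd (T t) = snd (T t') \<longleftrightarrow> t = t'"
    if "t < ?r" "t' < ?r" for t t'
    using that distinct_nth_Suc_mod_eq_iff[OF c(1)] nth_eq_iff_index_eq[OF c(1)] by (auto simp: T_def)
  have "fst x = fst y \<longleftrightarrow> x = y" "snd x = snd y \<longleftrightarrow> x = y" if "x \<in> B" "y \<in> B" for x y
    using that eqs eqT is_perm_nth_eq_iff[OF pi] unfolding B_def by (auto, metis+)
  then have injB: "inj_on fst B" "inj_on snd B"
    by (auto simp: inj_on_def)
  obtain \<epsilon> where \<epsilon>: "is_perm \<epsilon>" "length \<epsilon> = card B" "diagram \<epsilon> = std B ` B" "inj_on (std B) B"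
    by (rule standardization[OF finB injB])
  have ST: "S i \<noteq> T t" for i t
    using eqs(3) by metis
  have injS: "inj S"
    using eqs(1) by (metis injI)
  have injT: "inj_on T {..<?r}"
    using eqT(1) by (metis inj_onI lessThan_iff)
  have "S ` {..<?k} \<inter> T ` {..<?r} = {}"
    using ST by blast
  then have cardB: "card B = ?k + ?r"
    unfolding B_def using injT inj_on_subset[OF injS, of "{..<?k}"]
    by (simp add: card_Un_disjoint card_image)
  define s where "s = map (std B \<circ> S) [0..<?k]"
  have SB: "S j \<in> B" if "j < ?k" for j
    using that by (auto simp: B_def)
  have TB: "T t \<in> B" if "t < ?r" for t
    using that by (auto simp: B_def)
  have set_s: "set s = std B ` S ` {..<?k}"
    by (auto simp: s_def)
  have occ: "occurrence \<pi> \<epsilon> s"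
    unfolding occurrence_def
  proof (intro conjI allI impI)
    show "set s \<subseteq> diagram \<epsilon>"
      unfolding set_s \<epsilon>(3) using SB by auto
    show "sorted_wrt (<\<^sub>P) s"
      using std_less(1)[OF finB SB SB] by (auto simp: s_def sorted_wrt_iff_nth_less S_def less_P_def)
    show "s ! a <\<^sub>V s ! b \<longleftrightarrow> \<pi> ! a < \<pi> ! b" if "a < ?k" "b < ?k" for a b
      using std_less(2)[OF finB SB SB, OF that] that by (auto simp: s_def S_def less_V_def)
  qed (simp add: s_def)
  have "snd ` set s = fst ` set s"
  proof -
    have "snd ` set s = rank_in Z ` (\<lambda>j. 2 * \<pi> ! j + 1) ` {..<?k}"
      by (simp add: set_s std_def sndB image_image S_def)
    also have "\<dots> = rank_in Z ` (\<lambda>j. 2 * j + 1) ` {..<?k}"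
      by (simp only: odd_img)
    also have "\<dots> = fst ` set s"
      by (simp add: set_s std_def fstB image_image S_def)
    finally show ?thesis .
  qed
  then have st: "stable_occurrence \<pi> \<epsilon> s"
    using occ by (simp add: stable_occurrence_alt)
  have c_le: "c ! t \<le> ?k" if "t < ?r" for t
    using c(2) that nth_mem by fastforce
  have inj_stdS: "inj_on (std B \<circ> S) {..<?k}"
    using injS by (intro comp_inj_on) (auto intro: inj_on_subset[OF \<epsilon>(4)] inj_on_subset SB)
  \<comment> \<open>An odd coordinate \<open>2 * j + 1\<close> is below \<open>2 * m\<close> iff
    \<open>j < m\<close>, so a point at position \<open>2 * m\<close> has exactly \<open>m\<close>
    elements of \<open>s\<close> to its left; likewise for values below.\<close>
  have colT: "col s (std B (T t)) = c ! (Suc t mod ?r)" if t: "t < ?r" for t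
  proof -
    have le: "c ! (Suc t mod ?r) \<le> ?k"
      using t by (intro c_le mod_less_divisor) auto
    have "{y \<in> set s. y <\<^sub>P std B (T t)} = (std B \<circ> S) ` {..<c ! (Suc t mod ?r)}"
      using std_less(1)[OF finB SB TB[OF t]] le
      by (auto simp: set_s S_def[unfolded] T_def less_P_def image_iff)
    then show ?thesis
      using card_image[OF inj_on_subset[OF inj_stdS], of "{..<c ! (Suc t mod ?r)}"] le
      by (simp add: col_def)
  qed
  have rowT: "row s (std B (T t)) = c ! t" if t: "t < ?r" for t
  proof -
    let ?J = "{j \<in> {..<?k}. \<pi> ! j < c ! t}"
    have "(!) \<pi> ` ?J = {..<c ! t}"
      using pi_img c_le[OF t] by (auto simp: set_eq_iff image_iff) (metis lessThan_iff less_le_trans)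
    moreover have "inj_on ((!) \<pi>) ?J"
      using is_perm_bij[OF pi] by (auto simp: bij_betw_def intro: inj_on_subset)
    ultimately have J: "card ?J = c ! t"
      using card_image[of "(!) \<pi>" ?J] by simp
    have "{y \<in> set s. y <\<^sub>V std B (T t)} = (std B \<circ> S) ` ?J"
      using std_less(2)[OF finB SB TB[OF t]] by (auto simp: set_s S_def T_def less_V_def image_iff)
    moreover have "?J \<subseteq> {..<?k}"
      by blast
    ultimately show ?thesis
      using card_image[OF inj_on_subset[OF inj_stdS]] J by (simp only: row_def)
  qed
  have out: "diagram \<epsilon> - set s = (std B \<circ> T) ` {..<?r}"
  proof -
    have "diagram \<epsilon> - set s = std B ` (B - S ` {..<?k})"
      unfolding \<epsilon>(3) set_s using inj_on_image_set_diff[OF \<epsilon>(4), of B "S ` {..<?k}"] SB by auto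
    also have "B - S ` {..<?k} = T ` {..<?r}"
      unfolding B_def using ST by auto
    finally show ?thesis
      by (simp add: image_comp)
  qed
  have cells: "cell_matrix \<epsilon> s i j = cycle_matrix c i j" for i j
  proof -
    let ?P = "{t \<in> {..<?r}. c ! t = i \<and> c ! (Suc t mod ?r) = j}"
    have cell: "cell \<epsilon> s i j = (std B \<circ> T) ` ?P"
      unfolding cell_alt out using rowT colT by auto
    have "inj_on (std B \<circ> T) ?P"
    proof (rule comp_inj_on)
      show "inj_on T ?P"
        by (rule inj_on_subset[OF injT]) auto
      show "inj_on (std B) (T ` ?P)"
        by (rule inj_on_subset[OF \<epsilon>(4)]) (use TB in auto)
    qed
    then have card: "cell_matrix \<epsilon> s i j = card ?P"
      unfolding cell_matrix_def cell by (rule card_image)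
    show ?thesis
    proof (cases "\<exists>t<?r. i = c ! t \<and> j = c ! (Suc t mod ?r)")
      case True
      then obtain t where t: "t < ?r" "i = c ! t" "j = c ! (Suc t mod ?r)"
        by blast
      then have "?P = {t}"
        using nth_eq_iff_index_eq[OF c(1)] by auto
      then show ?thesis
        using card True by (simp add: cycle_matrix_def)
    next
      case False
      then have "?P = {}"
        by auto
      then show ?thesis
        using card False by (simp only: cycle_matrix_def if_False card.empty)
    qed
  qed
  show ?thesis
    using that[of \<epsilon> s] \<epsilon>(1,2) cardB st cells by (simp add: is_expansion_def)
qed

section \<open>Definability excludes expansion classes\<close>

lemma increasing_perms_upt: "[0..<N] \<in> increasing_perms"
  by (auto simp: increasing_perms_def is_perm_alt sorted_wrt_iff_nth_less)

lemma decreasing_perms_rev_upt: "rev [0..<N] \<in> decreasing_perms"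
  by (auto simp: decreasing_perms_def is_perm_alt sorted_wrt_iff_nth_less rev_nth)

text \<open>The length of a block depends only on membership in \<open>F\<close>, which \<sigma>
  preserves. Substituting \<open>\<sigma> ! p\<close> for the summation index then turns one sum
  into the other.\<close>

lemma val_offset_eq_pos_offset:
  assumes perm: "is_perm \<sigma>" and F: "(\<lambda>q. \<sigma> ! q) ` F = F" "F \<subseteq> {..<length \<sigma>}"
    and w: "\<And>q. q < length \<sigma> \<Longrightarrow> length (\<alpha>s ! q) = (if q \<in> F then a else b)" and q: "q < length \<sigma>"
  shows "val_offset \<sigma> \<alpha>s q = pos_offset \<alpha>s (\<sigma> ! q)"
proof -
  have bij: "bij_betw ((!) \<sigma>) {..<length \<sigma>} {..<length \<sigma>}"
    by (rule is_perm_bij[OF perm])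
  have iff: "\<sigma> ! p \<in> F \<longleftrightarrow> p \<in> F" if "p < length \<sigma>" for p
    using F bij that inj_on_image_mem_iff[of "(!) \<sigma>" "{..<length \<sigma>}" p F] by (auto simp: bij_betw_def)
  have "pos_offset \<alpha>s (\<sigma> ! q) = (\<Sum>v<\<sigma> ! q. if v \<in> F then a else b)"
    unfolding pos_offset_def using is_perm_nth_less[OF perm q] by (intro sum.cong) (auto simp: w)
  also have "\<dots> = (\<Sum>p | p < length \<sigma> \<and> \<sigma> ! p < \<sigma> ! q. if \<sigma> ! p \<in> F then a else b)"
  proof (rule sum.reindex_cong)
    show "inj_on ((!) \<sigma>) {p. p < length \<sigma> \<and> \<sigma> ! p < \<sigma> ! q}"
      using bij by (auto simp: bij_betw_def intro: inj_on_subset)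
    have "{..<\<sigma> ! q} \<subseteq> (!) \<sigma> ` {..<length \<sigma>}"
      using bij is_perm_nth_less[OF perm q] by (auto simp: bij_betw_def)
    then show "{..<\<sigma> ! q} = (!) \<sigma> ` {p. p < length \<sigma> \<and> \<sigma> ! p < \<sigma> ! q}"
      by blast
  qed simp
  also have "\<dots> = val_offset \<sigma> \<alpha>s q"
    unfolding val_offset_def by (intro sum.cong) (auto simp: w iff)
  finally show ?thesis
    by simp
qed

lemma definable_imp_no_expansion_class:
  assumes pi: "is_perm \<pi>" and C: "perm_class C" and def: "stable_occurrences_definable \<pi> C"
  shows "contains_no_expansion_class \<pi> C"
  unfolding contains_no_expansion_class_def
proof (intro allI impI notI)
  fix c Xs
  assume "distinct c \<and> set c \<subseteq> {..length \<pi>} \<and> 2 \<le> length c \<and>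
    length Xs = length c \<and> set Xs \<subseteq> {increasing_perms, decreasing_perms}"
  then have c: "distinct c" "set c \<subseteq> {..length \<pi>}" "2 \<le> length c"
    and Xs: "length Xs = length c" "set Xs \<subseteq> {increasing_perms, decreasing_perms}"
    by auto
  assume contained: "expansion_class \<pi> c Xs \<subseteq> C"
  obtain \<phi> where \<phi>: "free_vars \<phi> \<subseteq> {..<length \<pi>}"
    "\<And>\<sigma> s. \<sigma> \<in> C \<Longrightarrow> length s = length \<pi> \<Longrightarrow> set s \<subseteq> diagram \<sigma> \<Longrightarrow>
      models \<sigma> s \<phi> \<longleftrightarrow> stable_occurrence \<pi> \<sigma> s"
    using def unfolding stable_occurrences_definable_def by blast
  \<comment> \<open>Long enough for deleting a point unnoticed, and common to all blocks as
    \<open>val_offset_eq_pos_offset\<close> requires.\<close>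
  define N where "N = (2::nat) ^ quantifier_rank \<phi>"
  have N: "0 < N"
    by (simp add: N_def)
  obtain \<epsilon> s where exp: "is_expansion \<pi> c \<epsilon> s"
    using expansion_exists[OF pi c(1,2)] by blast
  then have \<epsilon>: "is_perm \<epsilon>" "length \<epsilon> = length \<pi> + length c"
    and st: "stable_occurrence \<pi> \<epsilon> s" and occ: "occurrence \<pi> \<epsilon> s"
    and cells: "\<And>i j. i \<le> length \<pi> \<Longrightarrow> j \<le> length \<pi> \<Longrightarrow> cell_matrix \<epsilon> s i j = cycle_matrix c i j"
    by (auto simp: is_expansion_def stable_occurrence_alt)
  let ?F = "fst ` set s"
  have sub: "set s \<subseteq> diagram \<epsilon>"
    using occ by (simp add: occurrence_def)
  have F: "?F \<subseteq> {..<length \<epsilon>}" "(\<lambda>q. \<epsilon> ! q) ` ?F = ?F"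
    using st sub fst_diagram by (auto simp: stable_occurrence_def)
  define \<Theta> where "\<Theta> = map (\<lambda>X. if X = increasing_perms then [0..<N] else rev [0..<N]) Xs"
  define \<alpha>s where "\<alpha>s = outside_blocks \<epsilon> s \<Theta>"
  define \<sigma> where "\<sigma> = inflate \<epsilon> \<alpha>s"
  have \<Theta>: "\<Theta> ! t \<in> Xs ! t" "\<Theta> ! t \<in> {[0..<N], rev [0..<N]}" if "t < length c" for t
  proof -
    have "Xs ! t \<in> {increasing_perms, decreasing_perms}"
      using Xs(1) subsetD[OF Xs(2) nth_mem] that by simp
    then have "Xs ! t = increasing_perms \<or> Xs ! t \<noteq> increasing_perms \<and> Xs ! t = decreasing_perms"
      by blast
    then show "\<Theta> ! t \<in> Xs ! t"
    proof
      assume "Xs ! t = increasing_perms"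
      then show ?thesis
        using that Xs(1) increasing_perms_upt by (simp add: \<Theta>_def)
    next
      assume t: "Xs ! t \<noteq> increasing_perms \<and> Xs ! t = decreasing_perms"
      have "\<Theta> ! t = rev [0..<N]"
        using that Xs(1) conjunct1[OF t] by (simp add: \<Theta>_def)
      then show ?thesis
        using decreasing_perms_rev_upt conjunct2[OF t] by simp
    qed
    show "\<Theta> ! t \<in> {[0..<N], rev [0..<N]}"
      using that Xs(1) by (simp add: \<Theta>_def)
  qed
  have \<alpha>_in: "\<alpha>s ! q = [0]" if "q < length \<epsilon>" "q \<in> ?F" for q
    using outside_blocks_nth(1)[OF that] by (simp add: \<alpha>s_def)
  have \<alpha>_out: "\<alpha>s ! q \<in> {[0..<N], rev [0..<N]}" if "q < length \<epsilon>" "q \<notin> ?F" for q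
    using outside_blocks_nth(2)[OF that] \<Theta>(2)[OF card_outside_less[OF occ \<epsilon>(2) that]] by (simp add: \<alpha>s_def)
  have \<alpha>_perm: "is_perm (\<alpha>s ! q)" if "q < length \<epsilon>" for q
    using \<alpha>_in[OF that] \<alpha>_out[OF that] by (cases "q \<in> ?F") (auto simp: is_perm_alt)
  have \<alpha>_len: "length (\<alpha>s ! q) = (if q \<in> ?F then 1 else N)" if "q < length \<epsilon>" for q
    using \<alpha>_in[OF that] \<alpha>_out[OF that] by (cases "q \<in> ?F") auto
  have \<alpha>_pos: "0 < length (\<alpha>s ! q)" if "q < length \<epsilon>" for q
    using \<alpha>_len[OF that] N by simp
  have \<sigma>: "is_perm \<sigma>"
    unfolding \<sigma>_def by (rule is_perm_inflate[OF \<epsilon>(1) \<alpha>_perm])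
  moreover have "length \<Theta> = length c"
    by (simp add: \<Theta>_def Xs(1))
  moreover have "is_pattern \<sigma> (inflate_outside \<epsilon> s \<Theta>)"
    unfolding inflate_outside_alt \<alpha>s_def[symmetric] \<sigma>_def[symmetric] by (rule is_pattern_self)
  ultimately have "\<sigma> \<in> expansion_class \<pi> c Xs"
    unfolding expansion_class_def using exp \<Theta>(1) by blast
  then have \<sigma>C: "\<sigma> \<in> C"
    using contained by blast
  \<comment> \<open>Intended for points of \<open>s\<close>: their block is \<open>[0]\<close>, so
    index 0 is its only point.\<close>
  define G where "G x = block_point \<epsilon> \<alpha>s (fst x) 0" for x :: point
  define s' where "s' = map G s"
  have s_lt: "fst x < length \<epsilon>" if "x \<in> diagram \<epsilon>" for x
    using that by (simp add: mem_diagram_iff)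
  have occ': "occurrence \<pi> \<sigma> s'"
    unfolding s'_def
  proof (rule occurrence_map[OF occ])
    fix x assume x: "x \<in> set s"
    show "G x \<in> diagram \<sigma>"
      unfolding \<sigma>_def diagram_inflate G_def using x sub s_lt \<alpha>_pos by blast
    fix y assume y: "y \<in> set s"
    have xy: "x \<in> diagram \<epsilon>" "y \<in> diagram \<epsilon>"
      using x y sub by auto
    show "x <\<^sub>P y \<longleftrightarrow> G x <\<^sub>P G y"
      unfolding G_def using block_point_less_P[OF \<alpha>_pos \<alpha>_pos, OF s_lt s_lt, OF xy] by (auto simp: less_P_def)
    show "x <\<^sub>V y \<longleftrightarrow> G x <\<^sub>V G y"
      unfolding G_def using block_point_less_V[OF \<epsilon>(1) s_lt s_lt \<alpha>_perm \<alpha>_perm \<alpha>_pos \<alpha>_pos, OF xy s_lt s_lt s_lt s_lt, OF xy xy] xy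
      by (auto simp: less_V_def mem_diagram_iff)
  qed
  have "snd (G x) = pos_offset \<alpha>s (\<epsilon> ! fst x)" if "x \<in> set s" for x
  proof -
    have x: "fst x \<in> ?F" "fst x < length \<epsilon>"
      using that s_lt[OF subsetD[OF sub that]] by auto
    then show ?thesis
      using val_offset_eq_pos_offset[OF \<epsilon>(1) F(2,1) \<alpha>_len x(2)] \<alpha>_in[OF x(2,1)]
      by (simp add: G_def block_point_def)
  qed
  then have "snd ` set s' = pos_offset \<alpha>s ` (\<lambda>q. \<epsilon> ! q) ` ?F"
    by (simp add: s'_def image_image cong: image_cong)
  also have "\<dots> = pos_offset \<alpha>s ` ?F"
    by (simp only: F(2))
  also have "\<dots> = fst ` set s'"
    by (simp add: s'_def G_def block_point_def image_image)
  finally have st': "stable_occurrence \<pi> \<sigma> s'"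
    using occ' by (simp add: stable_occurrence_alt)
  have l: "0 < length c" "1 < length c"
    using c(3) by auto
  \<comment> \<open>Here the cycle is non-trivial: the cell for its first step is off the diagonal,
    and the block replacing its only point becomes the run.\<close>
  have c01: "c ! 0 \<noteq> c ! 1" "c ! 0 \<le> length \<pi>" "c ! 1 \<le> length \<pi>"
    using nth_eq_iff_index_eq[OF c(1) l] subsetD[OF c(2) nth_mem[OF l(1)]] subsetD[OF c(2) nth_mem[OF l(2)]]
    by simp_all
  have "\<exists>t<length c. c ! 0 = c ! t \<and> c ! 1 = c ! (Suc t mod length c)"
    using c(3) by (intro exI[of _ 0]) auto
  then have "cell_matrix \<epsilon> s (c ! 0) (c ! 1) = 1"
    using cells[OF c01(2,3)] by (simp add: cycle_matrix_def)
  then obtain x where "x \<in> cell \<epsilon> s (c ! 0) (c ! 1)"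
    unfolding cell_matrix_def by (metis card_1_singletonE insertI1)
  then have x: "x \<in> diagram \<epsilon>" "x \<notin> set s" "row s x = c ! 0" "col s x = c ! 1"
    by (auto simp: cell_alt)
  define q where "q = fst x"
  have q: "q < length \<epsilon>" "q \<notin> ?F"
    using x(1,2) sub diagram_eq_iff_fst[of x \<epsilon>] s_lt by (auto simp: q_def) 
  have q_len: "length (\<alpha>s ! q) = N"
    using \<alpha>_len[OF q(1)] q(2) by simp
  define g where "g = block_point \<epsilon> \<alpha>s q"
  \<comment> \<open>Points of different blocks compare like the points they replace, so
    \<open>g 0\<close> has relative to \<open>s'\<close> the coordinates that \<open>x\<close> has
    relative to \<open>s\<close>.\<close>
  have "row s' (g 0) = card (G ` {y \<in> set s. y <\<^sub>V x})"
  proof -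
    have "G y <\<^sub>V g 0 \<longleftrightarrow> y <\<^sub>V x" if "y \<in> set s" for y
    proof -
      have y: "y \<in> diagram \<epsilon>" "fst y \<noteq> q"
        using that sub q by auto
      show ?thesis
        using block_point_less_V[OF \<epsilon>(1) s_lt[OF y(1)] q(1) \<alpha>_perm[OF s_lt[OF y(1)]] \<alpha>_perm[OF q(1)]
            \<alpha>_pos[OF s_lt[OF y(1)]] \<alpha>_pos[OF q(1)]] y x(1)
        by (simp add: G_def g_def less_V_def mem_diagram_iff q_def)
    qed
    then show ?thesis
      unfolding row_def s'_def by (intro arg_cong[where f = card]) auto
  qed
  moreover have "col s' (g 0) = card (G ` {y \<in> set s. y <\<^sub>P x})"
  proof -
    have "G y <\<^sub>P g 0 \<longleftrightarrow> y <\<^sub>P x" if "y \<in> set s" for y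
    proof -
      have y: "y \<in> diagram \<epsilon>" "fst y \<noteq> q"
        using that sub q by auto
      show ?thesis
        using block_point_less_P[OF \<alpha>_pos[OF s_lt[OF y(1)]] \<alpha>_pos[OF q(1)]] y
        by (simp add: G_def g_def less_P_def q_def)
    qed
    then show ?thesis
      unfolding col_def s'_def by (intro arg_cong[where f = card]) auto
  qed
  moreover have "inj_on G (set s)"
    using occurrence_distinct[OF occ'] by (simp add: s'_def distinct_map)
  ultimately have off: "row s' (g 0) \<noteq> col s' (g 0)"
    using x(3,4) c01(1) by (simp add: card_image inj_on_subset row_def col_def)
  have "monotone_run (diagram \<sigma>) g N"
    unfolding monotone_run_def
  proof (intro conjI ballI allI impI)
    show "g ` {..<N} \<subseteq> diagram \<sigma>"
      using q(1) q_len diagram_inflate unfolding \<sigma>_def g_def by blast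
    show "g i <\<^sub>P g j \<longleftrightarrow> i < j" if "i < N" "j < N" for i j
      using block_point_less_P[of i \<alpha>s q j q \<epsilon>] that q_len by (simp add: g_def)
    have V: "g i <\<^sub>V g j \<longleftrightarrow> \<alpha>s ! q ! i < \<alpha>s ! q ! j" if "i < N" "j < N" for i j
      using block_point_less_V[OF \<epsilon>(1) q(1) q(1) \<alpha>_perm \<alpha>_perm, OF q(1) q(1), of i j] that q_len
      by (simp add: g_def)
    show "(\<forall>i<N. \<forall>j<N. g i <\<^sub>V g j \<longleftrightarrow> i < j) \<or> (\<forall>i<N. \<forall>j<N. g i <\<^sub>V g j \<longleftrightarrow> j < i)"
      using \<alpha>_out[OF q] by (auto simp: V rev_nth)
    fix y i j assume y: "y \<in> diagram \<sigma> - g ` {..<N}" and ij: "i < N" "j < N"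
    then obtain p l where p: "p < length \<epsilon>" "l < length (\<alpha>s ! p)" "y = block_point \<epsilon> \<alpha>s p l"
      unfolding \<sigma>_def using diagram_inflate by blast
    then have pq: "p \<noteq> q"
      using y q_len by (auto simp: g_def)
    have ij': "i < length (\<alpha>s ! q)" "j < length (\<alpha>s ! q)"
      using ij q_len by auto
    show "y <\<^sub>P g i \<longleftrightarrow> y <\<^sub>P g j" "g i <\<^sub>P y \<longleftrightarrow> g j <\<^sub>P y"
      using block_point_less_P[OF p(2) ij'(1)] block_point_less_P[OF p(2) ij'(2)]
        block_point_less_P[OF ij'(1) p(2)] block_point_less_P[OF ij'(2) p(2)] pq
      by (auto simp: p(3) g_def)
    note V = block_point_less_V[OF \<epsilon>(1)]
    show "y <\<^sub>V g i \<longleftrightarrow> y <\<^sub>V g j" "g i <\<^sub>V y \<longleftrightarrow> g j <\<^sub>V y"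
      using V[OF p(1) q(1) \<alpha>_perm[OF p(1)] \<alpha>_perm[OF q(1)] p(2) ij'(1)]
        V[OF p(1) q(1) \<alpha>_perm[OF p(1)] \<alpha>_perm[OF q(1)] p(2) ij'(2)]
        V[OF q(1) p(1) \<alpha>_perm[OF q(1)] \<alpha>_perm[OF p(1)] ij'(1) p(2)]
        V[OF q(1) p(1) \<alpha>_perm[OF q(1)] \<alpha>_perm[OF p(1)] ij'(2) p(2)] pq
      by (auto simp: p(3) g_def)
  qed
  moreover have "g ` {..<N} \<inter> set s' = {}"
  proof -
    have "g i \<noteq> G y" if "i < N" "y \<in> set s" for i y
    proof -
      have y: "fst y < length \<epsilon>" "fst y \<noteq> q"
        using s_lt[OF subsetD[OF sub that(2)]] that(2) q(2) by auto
      have "g i <\<^sub>P G y \<or> G y <\<^sub>P g i"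
        unfolding g_def G_def
        using block_point_less_P[of i \<alpha>s q 0 "fst y" \<epsilon>] block_point_less_P[of 0 \<alpha>s "fst y" i q \<epsilon>]
          \<alpha>_pos[OF y(1)] that(1) q_len y(2) by auto
      then show ?thesis
        by (auto simp: less_P_def)
    qed
    then show ?thesis
      unfolding s'_def set_map by blast
  qed
  ultimately show False
    using \<phi> \<sigma>C st' off
    by (intro no_long_monotone_run[OF C, where \<phi> = \<phi> and \<sigma> = \<sigma> and s = s' and g = g and N = N and \<pi> = \<pi>])
      (simp_all add: N_def)
qed

section \<open>Cycles of large cells\<close>

text \<open>The vertices reachable from \<open>j\<close> along large entries receive at least \<open>a i j\<close> if \<open>i\<close> is not among
  them, and lose only small entries; by balance the two total flows agree.\<close>

lemma reachable_of_balanced: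
  fixes a :: "nat \<Rightarrow> nat \<Rightarrow> nat"
  assumes bal: "\<And>i. i \<le> k \<Longrightarrow> (\<Sum>j\<le>k. a i j) = (\<Sum>j\<le>k. a j i)"
    and ij: "i \<le> k" "j \<le> k" and large: "a i j \<ge> (Suc k)\<^sup>2 * T" and T: "0 < T"
  defines "E \<equiv> \<lambda>x y. x \<le> k \<and> y \<le> k \<and> x \<noteq> y \<and> T \<le> a x y"
  shows "E\<^sup>*\<^sup>* j i"
proof (rule ccontr)
  assume not: "\<not> E\<^sup>*\<^sup>* j i"
  define R where "R = {x. x \<le> k \<and> E\<^sup>*\<^sup>* j x}"
  define Q where "Q = {..k} - R"
  have R: "R \<subseteq> {..k}" "finite R" "finite Q" "R \<inter> Q = {}" "{..k} = R \<union> Q"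
    by (auto simp: R_def Q_def intro: finite_subset[of _ "{..k}"])
  have small: "a x y < T" if "x \<in> R" "y \<in> Q" for x y
  proof (rule ccontr)
    assume "\<not> a x y < T"
    then have "E x y"
      using that by (auto simp: E_def R_def Q_def)
    then have "y \<in> R"
      using that by (auto simp: R_def Q_def intro: rtranclp.rtrancl_into_rtrancl)
    then show False
      using that by (simp add: Q_def)
  qed
  have split: "(\<Sum>y\<le>k. f y) = (\<Sum>y\<in>R. f y) + (\<Sum>y\<in>Q. f y)" for f :: "nat \<Rightarrow> nat"
    unfolding R(5) using R by (intro sum.union_disjoint) auto
  have "(\<Sum>x\<in>R. \<Sum>y\<le>k. a x y) = (\<Sum>x\<in>R. \<Sum>y\<le>k. a y x)"
    by (rule sum.cong[OF refl], rule bal) (use R(1) in auto)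
  then have "(\<Sum>x\<in>R. \<Sum>y\<in>R. a x y) + (\<Sum>x\<in>R. \<Sum>y\<in>Q. a x y)
      = (\<Sum>x\<in>R. \<Sum>y\<in>R. a y x) + (\<Sum>x\<in>R. \<Sum>y\<in>Q. a y x)"
    by (simp add: split sum.distrib)
  \<comment> \<open>Flow inside \<open>R\<close> appears on both sides and cancels, which leaves the
    flow across the boundary.\<close>
  moreover have "(\<Sum>x\<in>R. \<Sum>y\<in>R. a x y) = (\<Sum>x\<in>R. \<Sum>y\<in>R. a y x)"
    by (rule sum.swap)
  ultimately have flow: "(\<Sum>x\<in>R. \<Sum>y\<in>Q. a x y) = (\<Sum>x\<in>R. \<Sum>y\<in>Q. a y x)"
    by simp
  have j: "j \<in> R" and i: "i \<in> Q"
    using ij not by (auto simp: R_def Q_def)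
  \<comment> \<open>At most \<open>(Suc k)\<^sup>2\<close> entries leave \<open>R\<close>, each at
    most \<open>T - 1\<close>; their total is below the single entry \<open>a i j\<close>, which
    enters \<open>R\<close>.\<close>
  have "a x y \<le> T - 1" if "x \<in> R" "y \<in> Q" for x y
    using small[OF that] by simp
  then have "(\<Sum>x\<in>R. \<Sum>y\<in>Q. a x y) \<le> (\<Sum>x\<in>R. \<Sum>y\<in>Q. T - 1)"
    by (intro sum_mono)
  also have "\<dots> = card R * card Q * (T - 1)"
    by simp
  also have "\<dots> \<le> Suc k * Suc k * (T - 1)"
  proof -
    have "Q \<subseteq> {..k}"
      by (auto simp: Q_def)
    then have "card Q \<le> Suc k" "card R \<le> Suc k"
      using card_mono[of "{..k}" R] card_mono[of "{..k}" Q] R(1) by simp_all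
    then show ?thesis
      by (intro mult_le_mono le_refl)
  qed
  also have "\<dots> < (Suc k)\<^sup>2 * T"
    unfolding power2_eq_square by (rule mult_less_mono2) (use T in auto)
  also have "\<dots> \<le> a i j"
    by (rule large)
  also have "\<dots> \<le> (\<Sum>y\<in>Q. a y j)"
    using i R by (intro member_le_sum) auto
  also have "\<dots> \<le> (\<Sum>x\<in>R. \<Sum>y\<in>Q. a y x)"
    using j R by (intro member_le_sum[of j R "\<lambda>x. \<Sum>y\<in>Q. a y x"]) auto
  finally show False
    using flow by simp
qed

lemma rtrancl_path_nth_edge:
  "rtrancl_path r x xs y \<Longrightarrow> t < length xs \<Longrightarrow> r ((x # xs) ! t) (xs ! t)"
proof (induction arbitrary: t rule: rtrancl_path.induct)
  case (step x y ys z)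
  then show ?case
    by (cases t) auto
qed simp

text \<open>One factor \<open>(Suc k)\<^sup>2\<close> is spent on finding a single large entry
  \<open>(i, j)\<close> among the off-diagonal ones, the other on reaching \<open>i\<close> from
  \<open>j\<close> along entries of size at least \<open>T\<close>. That path, closed by
  \<open>(i, j)\<close>, is the cycle.\<close>

lemma cycle_of_balanced:
  fixes a :: "nat \<Rightarrow> nat \<Rightarrow> nat"
  assumes bal: "\<And>i. i \<le> k \<Longrightarrow> (\<Sum>j\<le>k. a i j) = (\<Sum>j\<le>k. a j i)"
    and large: "(\<Sum>i\<le>k. \<Sum>j\<in>{..k} - {i}. a i j) \<ge> (Suc k)\<^sup>2 * ((Suc k)\<^sup>2 * T)" and T: "0 < T"
  obtains c where "distinct c" "set c \<subseteq> {..k}" "2 \<le> length c"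
    "\<And>t. t < length c \<Longrightarrow> T \<le> a (c ! t) (c ! (Suc t mod length c))"
proof -
  let ?E = "\<lambda>x y. x \<le> k \<and> y \<le> k \<and> x \<noteq> y \<and> T \<le> a x y"
  have "\<exists>i\<le>k. \<exists>j\<le>k. i \<noteq> j \<and> (Suc k)\<^sup>2 * T \<le> a i j"
  proof (rule ccontr)
    assume "\<not> ?thesis"
    then have less: "a i j < (Suc k)\<^sup>2 * T" if "i \<le> k" "j \<le> k" "i \<noteq> j" for i j
      using that by (meson not_less)
    \<comment> \<open>With the threshold written as \<open>Suc m\<close>, every entry is at most
      \<open>m\<close>, and at most \<open>(Suc k)\<^sup>2\<close> of them cannot sum up to
      \<open>(Suc k)\<^sup>2 * Suc m\<close>.\<close>
    define m where "m = (Suc k)\<^sup>2 * T - 1"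
    have m: "Suc m = (Suc k)\<^sup>2 * T"
      using T by (simp add: m_def)
    have "(\<Sum>i\<le>k. \<Sum>j\<in>{..k} - {i}. a i j) \<le> (\<Sum>i\<le>k. \<Sum>j\<in>{..k} - {i}. m)"
      using less[folded m] by (intro sum_mono) (auto simp: less_Suc_eq_le)
    also have "\<dots> \<le> (\<Sum>i\<le>k. \<Sum>j\<le>k. m)"
      by (intro sum_mono sum_mono2) auto
    also have "\<dots> = (Suc k)\<^sup>2 * m"
      by (simp add: power2_eq_square algebra_simps)
    also have "\<dots> < (Suc k)\<^sup>2 * Suc m"
      by simp
    finally show False
      using large by (simp only: m)
  qed
  then obtain i j where ij: "i \<le> k" "j \<le> k" "i \<noteq> j" "(Suc k)\<^sup>2 * T \<le> a i j"
    by blast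
  obtain xs where "rtrancl_path ?E j xs i"
    using reachable_of_balanced[OF bal ij(1,2,4) T] unfolding rtranclp_eq_rtrancl_path by blast
  \<comment> \<open>Cutting out repetitions makes the vertices distinct, as a cycle
    requires.\<close>
  then obtain xs where xs: "rtrancl_path ?E j xs i" "distinct (j # xs)"
    by (rule rtrancl_path_distinct)
  have ne: "xs \<noteq> []"
    using xs(1) ij(3) by (auto elim: rtrancl_path.cases)
  have last: "last xs = i"
    using xs(1) ne
  proof (induction rule: rtrancl_path.induct)
    case (step x y ys z)
    then show ?case
      by (cases ys) (auto elim: rtrancl_path.cases)
  qed simp
  let ?c = "j # xs"
  have edge: "?E (?c ! t) (?c ! Suc t)" if "t < length xs" for t
    using rtrancl_path_nth_edge[OF xs(1) that] by simp
  have "set xs \<subseteq> {..k}"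
    using edge by (fastforce simp: in_set_conv_nth)
  moreover have "T \<le> a (?c ! t) (?c ! (Suc t mod length ?c))" if "t < length ?c" for t
  proof (cases "t < length xs")
    case True
    then show ?thesis
      using edge[OF True] by simp
  next
    case False
    \<comment> \<open>The index wraps around at the last vertex \<open>i\<close>, whose successor is
      \<open>j\<close>: this is the entry the construction started from.\<close>
    then have "t = length xs"
      using that by simp
    moreover have "?c ! length xs = i"
      using last ne by (simp add: last_conv_nth nth_Cons')
    moreover have "T \<le> a i j"
      by (rule order.trans[OF _ ij(4)]) simp
    ultimately show ?thesis
      by simp
  qed
  moreover have "2 \<le> length ?c"
    using ne by (cases xs) auto
  ultimately show ?thesis
    using that[of ?c] xs(2) ij(2) by simp
qed

section \<open>Embedding an expansion class\<close>

definition monotone_set :: "bool \<Rightarrow> point set \<Rightarrow> bool" where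
  "monotone_set up R \<longleftrightarrow> (\<forall>x\<in>R. \<forall>y\<in>R. x <\<^sub>P y \<longrightarrow> (if up then x <\<^sub>V y else y <\<^sub>V x))"

lemma monotone_set_subset: "monotone_set up R \<Longrightarrow> S \<subseteq> R \<Longrightarrow> monotone_set up S"
  unfolding monotone_set_def by blast

text \<open>Ramsey for the graph of non-inversions: cliques are increasing and independent sets
  decreasing. What matters is that \<open>T\<close> depends on \<open>N\<close> alone.\<close>

lemma large_monotone_set:
  fixes N :: nat
  obtains T where "0 < T" "\<And>\<sigma> V. is_perm \<sigma> \<Longrightarrow> V \<subseteq> diagram \<sigma> \<Longrightarrow> T \<le> card V \<Longrightarrow>
    \<exists>R up. R \<subseteq> V \<and> card R = N \<and> monotone_set up R"
proof -
  obtain T where T: "T \<ge> 1" "\<And>(V :: point set) E. finite V \<Longrightarrow> card V \<ge> T \<Longrightarrow>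
      \<exists>R\<subseteq>V. card R = N \<and> clique R E \<or> card R = N \<and> indep R E"
    using ramsey2[where 'a = point, of N N] by blast
  have "\<exists>R up. R \<subseteq> V \<and> card R = N \<and> monotone_set up R"
    if \<sigma>: "is_perm \<sigma>" and V: "V \<subseteq> diagram \<sigma>" "T \<le> card V" for \<sigma> V
  proof -
    let ?E = "{{x, y} | x y. x <\<^sub>P y \<and> x <\<^sub>V y}"
    obtain R where R: "R \<subseteq> V" "card R = N" "clique R ?E \<or> indep R ?E"
      using T(2)[of V ?E] V finite_subset[OF V(1)] by auto
    \<comment> \<open>Edges are unordered pairs, but the position order orients each of them, so
      membership can be read off from the values.\<close>
    have pair: "{x, y} \<in> ?E \<longleftrightarrow> x <\<^sub>V y" if xy: "x <\<^sub>P y" for x y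
    proof
      assume "{x, y} \<in> ?E"
      then obtain x' y' where "{x, y} = {x', y'}" "x' <\<^sub>P y'" "x' <\<^sub>V y'"
        by blast
      then show "x <\<^sub>V y"
        using xy unfolding doubleton_eq_iff less_P_def by auto
    qed (use xy in blast)
    have "monotone_set True R" if "clique R ?E"
      unfolding monotone_set_def
    proof (intro ballI impI)
      fix x y assume xy: "x \<in> R" "y \<in> R" "x <\<^sub>P y"
      then have "{x, y} \<in> ?E"
        using that less_P_neq[of x y] unfolding clique_def by blast
      then have "x <\<^sub>V y"
        by (rule iffD1[OF pair[OF xy(3)]])
      then show "if True then x <\<^sub>V y else y <\<^sub>V x"
        by simp
    qed
    moreover have "monotone_set False R" if "indep R ?E"
      unfolding monotone_set_def
    proof (intro ballI impI)
      fix x y assume xy: "x \<in> R" "y \<in> R" "x <\<^sub>P y"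
      then have "{x, y} \<notin> ?E"
        using that less_P_neq[of x y] unfolding indep_def by blast
      then have "\<not> x <\<^sub>V y"
        by (rule contrapos_nn) (rule iffD2[OF pair[OF xy(3)]])
      moreover have "x \<noteq> y"
        using less_P_neq xy(3) by blast
      then have "snd x \<noteq> snd y"
        using diagram_eq_iff_snd[OF \<sigma>, of x y] xy(1,2) R(1) V(1) by blast
      ultimately show "if False then x <\<^sub>V y else y <\<^sub>V x"
        by (simp add: less_V_def)
    qed
    ultimately show ?thesis
      using R by blast
  qed
  then show ?thesis
    using that[of T] T(1) by auto
qed

lemma monotone_set_enumerate:
  assumes R: "finite R" "inj_on fst R" and up: "monotone_set up R"
  obtains h where "h ` {..<card R} \<subseteq> R"
    "\<forall>i<card R. \<forall>j<card R. h i <\<^sub>P h j \<longleftrightarrow> i < j"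
    "\<forall>i<card R. \<forall>j<card R. h i <\<^sub>V h j \<longleftrightarrow> (if up then i < j else j < i)"
proof -
  let ?n = "card R"
  obtain f where f: "bij_betw f {..<card (fst ` R)} (fst ` R)" "strict_mono_on {..<card (fst ` R)} f"
    using ex_bij_betw_strict_mono_card[of "fst ` R"] R(1) by auto
  have n: "card (fst ` R) = ?n"
    using R(2) by (rule card_image)
  define h where "h i = inv_into R fst (f i)" for i
  have h: "h i \<in> R" "fst (h i) = f i" if "i < ?n" for i
    using bij_betw_apply[OF f(1), of i] that
    by (auto simp: h_def n inv_into_into f_inv_into_f)
  have P: "h i <\<^sub>P h j \<longleftrightarrow> i < j" if "i < ?n" "j < ?n" for i j
    using strict_mono_on_less[OF f(2), of i j] h(2) that by (simp add: less_P_def n)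
  have V: "h i <\<^sub>V h j \<longleftrightarrow> (if up then i < j else j < i)" if ij: "i < ?n" "j < ?n" for i j
  proof (cases i j rule: linorder_cases)
    case less
    then have "if up then h i <\<^sub>V h j else h j <\<^sub>V h i"
      using up P[OF ij] h(1)[OF ij(1)] h(1)[OF ij(2)] unfolding monotone_set_def by blast
    then show ?thesis
      using less by (auto simp: less_V_def split: if_splits)
  next
    case greater
    then have "if up then h j <\<^sub>V h i else h i <\<^sub>V h j"
      using up P[OF ij(2,1)] h(1)[OF ij(1)] h(1)[OF ij(2)] unfolding monotone_set_def by blast
    then show ?thesis
      using greater by (auto simp: less_V_def split: if_splits)
  qed (simp add: less_V_def)
  show ?thesis
    by (rule that[of h]) (use h(1) P V in auto)
qed

section \<open>Points of an expansion outside the occurrence\<close>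

lemma expansion_outside:
  assumes exp: "is_expansion \<pi> c \<epsilon> s" and c: "distinct c" "set c \<subseteq> {..length \<pi>}"
    and x: "x \<in> diagram \<epsilon> - set s"
  obtains t where "t < length c" "row s x = c ! t" "col s x = c ! (Suc t mod length c)"
proof -
  have len: "length s = length \<pi>"
    using exp by (auto simp: is_expansion_def stable_occurrence_def occurrence_def)
  have "x \<in> cell \<epsilon> s (row s x) (col s x)"
    using x by (simp add: cell_alt)
  then have "cell_matrix \<epsilon> s (row s x) (col s x) \<noteq> 0"
    unfolding cell_matrix_def by (metis card_0_eq empty_iff finite_cell)
  then have "cycle_matrix c (row s x) (col s x) \<noteq> 0"
    using exp row_le[of s x] col_le[of s x] by (simp add: is_expansion_def len)
  then show ?thesis
    using that by (auto simp: cycle_matrix_def split: if_splits)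
qed

text \<open>As \<open>c\<close> is distinct, a row or a column determines the step of the cycle and
  hence the cell, and no cell holds more than one point.\<close>

lemma expansion_outside_unique:
  assumes exp: "is_expansion \<pi> c \<epsilon> s" and c: "distinct c" "set c \<subseteq> {..length \<pi>}"
    and x: "x \<in> diagram \<epsilon> - set s" and y: "y \<in> diagram \<epsilon> - set s"
    and eq: "row s x = row s y \<or> col s x = col s y"
  shows "x = y"
proof -
  obtain t where t: "t < length c" "row s x = c ! t" "col s x = c ! (Suc t mod length c)"
    by (rule expansion_outside[OF exp c x])
  obtain u where u: "u < length c" "row s y = c ! u" "col s y = c ! (Suc u mod length c)"
    by (rule expansion_outside[OF exp c y])
  have "t = u"
    using eq t u distinct_nth_Suc_mod_eq_iff[OF c(1) t(1) u(1)] nth_eq_iff_index_eq[OF c(1) t(1) u(1)] by auto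
  then have xy: "{x, y} \<subseteq> cell \<epsilon> s (row s x) (col s x)"
    using x y t u by (auto simp: cell_alt)
  have "length s = length \<pi>"
    using exp by (auto simp: is_expansion_def stable_occurrence_def occurrence_def)
  then have "cell_matrix \<epsilon> s (row s x) (col s x) \<le> 1"
    using exp row_le[of s x] col_le[of s x] cycle_matrix_le[of c "row s x" "col s x"]
    by (simp add: is_expansion_def)
  then have "card {x, y} \<le> 1"
    unfolding cell_matrix_def using card_mono[OF finite_cell xy] by linarith
  then show ?thesis
    by (cases "x = y") auto
qed

text \<open>The outside points are ordered from left to right like their columns, and these run
  through the entries of \<open>c\<close>. The block index of a point thus depends only on
  \<open>c\<close> and its column, so directions can be assigned before an expansion is
  chosen.\<close>

lemma expansion_outside_rank:
  assumes exp: "is_expansion \<pi> c \<epsilon> s" and c: "distinct c" "set c \<subseteq> {..length \<pi>}"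
    and x: "x \<in> diagram \<epsilon> - set s"
  shows "card ({..<fst x} - fst ` set s) = rank_in (set c) (col s x)"
proof -
  let ?L = "{y \<in> diagram \<epsilon> - set s. y <\<^sub>P x}"
  have sub: "set s \<subseteq> diagram \<epsilon>" and len: "length s = length \<pi>"
    using exp by (auto simp: is_expansion_def stable_occurrence_def occurrence_def)
  have "fst ` ?L = {..<fst x} - fst ` set s"
  proof
    show "fst ` ?L \<subseteq> {..<fst x} - fst ` set s"
      using sub diagram_eq_iff_fst[of _ \<epsilon>] by (fastforce simp: less_P_def)
    show "{..<fst x} - fst ` set s \<subseteq> fst ` ?L"
    proof
      fix p assume p: "p \<in> {..<fst x} - fst ` set s"
      then have "(p, \<epsilon> ! p) \<in> ?L"
        using x by (force simp: mem_diagram_iff less_P_def)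
      then show "p \<in> fst ` ?L"
        by force
    qed
  qed
  moreover have "card (fst ` ?L) = card ?L"
    by (rule card_image, rule inj_on_subset[OF inj_on_fst_diagram[of \<epsilon>]]) auto
  ultimately have "card ({..<fst x} - fst ` set s) = card ?L"
    by (simp only:)
  also have "\<dots> = card (col s ` ?L)"
    using expansion_outside_unique[OF exp c] by (intro card_image[symmetric]) (auto simp: inj_on_def)
  also have "col s ` ?L = {z \<in> set c. z < col s x}"
  proof
    show "col s ` ?L \<subseteq> {z \<in> set c. z < col s x}"
    proof
      fix z assume "z \<in> col s ` ?L"
      then obtain y where y: "y \<in> diagram \<epsilon> - set s" "y <\<^sub>P x" "z = col s y"
        by auto
      obtain t where "t < length c" "col s y = c ! (Suc t mod length c)"
        by (rule expansion_outside[OF exp c y(1)])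
      then have "z \<in> set c"
        using y(3) set_nth_Suc_mod[of c] by blast
      moreover have "col s y \<noteq> col s x"
        using expansion_outside_unique[OF exp c y(1) x] less_P_neq[OF y(2)] by auto
      moreover have "\<not> col s x < col s y"
        using less_P_of_col_less[of s x y] y(2) by (auto simp: less_P_def)
      ultimately show "z \<in> {z \<in> set c. z < col s x}"
        using y(3) by simp
    qed
    \<comment> \<open>Conversely, each entry of \<open>c\<close> is the column of some 1 of the
      cycle matrix and therefore contains a point.\<close>
    show "{z \<in> set c. z < col s x} \<subseteq> col s ` ?L"
    proof
      fix z assume z: "z \<in> {z \<in> set c. z < col s x}"
      then obtain t where t: "t < length c" "z = c ! (Suc t mod length c)"
        using set_nth_Suc_mod[of c] by blast
      have "cycle_matrix c (c ! t) z = 1"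
        using t by (auto simp: cycle_matrix_def)
      moreover have "c ! t \<le> length \<pi>" "z \<le> length \<pi>"
        using c(2) z nth_mem[OF t(1)] by auto
      ultimately have "cell_matrix \<epsilon> s (c ! t) z = 1"
        using exp by (simp add: is_expansion_def)
      then obtain y where "y \<in> cell \<epsilon> s (c ! t) z"
        unfolding cell_matrix_def by (metis card_1_singletonE insertI1)
      then have y: "y \<in> diagram \<epsilon> - set s" "col s y = z"
        by (auto simp: cell_alt)
      then have "y <\<^sub>P x"
        using z less_P_of_col_less[of s y x] by simp
      then show "z \<in> col s ` ?L"
        using y by auto
    qed
  qed
  finally show ?thesis
    by (simp add: rank_in_def)
qed

text \<open>It suffices to place each block inside the corresponding cell of \<sigma>. Two blocks
  share neither row nor column, so comparisons between blocks, and of blocks with \<open>s\<close>,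
  are decided by coordinates; only those inside one block depend on the choice of points.\<close>

lemma pattern_inflate_outside:
  assumes pi: "is_perm \<pi>" and c: "distinct c" "set c \<subseteq> {..length \<pi>}"
    and exp: "is_expansion \<pi> c \<epsilon> s" and \<Theta>: "\<And>t. t < length c \<Longrightarrow> is_perm (\<Theta> ! t)"
    and perm: "is_perm \<sigma>" and occ': "occurrence \<pi> \<sigma> s'"
    and H: "\<And>x. x \<in> diagram \<epsilon> - set s \<Longrightarrow> \<exists>h. \<forall>i<length (\<Theta> ! rank_in (set c) (col s x)).
      h i \<in> cell \<sigma> s' (row s x) (col s x) \<and>
      (\<forall>j<length (\<Theta> ! rank_in (set c) (col s x)). (h i <\<^sub>P h j \<longleftrightarrow> i < j) \<and>
        (h i <\<^sub>V h j \<longleftrightarrow> \<Theta> ! rank_in (set c) (col s x) ! i < \<Theta> ! rank_in (set c) (col s x) ! j))"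
    and \<tau>: "is_pattern \<tau> (inflate_outside \<epsilon> s \<Theta>)"
  shows "is_pattern \<tau> \<sigma>"
proof -
  have \<epsilon>: "is_perm \<epsilon>" "length \<epsilon> = length \<pi> + length c" and occ: "occurrence \<pi> \<epsilon> s"
    using exp by (auto simp: is_expansion_def stable_occurrence_def)
  have sub: "set s \<subseteq> diagram \<epsilon>" and len: "length s = length \<pi>" and len': "length s' = length \<pi>"
    using occ occ' by (auto simp: occurrence_def)
  define \<alpha>s where "\<alpha>s = outside_blocks \<epsilon> s \<Theta>"
  define pt where "pt q = (q, \<epsilon> ! q)" for q
  have pt: "pt q \<in> diagram \<epsilon>" if "q < length \<epsilon>" for q
    using that by (simp add: pt_def mem_diagram_iff)
  have F: "q \<in> fst ` set s \<longleftrightarrow> pt q \<in> set s" if "q < length \<epsilon>" for q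
    using sub by (force simp: pt_def mem_diagram_iff)
  have \<alpha>_in: "\<alpha>s ! q = [0]" if "q < length \<epsilon>" "pt q \<in> set s" for q
    using outside_blocks_nth(1)[OF that(1)] that F by (simp add: \<alpha>s_def)
  have \<alpha>_out: "\<alpha>s ! q = \<Theta> ! rank_in (set c) (col s (pt q))" if "q < length \<epsilon>" "pt q \<notin> set s" for q
    using outside_blocks_nth(2)[OF that(1)] that F expansion_outside_rank[OF exp c, of "pt q"] pt[OF that(1)]
    by (simp add: \<alpha>s_def pt_def)
  have \<alpha>_perm: "is_perm (\<alpha>s ! q)" if q: "q < length \<epsilon>" for q
  proof (cases "pt q \<in> set s")
    case True
    then show ?thesis
      using \<alpha>_in[OF q] by (simp add: is_perm_alt lessThan_Suc)
  next
    case False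
    then have "q \<notin> fst ` set s"
      using F[OF q] by simp
    then show ?thesis
      using outside_blocks_nth(2)[OF q] card_outside_less[OF occ \<epsilon>(2) q] \<Theta> by (simp add: \<alpha>s_def)
  qed
  have "\<forall>x\<in>diagram \<epsilon> - set s. \<exists>h. \<forall>i<length (\<Theta> ! rank_in (set c) (col s x)).
      h i \<in> cell \<sigma> s' (row s x) (col s x) \<and>
      (\<forall>j<length (\<Theta> ! rank_in (set c) (col s x)). (h i <\<^sub>P h j \<longleftrightarrow> i < j) \<and>
        (h i <\<^sub>V h j \<longleftrightarrow> \<Theta> ! rank_in (set c) (col s x) ! i < \<Theta> ! rank_in (set c) (col s x) ! j))"
    using H by blast
  from bchoice[OF this] obtain h where h: "\<forall>x\<in>diagram \<epsilon> - set s. \<forall>i<length (\<Theta> ! rank_in (set c) (col s x)).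
      h x i \<in> cell \<sigma> s' (row s x) (col s x) \<and>
      (\<forall>j<length (\<Theta> ! rank_in (set c) (col s x)). (h x i <\<^sub>P h x j \<longleftrightarrow> i < j) \<and>
        (h x i <\<^sub>V h x j \<longleftrightarrow> \<Theta> ! rank_in (set c) (col s x) ! i < \<Theta> ! rank_in (set c) (col s x) ! j))"
    by blast
  have "\<exists>a. a < length \<pi> \<and> s ! a = x" if "x \<in> set s" for x
    using that len by (auto simp: in_set_conv_nth)
  then obtain idx where idx: "\<And>x. x \<in> set s \<Longrightarrow> idx x < length \<pi> \<and> s ! idx x = x"
    by metis
  \<comment> \<open>The embedding: elements of \<open>s\<close> go to the elements of
    \<open>s'\<close> with the same index, the \<open>i\<close>-th point of a block to the
    \<open>i\<close>-th point chosen in its cell.\<close>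
  define M where "M q i = (if pt q \<in> set s then s' ! idx (pt q) else h (pt q) i)" for q i
  have M_in: "M q i = s' ! idx (pt q)" if "pt q \<in> set s" for q i
    using that by (simp add: M_def)
  have M_out: "M q i = h (pt q) i" "M q i \<in> cell \<sigma> s' (row s (pt q)) (col s (pt q))"
    if "q < length \<epsilon>" "pt q \<notin> set s" "i < length (\<alpha>s ! q)" for q i
    using that h pt[OF that(1)] \<alpha>_out[OF that(1,2)] by (auto simp: M_def)
  have M_out': "row s' (M q i) = row s (pt q)" "col s' (M q i) = col s (pt q)" "M q i \<notin> set s'"
    "M q i \<in> diagram \<sigma>"
    if "q < length \<epsilon>" "pt q \<notin> set s" "i < length (\<alpha>s ! q)" for q i
    using M_out(2)[OF that] by (auto simp: cell_alt)
  have M_mem: "M q i \<in> diagram \<sigma>" if "q < length \<epsilon>" "i < length (\<alpha>s ! q)" for q i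
    using M_out'(4)[OF that(1) _ that(2)] M_in[of q i] idx[of "pt q"] occurrence_nth_mem[OF occ']
    by (cases "pt q \<in> set s") auto
  have M_P: "M q i <\<^sub>P M q' i'"
    if q: "q < length \<epsilon>" "q' < length \<epsilon>" "q < q'" "i < length (\<alpha>s ! q)" "i' < length (\<alpha>s ! q')" for q q' i i'
  proof -
    have less: "pt q <\<^sub>P pt q'"
      using q(3) by (simp add: pt_def less_P_def)
    show ?thesis
    proof (cases "pt q \<in> set s"; cases "pt q' \<in> set s")
      assume ss: "pt q \<in> set s" "pt q' \<in> set s"
      then show ?thesis
        using less idx[OF ss(1)] idx[OF ss(2)] occurrence_nth_P[OF occ, of "idx (pt q)" "idx (pt q')"]
          occurrence_nth_P[OF occ', of "idx (pt q)" "idx (pt q')"] by (simp add: M_in)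
    next
      assume ss: "pt q \<in> set s" "pt q' \<notin> set s"
      then show ?thesis
        using less idx[OF ss(1)] nth_less_P_iff[OF occ, of "idx (pt q)" "pt q'"]
          nth_less_P_iff[OF occ', of "idx (pt q)" "M q' i'"] M_out'(2)[OF q(2) ss(2) q(5)] by (simp add: M_in)
    next
      assume ss: "pt q \<notin> set s" "pt q' \<in> set s"
      \<comment> \<open>Coordinates only tell which elements of \<open>s\<close> are to the left of
        a point. For the reverse comparison this is negated and equality is excluded
        separately.\<close>
      have "\<not> idx (pt q') < col s (pt q)"
        using less idx[OF ss(2)] nth_less_P_iff[OF occ, of "idx (pt q')" "pt q"] by (auto simp: less_P_def)
      then have "\<not> M q' i' <\<^sub>P M q i"
        using idx[OF ss(2)] nth_less_P_iff[OF occ', of "idx (pt q')" "M q i"] M_out'(2)[OF q(1) ss(1) q(4)] ss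
        by (simp add: M_in)
      moreover have "M q i \<noteq> M q' i'"
        using M_out'(3)[OF q(1) ss(1) q(4)] M_in[OF ss(2)] idx[OF ss(2)] len' by (metis nth_mem)
      ultimately show ?thesis
        using diagram_eq_iff_fst[OF M_mem[OF q(1,4)] M_mem[OF q(2,5)]] by (auto simp: less_P_def)
    next
      assume ss: "pt q \<notin> set s" "pt q' \<notin> set s"
      have "col s (pt q) \<noteq> col s (pt q')"
        using expansion_outside_unique[OF exp c, of "pt q" "pt q'"] pt q ss less_P_neq[OF less] by blast
      moreover have "\<not> col s (pt q') < col s (pt q)"
        using less_P_of_col_less[of s "pt q'" "pt q"] less by (auto simp: less_P_def)
      ultimately have "col s' (M q i) < col s' (M q' i')"
        using M_out'(2)[OF q(1) ss(1) q(4)] M_out'(2)[OF q(2) ss(2) q(5)] by simp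
      then show ?thesis
        by (rule less_P_of_col_less)
    qed
  qed
  have M_V: "M q i <\<^sub>V M q' i'" 
    if q: "q < length \<epsilon>" "q' < length \<epsilon>" "\<epsilon> ! q < \<epsilon> ! q'" "i < length (\<alpha>s ! q)" "i' < length (\<alpha>s ! q')" for q q' i i'
  proof -
    have less: "pt q <\<^sub>V pt q'" and neq: "pt q \<noteq> pt q'"
      using q(3) by (auto simp: pt_def less_V_def)
    show ?thesis
    proof (cases "pt q \<in> set s"; cases "pt q' \<in> set s")
      assume ss: "pt q \<in> set s" "pt q' \<in> set s"
      then show ?thesis
        using less idx[OF ss(1)] idx[OF ss(2)] occurrence_nth_V[OF occ, of "idx (pt q)" "idx (pt q')"]
          occurrence_nth_V[OF occ', of "idx (pt q)" "idx (pt q')"] by (simp add: M_in)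
    next
      assume ss: "pt q \<in> set s" "pt q' \<notin> set s"
      then show ?thesis
        using less idx[OF ss(1)] nth_less_V_iff[OF pi occ, of "idx (pt q)" "pt q'"]
          nth_less_V_iff[OF pi occ', of "idx (pt q)" "M q' i'"] M_out'(1)[OF q(2) ss(2) q(5)] by (simp add: M_in)
    next
      assume ss: "pt q \<notin> set s" "pt q' \<in> set s"
      have "\<not> \<pi> ! idx (pt q') < row s (pt q)"
        using less idx[OF ss(2)] nth_less_V_iff[OF pi occ, of "idx (pt q')" "pt q"] by (auto simp: less_V_def)
      then have "\<not> M q' i' <\<^sub>V M q i"
        using idx[OF ss(2)] nth_less_V_iff[OF pi occ', of "idx (pt q')" "M q i"] M_out'(1)[OF q(1) ss(1) q(4)] ss
        by (simp add: M_in)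
      moreover have "M q i \<noteq> M q' i'"
        using M_out'(3)[OF q(1) ss(1) q(4)] M_in[OF ss(2)] idx[OF ss(2)] len' by (metis nth_mem)
      ultimately show ?thesis
        using diagram_eq_iff_snd[OF perm M_mem[OF q(1,4)] M_mem[OF q(2,5)]] by (auto simp: less_V_def)
    next
      assume ss: "pt q \<notin> set s" "pt q' \<notin> set s"
      have "row s (pt q) \<noteq> row s (pt q')"
        using expansion_outside_unique[OF exp c, of "pt q" "pt q'"] pt q ss neq by blast
      moreover have "\<not> row s (pt q') < row s (pt q)"
        using less_V_of_row_less[of s "pt q'" "pt q"] less by (auto simp: less_V_def)
      ultimately have "row s' (M q i) < row s' (M q' i')"
        using M_out'(1)[OF q(1) ss(1) q(4)] M_out'(1)[OF q(2) ss(2) q(5)] by simp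
      then show ?thesis
        by (rule less_V_of_row_less)
    qed
  qed
  have M_same: "(M q i <\<^sub>P M q j \<longleftrightarrow> i < j) \<and> (M q i <\<^sub>V M q j \<longleftrightarrow> \<alpha>s ! q ! i < \<alpha>s ! q ! j)"
    if q: "q < length \<epsilon>" "i < length (\<alpha>s ! q)" "j < length (\<alpha>s ! q)" for q i j
  proof (cases "pt q \<in> set s")
    case True
    then show ?thesis
      using q \<alpha>_in[OF q(1) True] by (simp add: less_P_def less_V_def)
  next
    case False
    have "pt q \<in> diagram \<epsilon> - set s"
      using pt[OF q(1)] False by simp
    then show ?thesis
      using h q \<alpha>_out[OF q(1) False] by (simp add: M_out(1)[OF q(1) False])
  qed
  obtain u where u: "occurrence \<tau> (inflate \<epsilon> \<alpha>s) u"
    using \<tau> by (auto simp: is_pattern_def inflate_outside_alt \<alpha>s_def)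
  then have "\<forall>x\<in>set u. \<exists>qi. fst qi < length \<epsilon> \<and> snd qi < length (\<alpha>s ! fst qi) \<and>
      x = block_point \<epsilon> \<alpha>s (fst qi) (snd qi)"
    using diagram_inflate by (fastforce simp: occurrence_def)
  from bchoice[OF this] obtain B where B: "\<And>x. x \<in> set u \<Longrightarrow> fst (B x) < length \<epsilon>"
    "\<And>x. x \<in> set u \<Longrightarrow> snd (B x) < length (\<alpha>s ! fst (B x))"
    "\<And>x. x \<in> set u \<Longrightarrow> x = block_point \<epsilon> \<alpha>s (fst (B x)) (snd (B x))"
    by blast
  have "occurrence \<tau> \<sigma> (map (\<lambda>x. M (fst (B x)) (snd (B x))) u)"
  proof (rule occurrence_map[OF u])
    fix x assume x: "x \<in> set u"
    show "M (fst (B x)) (snd (B x)) \<in> diagram \<sigma>"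
      by (rule M_mem[OF B(1,2)[OF x]])
    fix y assume y: "y \<in> set u"
    obtain q i where qi: "B x = (q, i)"
      by (cases "B x")
    obtain r j where rj: "B y = (r, j)"
      by (cases "B y")
    have q: "q < length \<epsilon>" "i < length (\<alpha>s ! q)" "x = block_point \<epsilon> \<alpha>s q i"
      using B[OF x] by (simp_all add: qi)
    have r: "r < length \<epsilon>" "j < length (\<alpha>s ! r)" "y = block_point \<epsilon> \<alpha>s r j"
      using B[OF y] by (simp_all add: rj)
    have "x <\<^sub>P y \<longleftrightarrow> q < r \<or> q = r \<and> i < j"
      unfolding q(3) r(3) by (rule block_point_less_P[OF q(2) r(2)])
    also have "\<dots> \<longleftrightarrow> M q i <\<^sub>P M r j"
    proof (cases q r rule: linorder_cases)
      case less
      then show ?thesis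
        using M_P[OF q(1) r(1) less q(2) r(2)] by simp
    next
      case equal
      then show ?thesis
        using M_same[OF q(1,2), of j] r(2) by simp
    next
      case greater
      then show ?thesis
        using M_P[OF r(1) q(1) greater r(2) q(2)] by (auto simp: less_P_def)
    qed
    finally show "x <\<^sub>P y \<longleftrightarrow> M (fst (B x)) (snd (B x)) <\<^sub>P M (fst (B y)) (snd (B y))"
      by (simp add: qi rj)
    have "x <\<^sub>V y \<longleftrightarrow> \<epsilon> ! q < \<epsilon> ! r \<or> q = r \<and> \<alpha>s ! q ! i < \<alpha>s ! r ! j"
      unfolding q(3) r(3)
      by (rule block_point_less_V[OF \<epsilon>(1) q(1) r(1) \<alpha>_perm[OF q(1)] \<alpha>_perm[OF r(1)] q(2) r(2)])
    also have "\<dots> \<longleftrightarrow> M q i <\<^sub>V M r j"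
    proof (cases "\<epsilon> ! q" "\<epsilon> ! r" rule: linorder_cases)
      case less
      then show ?thesis
        using M_V[OF q(1) r(1) less q(2) r(2)] by simp
    next
      case equal
      then have "q = r"
        using is_perm_nth_eq_iff[OF \<epsilon>(1) q(1) r(1)] by simp
      then show ?thesis
        using M_same[OF q(1,2), of j] r(2) by simp
    next
      case greater
      then show ?thesis
        using M_V[OF r(1) q(1) greater r(2) q(2)] by (auto simp: less_V_def)
    qed
    finally show "x <\<^sub>V y \<longleftrightarrow> M (fst (B x)) (snd (B x)) <\<^sub>V M (fst (B y)) (snd (B y))"
      by (simp add: qi rj)
  qed
  then show ?thesis
    by (auto simp: is_pattern_def)
qed

section \<open>Unbounded cells yield an expansion class\<close>

text \<open>The directions are given by the set \<open>Y\<close> of columns with an increasing set.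
  Each step of a distinct cycle has its own column, and there are only finitely many choices of
  \<open>Y\<close>.\<close>

definition large_cells :: "nat list \<Rightarrow> nat list set \<Rightarrow> nat \<Rightarrow> nat list \<Rightarrow> nat set \<Rightarrow> bool" where
  "large_cells \<pi> C N c Y \<longleftrightarrow> (\<exists>\<sigma>\<in>C. \<exists>s. stable_occurrence \<pi> \<sigma> s \<and>
     (\<forall>t<length c. \<exists>R\<subseteq>cell \<sigma> s (c ! t) (c ! (Suc t mod length c)).
        card R = N \<and> monotone_set (c ! (Suc t mod length c) \<in> Y) R))"

text \<open>Lets a single size at which a pair \<open>c\<close>, \<open>Y\<close> fails exclude all
  larger sizes.\<close>

lemma large_cells_mono:
  assumes "large_cells \<pi> C N c Y" "n \<le> N"
  shows "large_cells \<pi> C n c Y"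
proof -
  obtain \<sigma> s where \<sigma>: "\<sigma> \<in> C" "stable_occurrence \<pi> \<sigma> s"
    and R: "\<And>t. t < length c \<Longrightarrow> \<exists>R\<subseteq>cell \<sigma> s (c ! t) (c ! (Suc t mod length c)).
        card R = N \<and> monotone_set (c ! (Suc t mod length c) \<in> Y) R"
    using assms(1) unfolding large_cells_def by blast
  have "\<exists>R\<subseteq>cell \<sigma> s (c ! t) (c ! (Suc t mod length c)).
        card R = n \<and> monotone_set (c ! (Suc t mod length c) \<in> Y) R" if t: "t < length c" for t
  proof -
    obtain R where R: "R \<subseteq> cell \<sigma> s (c ! t) (c ! (Suc t mod length c))" "card R = N"
      "monotone_set (c ! (Suc t mod length c) \<in> Y) R"
      using R[OF t] by blast
    obtain S where S: "S \<subseteq> R" "card S = n"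
      using obtain_subset_with_card_n[of n R] assms(2) R(2) by blast
    then show ?thesis
      using R(1) monotone_set_subset[OF R(3) S(1)] by blast
  qed
  then show ?thesis
    unfolding large_cells_def using \<sigma> by blast
qed

lemma ex_large_cells:
  assumes C: "perm_class C" and unbdd: "\<not> off_diagonal_bounded \<pi> C"
  obtains c Y where "distinct c" "set c \<subseteq> {..length \<pi>}" "2 \<le> length c" "Y \<subseteq> {..length \<pi>}"
    "large_cells \<pi> C N c Y"
proof -
  let ?k = "length \<pi>"
  obtain T where T: "0 < T" "\<And>\<sigma> V. is_perm \<sigma> \<Longrightarrow> V \<subseteq> diagram \<sigma> \<Longrightarrow> T \<le> card V \<Longrightarrow>
      \<exists>R up. R \<subseteq> V \<and> card R = N \<and> monotone_set up R"
    using large_monotone_set[of N] by blast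
  \<comment> \<open>The threshold of \<open>cycle_of_balanced\<close>, with the Ramsey bound as the
    required size of the cells.\<close>
  let ?M = "(Suc ?k)\<^sup>2 * ((Suc ?k)\<^sup>2 * T)"
  have "0 < ?M"
    using T(1) by simp
  then obtain \<sigma> s where \<sigma>: "\<sigma> \<in> C" "stable_occurrence \<pi> \<sigma> s"
    and large: "?M \<le> (\<Sum>i\<le>?k. \<Sum>j\<in>{..?k} - {i}. cell_matrix \<sigma> s i j)"
    using unbdd unfolding off_diagonal_bounded_def by (meson nat_le_linear)
  have perm: "is_perm \<sigma>"
    using C \<sigma>(1) by (auto simp: perm_class_def)
  obtain c where c: "distinct c" "set c \<subseteq> {..?k}" "2 \<le> length c"
    and cells: "\<And>t. t < length c \<Longrightarrow> T \<le> cell_matrix \<sigma> s (c ! t) (c ! (Suc t mod length c))"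
    using cycle_of_balanced[OF row_sum_eq_col_sum[OF perm \<sigma>(2)] large T(1)] by blast
  have "\<forall>t\<in>{..<length c}. \<exists>up. \<exists>R\<subseteq>cell \<sigma> s (c ! t) (c ! (Suc t mod length c)).
      card R = N \<and> monotone_set up R"
  proof
    fix t assume "t \<in> {..<length c}"
    then have "T \<le> card (cell \<sigma> s (c ! t) (c ! (Suc t mod length c)))"
      using cells by (simp add: cell_matrix_def)
    moreover have "cell \<sigma> s (c ! t) (c ! (Suc t mod length c)) \<subseteq> diagram \<sigma>"
      by (auto simp: cell_def)
    ultimately show "\<exists>up. \<exists>R\<subseteq>cell \<sigma> s (c ! t) (c ! (Suc t mod length c)). card R = N \<and> monotone_set up R"
      using T(2)[OF perm] by blast
  qed
  from bchoice[OF this] obtain up where up: "\<And>t. t < length c \<Longrightarrow>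
      \<exists>R\<subseteq>cell \<sigma> s (c ! t) (c ! (Suc t mod length c)). card R = N \<and> monotone_set (up t) R"
    by blast
  \<comment> \<open>Different steps lead to different columns, so no two steps impose conflicting
    directions on a column.\<close>
  define Y where "Y = (\<lambda>t. c ! (Suc t mod length c)) ` {t. t < length c \<and> up t}"
  have "c ! (Suc t mod length c) \<in> Y \<longleftrightarrow> up t" if "t < length c" for t
    using distinct_nth_Suc_mod_eq_iff[OF c(1) that] that by (auto simp: Y_def)
  then have "large_cells \<pi> C N c Y"
    unfolding large_cells_def using \<sigma> up by auto
  moreover have "Y \<subseteq> {..?k}"
    using c(2) set_nth_Suc_mod[of c] by (auto simp: Y_def)
  ultimately show ?thesis
    using that c by blast
qed

text \<open>Otherwise each of the finitely many pairs fails at some size. The sum of these sizes is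
  at least each of them, so no pair would be available at that size.\<close>

lemma ex_uniform_large_cells:
  assumes C: "perm_class C" and unbdd: "\<not> off_diagonal_bounded \<pi> C"
  obtains c Y where "distinct c" "set c \<subseteq> {..length \<pi>}" "2 \<le> length c"
    "\<And>N. large_cells \<pi> C N c Y"
proof (rule ccontr)
  assume "\<not> thesis"
  let ?K = "{c. set c \<subseteq> {..length \<pi>} \<and> distinct c} \<times> Pow {..length \<pi>}"
  have fin: "finite ?K"
    by (intro finite_cartesian_product finite_subset_distinct) auto
  have "\<forall>p\<in>{p \<in> ?K. 2 \<le> length (fst p)}. \<exists>N. \<not> large_cells \<pi> C N (fst p) (snd p)"
    using that \<open>\<not> thesis\<close> by fastforce
  from bchoice[OF this] obtain f where f: "\<And>p. p \<in> ?K \<Longrightarrow> 2 \<le> length (fst p) \<Longrightarrow>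
      \<not> large_cells \<pi> C (f p) (fst p) (snd p)"
    by blast
  obtain c Y where c: "distinct c" "set c \<subseteq> {..length \<pi>}" "2 \<le> length c" "Y \<subseteq> {..length \<pi>}"
    "large_cells \<pi> C (sum f ?K) c Y"
    by (rule ex_large_cells[OF C unbdd])
  have K: "(c, Y) \<in> ?K"
    using c by simp
  have "f (c, Y) \<le> sum f ?K"
    by (rule member_le_sum[OF K _ fin]) simp
  then show False
    using large_cells_mono[OF c(5)] f[OF K] c(3) by simp
qed

lemma no_expansion_class_imp_off_diagonal_bounded:
  assumes pi: "is_perm \<pi>" and C: "perm_class C" and none: "contains_no_expansion_class \<pi> C"
  shows "off_diagonal_bounded \<pi> C"
proof (rule ccontr)
  assume unbdd: "\<not> off_diagonal_bounded \<pi> C"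
  obtain c Y where c: "distinct c" "set c \<subseteq> {..length \<pi>}" "2 \<le> length c"
    and large: "\<And>N. large_cells \<pi> C N c Y"
    using ex_uniform_large_cells[OF C unbdd] by blast
  define type where "type z = (if z \<in> Y then increasing_perms else decreasing_perms)" for z
  \<comment> \<open>Ordered from left to right like the blocks: the entry at \<open>i\<close>
    belongs to the element of \<open>c\<close> of rank \<open>i\<close>, read as a column.\<close>
  define Xs where "Xs = map (\<lambda>i. type (inv_into (set c) (rank_in (set c)) i)) [0..<length c]"
  have rank: "rank_in (set c) z < length c" "Xs ! rank_in (set c) z = type z" if "z \<in> set c" for z
  proof -
    have bij: "bij_betw (rank_in (set c)) (set c) {..<length c}"
      using rank_in_bij[of "set c"] c(1) by (simp add: distinct_card)
    then show "rank_in (set c) z < length c"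
      using that by (auto simp: bij_betw_def)
    then show "Xs ! rank_in (set c) z = type z"
      using inv_into_f_f[OF bij_betw_imp_inj_on[OF bij] that] by (simp add: Xs_def)
  qed
  have Xs: "length Xs = length c" "set Xs \<subseteq> {increasing_perms, decreasing_perms}"
    by (auto simp: Xs_def type_def)
  have "expansion_class \<pi> c Xs \<subseteq> C"
  proof
    fix \<tau> assume "\<tau> \<in> expansion_class \<pi> c Xs"
    then obtain \<epsilon> s \<Theta> where \<tau>: "is_perm \<tau>" "is_pattern \<tau> (inflate_outside \<epsilon> s \<Theta>)"
      and exp: "is_expansion \<pi> c \<epsilon> s" and \<Theta>: "\<And>t. t < length c \<Longrightarrow> \<Theta> ! t \<in> Xs ! t"
      unfolding expansion_class_def by blast
    \<comment> \<open>The block lengths vary over the expansion class, but their sum bounds all of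
      them, and the same \<open>c\<close> and \<open>Y\<close> are available for every size.\<close>
    define N where "N = (\<Sum>t<length c. length (\<Theta> ! t))"
    obtain \<sigma> s' where \<sigma>: "\<sigma> \<in> C" "stable_occurrence \<pi> \<sigma> s'"
      and R: "\<And>t. t < length c \<Longrightarrow> \<exists>R\<subseteq>cell \<sigma> s' (c ! t) (c ! (Suc t mod length c)).
        card R = N \<and> monotone_set (c ! (Suc t mod length c) \<in> Y) R"
      using large[of N] unfolding large_cells_def by blast
    have perm: "is_perm \<sigma>" and occ': "occurrence \<pi> \<sigma> s'"
      using C \<sigma> by (auto simp: perm_class_def stable_occurrence_def)
    have \<Theta>_perm: "is_perm (\<Theta> ! t)" if "t < length c" for t
    proof -
      have "Xs ! t \<in> {increasing_perms, decreasing_perms}"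
        using Xs(1) subsetD[OF Xs(2) nth_mem] that by simp
      then show ?thesis
        using \<Theta>[OF that] by (auto simp: increasing_perms_def decreasing_perms_def)
    qed
    have "is_pattern \<tau> \<sigma>"
    proof (rule pattern_inflate_outside[OF pi c(1,2) exp \<Theta>_perm perm occ' _ \<tau>(2)])
      fix x assume x: "x \<in> diagram \<epsilon> - set s"
      obtain t where t: "t < length c" "row s x = c ! t" "col s x = c ! (Suc t mod length c)"
        by (rule expansion_outside[OF exp c(1,2) x])
      obtain R where R: "R \<subseteq> cell \<sigma> s' (row s x) (col s x)" "card R = N"
        "monotone_set (col s x \<in> Y) R"
        using R[OF t(1)] t by auto
      have "R \<subseteq> diagram \<sigma>"
        using R(1) by (auto simp: cell_def)
      then have "finite R" "inj_on fst R"
        using finite_subset[OF _ finite_diagram] inj_on_subset[OF inj_on_fst_diagram] by blast+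
      then obtain h where h: "h ` {..<N} \<subseteq> R" "\<forall>i<N. \<forall>j<N. h i <\<^sub>P h j \<longleftrightarrow> i < j"
        "\<forall>i<N. \<forall>j<N. h i <\<^sub>V h j \<longleftrightarrow> (if col s x \<in> Y then i < j else j < i)"
        using monotone_set_enumerate[OF _ _ R(3)] unfolding R(2) by blast
      have "col s x \<in> set c"
        using t set_nth_Suc_mod[of c] by auto
      note rank = rank[OF this]
      let ?\<theta> = "\<Theta> ! rank_in (set c) (col s x)"
      have "?\<theta> \<in> type (col s x)"
        using \<Theta>[OF rank(1)] rank(2) by simp
      then have "if col s x \<in> Y then sorted_wrt (<) ?\<theta> else sorted_wrt (>) ?\<theta>"
        by (auto simp: type_def increasing_perms_def decreasing_perms_def)
      then have mono: "if col s x \<in> Y then ?\<theta> ! i < ?\<theta> ! j else ?\<theta> ! j < ?\<theta> ! i"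
        if "i < j" "j < length ?\<theta>" for i j
        using that by (simp add: sorted_wrt_iff_nth_less split: if_splits)
      have \<theta>: "?\<theta> ! i < ?\<theta> ! j \<longleftrightarrow> (if col s x \<in> Y then i < j else j < i)"
        if "i < length ?\<theta>" "j < length ?\<theta>" for i j
        using mono[of i j] mono[of j i] that
        by (cases i j rule: linorder_cases) (simp_all split: if_splits)
      have le: "length ?\<theta> \<le> N"
        unfolding N_def using rank(1) by (intro member_le_sum[of _ _ "\<lambda>t. length (\<Theta> ! t)"]) auto
      show "\<exists>h. \<forall>i<length ?\<theta>. h i \<in> cell \<sigma> s' (row s x) (col s x) \<and>
          (\<forall>j<length ?\<theta>. (h i <\<^sub>P h j \<longleftrightarrow> i < j) \<and> (h i <\<^sub>V h j \<longleftrightarrow> ?\<theta> ! i < ?\<theta> ! j))"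
      proof (intro exI[of _ h] allI impI conjI)
        fix i assume i: "i < length ?\<theta>"
        then have i': "i < N"
          using le by simp
        then show "h i \<in> cell \<sigma> s' (row s x) (col s x)"
          using h(1) R(1) by blast
        fix j assume j: "j < length ?\<theta>"
        then have j': "j < N"
          using le by simp
        show "h i <\<^sub>P h j \<longleftrightarrow> i < j"
          using h(2) i' j' by blast
        have "h i <\<^sub>V h j \<longleftrightarrow> (if col s x \<in> Y then i < j else j < i)"
          using h(3) i' j' by blast
        then show "h i <\<^sub>V h j \<longleftrightarrow> ?\<theta> ! i < ?\<theta> ! j"
          by (simp only: \<theta>[OF i j])
      qed
    qed
    then show "\<tau> \<in> C"
      using C \<sigma>(1) \<tau>(1) unfolding perm_class_def by blast
  qed
  then show False
    using none c Xs unfolding contains_no_expansion_class_def by blast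
qed

theorem theorem5p10:
  fixes \<pi> :: "nat list" and C :: "nat list set"
  assumes "is_perm \<pi>" and "perm_class C"
  shows "(stable_occurrences_definable \<pi> C \<longleftrightarrow> contains_no_expansion_class \<pi> C) \<and>
         (contains_no_expansion_class \<pi> C \<longleftrightarrow> off_diagonal_bounded \<pi> C)"
  using assms off_diagonal_bounded_imp_definable definable_imp_no_expansion_class
    no_expansion_class_imp_off_diagonal_bounded by blast

end
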